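(* There exist countable ICC groups $G$ and $H$ such that $G$ and $H$ are elementarily equivalent as groups, but their group von Neumann algebras $L(G)$ and $L(H)$ are not elementarily equivalent (as tracial von Neumann algebras).
   Context: A group is ICC if all of its nontrivial conjugacy classes are infinite. Two groups are elementarily equivalent if they satisfy the same first-order sentences in the language of groups. For a countable group $G$, $L(G)$ denotes the group von Neumann algebra of $G$, i.e. the von Neumann algebra generated by the left regular representation of $G$ on $\ell^2(G)$, equipped with its canonical faithful normal trace $\tau(x)=\langle x\delta_e,\delta_e\rangle$. Two tracial von Neumann algebras are elementarily equivalent if they assign the same values to all sentences of continuous first-order logic in the language of tracial von Neumann algebras; equivalently (by the continuous Keisler-Shelah theorem), they have trace-preservingly isomorphic tracial ultrapowers with respect to some ultrafilters. *)

theory Defs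
  imports "HOL-Analysis.Function_Topology" "HOL-Analysis.Infinite_Sum" "HOL-Algebra.Module"
begin

section \<open>ICC groups\<close>

definition conjugacy_class :: "('a, 'b) monoid_scheme \<Rightarrow> 'a \<Rightarrow> 'a set" where
  "conjugacy_class G g = {h \<otimes>\<^bsub>G\<^esub> g \<otimes>\<^bsub>G\<^esub> inv\<^bsub>G\<^esub> h | h. h \<in> carrier G}"

definition icc :: "('a, 'b) monoid_scheme \<Rightarrow> bool" where
  "icc G \<longleftrightarrow> (\<forall>g\<in>carrier G. g \<noteq> \<one>\<^bsub>G\<^esub> \<longrightarrow> infinite (conjugacy_class G g))"

section \<open>First-order logic in the language of groups\<close>

datatype gterm = GVar nat | GOne | GMul gterm gterm | GInv gterm

datatype gform =
    GEq gterm gterm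
  | GNot gform
  | GAnd gform gform
  | GOr gform gform
  | GAll nat gform
  | GEx nat gform

primrec gterm_vars :: "gterm \<Rightarrow> nat set" where
  "gterm_vars (GVar i) = {i}"
| "gterm_vars GOne = {}"
| "gterm_vars (GMul t u) = gterm_vars t \<union> gterm_vars u"
| "gterm_vars (GInv t) = gterm_vars t"

primrec gform_free :: "gform \<Rightarrow> nat set" where
  "gform_free (GEq t u) = gterm_vars t \<union> gterm_vars u"
| "gform_free (GNot \<phi>) = gform_free \<phi>"
| "gform_free (GAnd \<phi> \<psi>) = gform_free \<phi> \<union> gform_free \<psi>"
| "gform_free (GOr \<phi> \<psi>) = gform_free \<phi> \<union> gform_free \<psi>"
| "gform_free (GAll i \<phi>) = gform_free \<phi> - {i}"
| "gform_free (GEx i \<phi>) = gform_free \<phi> - {i}"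

primrec gterm_eval :: "('a, 'b) monoid_scheme \<Rightarrow> (nat \<Rightarrow> 'a) \<Rightarrow> gterm \<Rightarrow> 'a" where
  "gterm_eval G s (GVar i) = s i"
| "gterm_eval G s GOne = \<one>\<^bsub>G\<^esub>"
| "gterm_eval G s (GMul t u) = gterm_eval G s t \<otimes>\<^bsub>G\<^esub> gterm_eval G s u"
| "gterm_eval G s (GInv t) = inv\<^bsub>G\<^esub> (gterm_eval G s t)"

primrec gform_sat :: "('a, 'b) monoid_scheme \<Rightarrow> (nat \<Rightarrow> 'a) \<Rightarrow> gform \<Rightarrow> bool" where
  "gform_sat G s (GEq t u) \<longleftrightarrow> gterm_eval G s t = gterm_eval G s u"
| "gform_sat G s (GNot \<phi>) \<longleftrightarrow> \<not> gform_sat G s \<phi>"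
| "gform_sat G s (GAnd \<phi> \<psi>) \<longleftrightarrow> gform_sat G s \<phi> \<and> gform_sat G s \<psi>"
| "gform_sat G s (GOr \<phi> \<psi>) \<longleftrightarrow> gform_sat G s \<phi> \<or> gform_sat G s \<psi>"
| "gform_sat G s (GAll i \<phi>) \<longleftrightarrow> (\<forall>a\<in>carrier G. gform_sat G (s(i := a)) \<phi>)"
| "gform_sat G s (GEx i \<phi>) \<longleftrightarrow> (\<exists>a\<in>carrier G. gform_sat G (s(i := a)) \<phi>)"

definition group_sentence :: "gform \<Rightarrow> bool" where
  "group_sentence \<phi> \<longleftrightarrow> gform_free \<phi> = {}"

text \<open>The truth of a sentence does not depend on the assignment; the constant one is used.\<close>

definition group_models :: "('a, 'b) monoid_scheme \<Rightarrow> gform \<Rightarrow> bool" where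
  "group_models G \<phi> \<longleftrightarrow> gform_sat G (\<lambda>_. \<one>\<^bsub>G\<^esub>) \<phi>"

definition group_elem_equiv :: "('a, 'b) monoid_scheme \<Rightarrow> ('c, 'd) monoid_scheme \<Rightarrow> bool" where
  "group_elem_equiv G H \<longleftrightarrow>
    (\<forall>\<phi>. group_sentence \<phi> \<longrightarrow> (group_models G \<phi> \<longleftrightarrow> group_models H \<phi>))"

section \<open>Continuous logic in the language of tracial von Neumann algebras\<close>

text \<open>The language of Farah, Hart and Sherman: *-algebra operations as function symbols, the trace
  and the 2-norm metric as relation symbols, and as domains of quantification the operator norm
  balls with radius a natural number. The structures extend the library's complex algebra
  signature (carrier, multiplication, one, zero, addition, scalar multiplication).\<close>

record 'x tracial_algebra = "(complex, 'x) module" +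
  adj :: "'x \<Rightarrow> 'x"
  opnorm :: "'x \<Rightarrow> real"
  tau :: "'x \<Rightarrow> complex"

definition norm_ball :: "('x, 'z) tracial_algebra_scheme \<Rightarrow> nat \<Rightarrow> 'x set" where
  "norm_ball M k = {a \<in> carrier M. opnorm M a \<le> real k}"

definition dist2 :: "('x, 'z) tracial_algebra_scheme \<Rightarrow> 'x \<Rightarrow> 'x \<Rightarrow> real" where
  "dist2 M a b =
    (let c = a \<oplus>\<^bsub>M\<^esub> (- 1) \<odot>\<^bsub>M\<^esub> b in sqrt (Re (tau M (adj M c \<otimes>\<^bsub>M\<^esub> c))))"

datatype tterm =
    TVar nat
  | TZero
  | TOne
  | TAdd tterm tterm
  | TMul tterm tterm
  | TScale complex tterm
  | TAdj tterm

text \<open>\<open>TSup i k \<phi>\<close> and \<open>TInf i k \<phi>\<close> quantify the variable \<open>i\<close> over the ball of radius \<open>k\<close>. In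
  \<open>TConn u \<phi>s\<close> the function \<open>u\<close> takes the values of the formulas \<open>\<phi>s\<close>, padded with zeros to a
  sequence. Every continuous function of finitely many real variables is the restriction of a
  continuous function on the product space of real sequences, and conversely, so with
  \<open>tform_wf\<close> below the connectives are exactly all continuous real functions of finitely many real
  variables.\<close>

datatype tform =
    TDist tterm tterm
  | TReTr tterm
  | TImTr tterm
  | TConn "(nat \<Rightarrow> real) \<Rightarrow> real" "tform list"
  | TSup nat nat tform
  | TInf nat nat tform

primrec tform_wf :: "tform \<Rightarrow> bool" where
  "tform_wf (TDist t u) \<longleftrightarrow> True"
| "tform_wf (TReTr t) \<longleftrightarrow> True"
| "tform_wf (TImTr t) \<longleftrightarrow> True"
| "tform_wf (TConn u \<phi>s) \<longleftrightarrow> continuous_on UNIV u \<and> list_all (\<lambda>b. b) (map tform_wf \<phi>s)"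
| "tform_wf (TSup i k \<phi>) \<longleftrightarrow> tform_wf \<phi>"
| "tform_wf (TInf i k \<phi>) \<longleftrightarrow> tform_wf \<phi>"

primrec tterm_vars :: "tterm \<Rightarrow> nat set" where
  "tterm_vars (TVar i) = {i}"
| "tterm_vars TZero = {}"
| "tterm_vars TOne = {}"
| "tterm_vars (TAdd t u) = tterm_vars t \<union> tterm_vars u"
| "tterm_vars (TMul t u) = tterm_vars t \<union> tterm_vars u"
| "tterm_vars (TScale c t) = tterm_vars t"
| "tterm_vars (TAdj t) = tterm_vars t"

primrec tform_free :: "tform \<Rightarrow> nat set" where
  "tform_free (TDist t u) = tterm_vars t \<union> tterm_vars u"
| "tform_free (TReTr t) = tterm_vars t"
| "tform_free (TImTr t) = tterm_vars t"
| "tform_free (TConn u \<phi>s) = \<Union> (set (map tform_free \<phi>s))"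
| "tform_free (TSup i k \<phi>) = tform_free \<phi> - {i}"
| "tform_free (TInf i k \<phi>) = tform_free \<phi> - {i}"

primrec tterm_eval :: "('x, 'z) tracial_algebra_scheme \<Rightarrow> (nat \<Rightarrow> 'x) \<Rightarrow> tterm \<Rightarrow> 'x" where
  "tterm_eval M s (TVar i) = s i"
| "tterm_eval M s TZero = \<zero>\<^bsub>M\<^esub>"
| "tterm_eval M s TOne = \<one>\<^bsub>M\<^esub>"
| "tterm_eval M s (TAdd t u) = tterm_eval M s t \<oplus>\<^bsub>M\<^esub> tterm_eval M s u"
| "tterm_eval M s (TMul t u) = tterm_eval M s t \<otimes>\<^bsub>M\<^esub> tterm_eval M s u"
| "tterm_eval M s (TScale c t) = c \<odot>\<^bsub>M\<^esub> tterm_eval M s t"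
| "tterm_eval M s (TAdj t) = adj M (tterm_eval M s t)"

primrec tform_eval :: "('x, 'z) tracial_algebra_scheme \<Rightarrow> tform \<Rightarrow> (nat \<Rightarrow> 'x) \<Rightarrow> real" where
  "tform_eval M (TDist t u) = (\<lambda>s. dist2 M (tterm_eval M s t) (tterm_eval M s u))"
| "tform_eval M (TReTr t) = (\<lambda>s. Re (tau M (tterm_eval M s t)))"
| "tform_eval M (TImTr t) = (\<lambda>s. Im (tau M (tterm_eval M s t)))"
| "tform_eval M (TConn u \<phi>s) =
    (\<lambda>s. let fs = map (tform_eval M) \<phi>s in u (\<lambda>i. if i < length fs then (fs ! i) s else 0))"
| "tform_eval M (TSup i k \<phi>) = (\<lambda>s. SUP a\<in>norm_ball M k. tform_eval M \<phi> (s(i := a)))"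
| "tform_eval M (TInf i k \<phi>) = (\<lambda>s. INF a\<in>norm_ball M k. tform_eval M \<phi> (s(i := a)))"

definition tracial_sentence :: "tform \<Rightarrow> bool" where
  "tracial_sentence \<phi> \<longleftrightarrow> tform_wf \<phi> \<and> tform_free \<phi> = {}"

definition sentence_value :: "('x, 'z) tracial_algebra_scheme \<Rightarrow> tform \<Rightarrow> real" where
  "sentence_value M \<phi> = tform_eval M \<phi> (\<lambda>_. \<zero>\<^bsub>M\<^esub>)"

definition tracial_elem_equiv ::
    "('x, 'y) tracial_algebra_scheme \<Rightarrow> ('z, 'w) tracial_algebra_scheme \<Rightarrow> bool" where
  "tracial_elem_equiv M N \<longleftrightarrow>
    (\<forall>\<phi>. tracial_sentence \<phi> \<longrightarrow> sentence_value M \<phi> = sentence_value N \<phi>)"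

section \<open>Bounded operators on the Hilbert space of square-summable functions\<close>

text \<open>Vectors are functions vanishing off the index set \<open>S\<close>, operators are functions that are
  undefined off \<open>ell2 S\<close>, so that HOL equality is equality of vectors and of operators. The inner
  product is linear in the first argument.\<close>

definition ell2 :: "'a set \<Rightarrow> ('a \<Rightarrow> complex) set" where
  "ell2 S = {f. (\<forall>x. x \<notin> S \<longrightarrow> f x = 0) \<and> (\<lambda>x. (cmod (f x))\<^sup>2) summable_on S}"

definition ell2_inner :: "'a set \<Rightarrow> ('a \<Rightarrow> complex) \<Rightarrow> ('a \<Rightarrow> complex) \<Rightarrow> complex" where
  "ell2_inner S f g = (\<Sum>\<^sub>\<infinity>x\<in>S. f x * cnj (g x))"

definition ell2_norm :: "'a set \<Rightarrow> ('a \<Rightarrow> complex) \<Rightarrow> real" where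
  "ell2_norm S f = sqrt (\<Sum>\<^sub>\<infinity>x\<in>S. (cmod (f x))\<^sup>2)"

definition delta :: "'a \<Rightarrow> 'a \<Rightarrow> complex" where
  "delta x = (\<lambda>y. if y = x then 1 else 0)"

type_synonym 'a operator = "('a \<Rightarrow> complex) \<Rightarrow> ('a \<Rightarrow> complex)"

definition bounded_ops :: "'a set \<Rightarrow> 'a operator set" where
  "bounded_ops S = {T. T \<in> ell2 S \<rightarrow>\<^sub>E ell2 S \<and>
    (\<forall>f\<in>ell2 S. \<forall>g\<in>ell2 S. T (\<lambda>x. f x + g x) = (\<lambda>x. T f x + T g x)) \<and>
    (\<forall>c. \<forall>f\<in>ell2 S. T (\<lambda>x. c * f x) = (\<lambda>x. c * T f x)) \<and>
    (\<exists>K. \<forall>f\<in>ell2 S. ell2_norm S (T f) \<le> K * ell2_norm S f)}"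

definition op_norm :: "'a set \<Rightarrow> 'a operator \<Rightarrow> real" where
  "op_norm S T = (SUP f\<in>{f \<in> ell2 S. ell2_norm S f \<le> 1}. ell2_norm S (T f))"

definition op_adjoint :: "'a set \<Rightarrow> 'a operator \<Rightarrow> 'a operator" where
  "op_adjoint S T = (THE A. A \<in> bounded_ops S \<and>
    (\<forall>f\<in>ell2 S. \<forall>g\<in>ell2 S. ell2_inner S (T f) g = ell2_inner S f (A g)))"

section \<open>Von Neumann algebras\<close>

definition commutant :: "'a set \<Rightarrow> 'a operator set \<Rightarrow> 'a operator set" where
  "commutant S X = {T \<in> bounded_ops S. \<forall>A\<in>X. compose (ell2 S) T A = compose (ell2 S) A T}"

definition von_neumann_algebra :: "'a set \<Rightarrow> 'a operator set \<Rightarrow> bool" where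
  "von_neumann_algebra S M \<longleftrightarrow>
    M \<subseteq> bounded_ops S \<and> (\<forall>T\<in>M. op_adjoint S T \<in> M) \<and> commutant S (commutant S M) = M"

definition vN_generated :: "'a set \<Rightarrow> 'a operator set \<Rightarrow> 'a operator set" where
  "vN_generated S X = \<Inter> {M. von_neumann_algebra S M \<and> X \<subseteq> M}"

definition operator_algebra ::
    "'a set \<Rightarrow> 'a operator set \<Rightarrow> ('a operator \<Rightarrow> complex) \<Rightarrow> 'a operator tracial_algebra" where
  "operator_algebra S M t =
    \<lparr> carrier = M,
      mult = compose (ell2 S),
      one = (\<lambda>f\<in>ell2 S. f),
      zero = (\<lambda>f\<in>ell2 S. \<lambda>x. 0),
      add = (\<lambda>T U. \<lambda>f\<in>ell2 S. \<lambda>x. T f x + U f x),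
      smult = (\<lambda>c T. \<lambda>f\<in>ell2 S. \<lambda>x. c * T f x),
      adj = op_adjoint S,
      opnorm = op_norm S,
      tau = t \<rparr>"

section \<open>Group von Neumann algebras\<close>

definition left_regular :: "('a, 'b) monoid_scheme \<Rightarrow> 'a \<Rightarrow> 'a operator" where
  "left_regular G g = (\<lambda>f\<in>ell2 (carrier G). \<lambda>h.
    if h \<in> carrier G then f (inv\<^bsub>G\<^esub> g \<otimes>\<^bsub>G\<^esub> h) else 0)"

definition group_vN :: "('a, 'b) monoid_scheme \<Rightarrow> 'a operator tracial_algebra" where
  "group_vN G = operator_algebra (carrier G)
    (vN_generated (carrier G) (left_regular G ` carrier G))
    (\<lambda>T. ell2_inner (carrier G) (T (delta \<one>\<^bsub>G\<^esub>)) (delta \<one>\<^bsub>G\<^esub>))"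

end

theory Submission
  imports Defs "HOL-Library.Countable" "HOL-Library.Z2" "HOL-Number_Theory.Residues"
    "HOL-Algebra.Algebraic_Closure_Type"
begin

text \<open>Let \<open>F\<close> be the algebraic closure of the field with two elements and \<open>H = F\<^sup>2 \<rtimes> SL\<^sub>2(F)\<close>. As \<open>F\<close> is
  a union of finite fields, every finite subset of \<open>H\<close> normalises arbitrarily large finite groups of
  translations, the group rings of which contain projections of trace about \<open>1/2\<close> commuting with the
  subset. So \<open>L(H)\<close> has property Gamma. The group \<open>H\<close> is elementarily equivalent to its ultrapower
  \<open>K\<^sup>2 \<rtimes> SL\<^sub>2(K)\<close>, where \<open>K\<close> is the ultrapower of \<open>F\<close>, and hence to a countable elementary subgroup \<open>G\<close>
  of the latter. Sending an element to its eigenlines (and a translation to its direction) defines an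
  equivariant map from \<open>G - {1}\<close> to the finite subsets of the projective line over \<open>K\<close>. Since
  \<open>K\<close> has a nontrivial valuation, \<open>G\<close> can be chosen to contain two matrices that play ping-pong on
  this line. Hence no unit vector of \<open>\<ell>\<^sup>2(G - {1})\<close> is almost invariant under conjugation by
  both, so \<open>L(G)\<close> does not have property Gamma.\<close>

section \<open>Elementary equivalence\<close>

text \<open>First-order sentences cannot see that \<open>F\<close> is locally finite while its
  ultrapower contains transcendental elements, and this difference decides between property Gamma
  and a spectral gap. For property Gamma it is not enough to average over a finite group of
  translations: the result is a projection of trace one over the group order, close to 0 in 2-norm.
  Hence sums of projections attached to many lines of a finite plane, over a set of lines invariant
  under the given matrices. The separating sentence ranges over the whole unit ball, so for
  \<open>H\<close> arbitrary operators must be treated: they are truncated to finite support, and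
  convolution by a projection, from either side, does not enlarge the remainder. For
  \<open>G\<close> two group elements suffice, and the ping-pong bound is quantitative: the values
  are at most 0 for \<open>H\<close> and at least 1/64 for \<open>G\<close>. Characteristic two
  gives -1 = 1, so that no nontrivial matrix of determinant one is scalar and each has only finitely
  many eigenlines; roots of quadratic equations in \<open>K\<close> provide at least one. The
  uniform measure on them turns ping-pong on lines into an inequality between masses.\<close>

instance gterm :: countable by countable_datatype
instance gform :: countable by countable_datatype

section \<open>Ultrafilters\<close>

locale ultrafilter =
  fixes F :: "'a filter"
  assumes proper: "F \<noteq> bot"
    and ultra: "eventually P F \<or> eventually (\<lambda>x. \<not> P x) F"
begin

lemma eventually_not_iff: "eventually (\<lambda>x. \<not> P x) F \<longleftrightarrow> \<not> eventually P F"
proof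
  assume "eventually (\<lambda>x. \<not> P x) F"
  moreover have "\<not> (eventually P F \<and> eventually (\<lambda>x. \<not> P x) F)"
    using proper eventually_elim2[of P F "\<lambda>x. \<not> P x" "\<lambda>_. False"] by auto
  ultimately show "\<not> eventually P F"
    by blast
qed (use ultra in blast)

lemma eventually_disj_iff:
  "eventually (\<lambda>x. P x \<or> Q x) F \<longleftrightarrow> eventually P F \<or> eventually Q F"
  using eventually_not_iff[of "\<lambda>x. \<not> P x \<and> \<not> Q x"] eventually_not_iff[of P] eventually_not_iff[of Q]
  by (simp add: eventually_conj_iff)

end

text \<open>A maximal proper filter decides every set, since otherwise it could be refined further.\<close>

lemma ultrafilter_exists:
  fixes F :: "'a filter"
  assumes "F \<noteq> bot"
  shows "\<exists>U\<le>F. ultrafilter U"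
proof -
  define r where "r = {(b, a). a \<noteq> bot \<and> a \<le> b \<and> b \<le> F}"
  have Fr: "Field r = {G. G \<noteq> bot \<and> G \<le> F}"
    by (auto simp: r_def Field_def bot_unique)
  have "\<exists>m\<in>Field r. \<forall>a\<in>Field r. (m, a) \<in> r \<longrightarrow> a = m"
  proof (rule Zorns_po_lemma)
    show "Partial_order r"
      by (auto simp: r_def partial_order_on_def preorder_on_def antisym_def refl_on_def trans_def
          Field_def bot_unique)
  next
    fix C assume C: "C \<in> Chains r"
    show "\<exists>u\<in>Field r. \<forall>a\<in>C. (a, u) \<in> r"
    proof (cases "C = {}")
      case True
      then show ?thesis
        using assms by (auto simp: Fr)
    next
      case False
      have *: "x \<noteq> bot" "x \<le> F" if "x \<in> C" for x
        using C that by (auto simp: Chains_def r_def)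
      \<comment> \<open>A chain is directed, so an event of the infimum is already an event of some
        member; the infimum is therefore proper.\<close>
      have "Inf C = bot \<longleftrightarrow> (\<exists>x\<in>C. x = bot)"
        unfolding trivial_limit_def
        by (intro eventually_Inf_base) (use C False in \<open>auto simp: Chains_def r_def\<close>)
      with * have nb: "Inf C \<noteq> bot"
        by auto
      have le: "Inf C \<le> x" if "x \<in> C" for x
        using that by (rule Inf_lower)
      obtain x where "x \<in> C"
        using False by auto
      with le * have "Inf C \<le> F"
        by (meson order_trans)
      with nb have "Inf C \<in> Field r"
        by (simp add: Fr)
      then show ?thesis
        by (rule bexI[rotated]) (use nb le * in \<open>simp add: r_def\<close>)
    qed
  qed
  then obtain U where U0: "U \<in> Field r" and max0: "\<And>a. a \<in> Field r \<Longrightarrow> (U, a) \<in> r \<Longrightarrow> a = U"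
    by blast
  then have U: "U \<noteq> bot" "U \<le> F"
    by (auto simp: Fr)
  have max: "G = U" if "G \<noteq> bot" "G \<le> U" for G
  proof (rule max0)
    show "G \<in> Field r" "(U, G) \<in> r"
      using that U order_trans[OF that(2) U(2)] by (simp_all add: Fr) (simp add: r_def)
  qed
  have "eventually P U \<or> eventually (\<lambda>x. \<not> P x) U" for P
  proof (rule disjCI)
    \<comment> \<open>The restriction of \<open>U\<close> to \<open>P\<close> is then still proper,
      and by maximality it is \<open>U\<close> itself.\<close>
    assume "\<not> eventually (\<lambda>x. \<not> P x) U"
    then have "inf U (principal {x. P x}) \<noteq> bot"
      by (simp add: trivial_limit_def eventually_inf_principal)
    then have "inf U (principal {x. P x}) = U"
      by (rule max) simp
    moreover have "eventually P (inf U (principal {x. P x}))"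
      by (simp add: eventually_inf_principal)
    ultimately show "eventually P U"
      by simp
  qed
  with U show ?thesis
    by (auto simp: ultrafilter_def)
qed

section \<open>Los's theorem for groups\<close>

lemma gterm_eval_closed:
  assumes "group G" "\<And>i. s i \<in> carrier G"
  shows "gterm_eval G s t \<in> carrier G"
proof -
  interpret group G by fact
  show ?thesis
    by (induction t) (use assms in auto)
qed

text \<open>The quotient map of an ultraproduct, given by its characteristic properties. Isomorphisms
  are the case of an index type with one element.\<close>

locale ultraproduct_map = ultrafilter F for F :: "'i filter" +
  fixes A :: "('a, 'c) monoid_scheme" and B :: "('b, 'd) monoid_scheme"
    and \<pi> :: "('i \<Rightarrow> 'a) \<Rightarrow> 'b"
  assumes A: "group A" and B: "group B"
    and closed: "(\<And>n. f n \<in> carrier A) \<Longrightarrow> \<pi> f \<in> carrier B"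
    and surj: "y \<in> carrier B \<Longrightarrow> \<exists>f. (\<forall>n. f n \<in> carrier A) \<and> \<pi> f = y"
    and eq_iff: "(\<And>n. f n \<in> carrier A) \<Longrightarrow> (\<And>n. g n \<in> carrier A) \<Longrightarrow>
      \<pi> f = \<pi> g \<longleftrightarrow> eventually (\<lambda>n. f n = g n) F"
    and mult: "(\<And>n. f n \<in> carrier A) \<Longrightarrow> (\<And>n. g n \<in> carrier A) \<Longrightarrow>
      \<pi> (\<lambda>n. f n \<otimes>\<^bsub>A\<^esub> g n) = \<pi> f \<otimes>\<^bsub>B\<^esub> \<pi> g"
begin

sublocale A: group A by (rule A)
sublocale B: group B by (rule B)

lemma one: "\<pi> (\<lambda>n. \<one>\<^bsub>A\<^esub>) = \<one>\<^bsub>B\<^esub>"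
  using mult[of "\<lambda>n. \<one>\<^bsub>A\<^esub>" "\<lambda>n. \<one>\<^bsub>A\<^esub>"] closed[of "\<lambda>n. \<one>\<^bsub>A\<^esub>"] by simp

lemma inverse: "(\<And>n. f n \<in> carrier A) \<Longrightarrow> \<pi> (\<lambda>n. inv\<^bsub>A\<^esub> (f n)) = inv\<^bsub>B\<^esub> (\<pi> f)"
  using mult[of "\<lambda>n. inv\<^bsub>A\<^esub> (f n)" f] one
  by (intro B.inv_equality[symmetric]) (simp_all add: closed)

lemma gterm_eval_eq:
  assumes "\<And>i n. s n i \<in> carrier A"
  shows "gterm_eval B (\<lambda>i. \<pi> (\<lambda>n. s n i)) t = \<pi> (\<lambda>n. gterm_eval A (s n) t)"
  by (induction t)
    (simp_all add: one mult inverse gterm_eval_closed A.group_axioms assms)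

text \<open>Conjunction passes through every filter, negation and disjunction through ultrafilters.
  For quantifiers, surjectivity of \<open>\<pi>\<close> replaces an element of \<open>B\<close> by a
  family in \<open>A\<close>, and witnesses are chosen in each coordinate.\<close>

lemma los_theorem:
  assumes "\<And>i n. s n i \<in> carrier A"
  shows "gform_sat B (\<lambda>i. \<pi> (\<lambda>n. s n i)) \<phi> \<longleftrightarrow> eventually (\<lambda>n. gform_sat A (s n) \<phi>) F"
  using assms
proof (induction \<phi> arbitrary: s)
  case (GEq t u)
  then show ?case
    by (simp add: gterm_eval_eq eq_iff gterm_eval_closed A.group_axioms)
next
  case (GNot \<phi>)
  then show ?case
    by (simp add: eventually_not_iff)
next
  case (GAnd \<phi> \<psi>)
  then show ?case
    by (simp add: eventually_conj_iff)
next
  case (GOr \<phi> \<psi>)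
  then show ?case
    by (simp add: eventually_disj_iff)
next
  case ex: (GEx i \<phi>)
  have upd: "(\<lambda>i. \<pi> (\<lambda>n. s n i))(i := \<pi> f) = (\<lambda>j. \<pi> (\<lambda>n. ((s n)(i := f n)) j))" for f
    by auto
  have IH: "gform_sat B ((\<lambda>i. \<pi> (\<lambda>n. s n i))(i := \<pi> f)) \<phi> \<longleftrightarrow>
      eventually (\<lambda>n. gform_sat A ((s n)(i := f n)) \<phi>) F" if "\<And>n. f n \<in> carrier A" for f
    unfolding upd by (rule ex.IH) (use ex.prems that in auto)
  show ?case
  proof
    assume "gform_sat B (\<lambda>i. \<pi> (\<lambda>n. s n i)) (GEx i \<phi>)"
    then obtain f where "\<And>n. f n \<in> carrier A" "gform_sat B ((\<lambda>i. \<pi> (\<lambda>n. s n i))(i := \<pi> f)) \<phi>"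
      using surj by auto
    with IH have "eventually (\<lambda>n. gform_sat A ((s n)(i := f n)) \<phi>) F" "\<And>n. f n \<in> carrier A"
      by auto
    then show "eventually (\<lambda>n. gform_sat A (s n) (GEx i \<phi>)) F"
      by (auto elim!: eventually_mono)
  next
    assume *: "eventually (\<lambda>n. gform_sat A (s n) (GEx i \<phi>)) F"
    \<comment> \<open>One family serves all coordinates: \<open>f n\<close> is a witness where there
      is one and an arbitrary element elsewhere.\<close>
    have "\<exists>f. \<forall>n. f n \<in> carrier A \<and> (gform_sat A (s n) (GEx i \<phi>) \<longrightarrow> gform_sat A ((s n)(i := f n)) \<phi>)"
    proof (intro choice allI)
      show "\<exists>y. y \<in> carrier A \<and> (gform_sat A (s n) (GEx i \<phi>) \<longrightarrow> gform_sat A ((s n)(i := y)) \<phi>)" for n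
        using A.one_closed by (cases "\<exists>a\<in>carrier A. gform_sat A ((s n)(i := a)) \<phi>") auto
    qed
    then obtain f where f: "\<And>n. f n \<in> carrier A"
      "\<And>n. gform_sat A (s n) (GEx i \<phi>) \<Longrightarrow> gform_sat A ((s n)(i := f n)) \<phi>"
      by blast
    have "eventually (\<lambda>n. gform_sat A ((s n)(i := f n)) \<phi>) F"
      using * by (rule eventually_mono) (rule f)
    then have "gform_sat B ((\<lambda>i. \<pi> (\<lambda>n. s n i))(i := \<pi> f)) \<phi>"
      using IH f(1) by blast
    with closed[OF f(1)] show "gform_sat B (\<lambda>i. \<pi> (\<lambda>n. s n i)) (GEx i \<phi>)"
      by auto
  qed
next
  case all: (GAll i \<phi>)
  have upd: "(\<lambda>i. \<pi> (\<lambda>n. s n i))(i := \<pi> f) = (\<lambda>j. \<pi> (\<lambda>n. ((s n)(i := f n)) j))" for f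
    by auto
  have IH: "gform_sat B ((\<lambda>i. \<pi> (\<lambda>n. s n i))(i := \<pi> f)) \<phi> \<longleftrightarrow>
      eventually (\<lambda>n. gform_sat A ((s n)(i := f n)) \<phi>) F" if "\<And>n. f n \<in> carrier A" for f
    unfolding upd by (rule all.IH) (use all.prems that in auto)
  show ?case
  proof
    assume *: "gform_sat B (\<lambda>i. \<pi> (\<lambda>n. s n i)) (GAll i \<phi>)"
    \<comment> \<open>Dually \<open>f n\<close> is a counterexample where there is one, so that the
      formula at \<open>f n\<close> decides the universal statement.\<close>
    have "\<exists>f. \<forall>n. f n \<in> carrier A \<and> (gform_sat A ((s n)(i := f n)) \<phi> \<longrightarrow> gform_sat A (s n) (GAll i \<phi>))"
    proof (intro choice allI)
      show "\<exists>y. y \<in> carrier A \<and> (gform_sat A ((s n)(i := y)) \<phi> \<longrightarrow> gform_sat A (s n) (GAll i \<phi>))" for n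
        using A.one_closed by (cases "\<exists>a\<in>carrier A. \<not> gform_sat A ((s n)(i := a)) \<phi>") auto
    qed
    then obtain f where f: "\<And>n. f n \<in> carrier A"
      "\<And>n. gform_sat A ((s n)(i := f n)) \<phi> \<Longrightarrow> gform_sat A (s n) (GAll i \<phi>)"
      by blast
    have "eventually (\<lambda>n. gform_sat A ((s n)(i := f n)) \<phi>) F"
      using * IH f closed by auto
    then show "eventually (\<lambda>n. gform_sat A (s n) (GAll i \<phi>)) F"
      by (rule eventually_mono) (rule f)
  next
    assume *: "eventually (\<lambda>n. gform_sat A (s n) (GAll i \<phi>)) F"
    have "gform_sat B ((\<lambda>i. \<pi> (\<lambda>n. s n i))(i := y)) \<phi>" if y: "y \<in> carrier B" for y
    proof -
      obtain f where f: "\<And>n. f n \<in> carrier A" "\<pi> f = y"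
        using surj[OF y] by auto
      have "eventually (\<lambda>n. gform_sat A ((s n)(i := f n)) \<phi>) F"
        using * by (rule eventually_mono) (use f in auto)
      with IH f show ?thesis
        by auto
    qed
    then show "gform_sat B (\<lambda>i. \<pi> (\<lambda>n. s n i)) (GAll i \<phi>)"
      by simp
  qed
qed

lemma group_elem_equiv: "group_elem_equiv A B"
proof -
  have "group_models B \<phi> \<longleftrightarrow> eventually (\<lambda>n. group_models A \<phi>) F" for \<phi>
    using los_theorem[of "\<lambda>_ _. \<one>\<^bsub>A\<^esub>" \<phi>] by (simp add: group_models_def one)
  then show ?thesis
    using proper by (simp add: group_elem_equiv_def eventually_const_iff)
qed

end

lemma group_elem_equiv_iso:
  assumes "group A" "group B" "f \<in> iso A B"
  shows "group_elem_equiv A B"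
proof -
  have f: "f \<in> hom A B" "bij_betw f (carrier A) (carrier B)"
    using assms(3) by (auto simp: iso_def)
  interpret ultraproduct_map "principal (UNIV :: unit set)" A B "\<lambda>g. f (g ())"
  proof (intro ultraproduct_map.intro ultraproduct_map_axioms.intro ultrafilter.intro)
    show "principal (UNIV :: unit set) \<noteq> bot"
      by (simp add: trivial_limit_def eventually_top)
    show "\<exists>g. (\<forall>n. g n \<in> carrier A) \<and> f (g ()) = y" if "y \<in> carrier B" for y
      using f(2) that by (force simp: bij_betw_def)
    show "f (g ()) \<in> carrier B" if "\<And>n. g n \<in> carrier A" for g
      using f(2) that by (force simp: bij_betw_def)
    show "f (g ()) = f (h ()) \<longleftrightarrow> eventually (\<lambda>n. g n = h n) (principal UNIV)"
      if "\<And>n. g n \<in> carrier A" "\<And>n. h n \<in> carrier A" for g h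
      using f(2) that by (auto simp: eventually_principal bij_betw_def inj_on_eq_iff)
    show "f (g () \<otimes>\<^bsub>A\<^esub> h ()) = f (g ()) \<otimes>\<^bsub>B\<^esub> f (h ())"
      if "\<And>n. g n \<in> carrier A" "\<And>n. h n \<in> carrier A" for g h
      using f(1) that by (auto simp: hom_mult)
  qed (use assms(1,2) in \<open>auto simp: eventually_principal\<close>)
  show ?thesis
    by (rule group_elem_equiv)
qed

lemma group_elem_equiv_sym: "group_elem_equiv A B \<Longrightarrow> group_elem_equiv B A"
  by (simp add: group_elem_equiv_def)

lemma group_elem_equiv_trans:
  "group_elem_equiv A B \<Longrightarrow> group_elem_equiv B C \<Longrightarrow> group_elem_equiv A C"
  by (simp add: group_elem_equiv_def)

section \<open>The downward Loewenheim-Skolem theorem\<close>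

lemma finite_gterm_vars: "finite (gterm_vars t)"
  by (induction t) auto

lemma finite_gform_free: "finite (gform_free \<phi>)"
  by (induction \<phi>) (auto simp: finite_gterm_vars)

lemma gterm_eval_cong:
  "(\<And>i. i \<in> gterm_vars t \<Longrightarrow> s i = s' i) \<Longrightarrow> gterm_eval G s t = gterm_eval G s' t"
  by (induction t) auto

lemma gform_sat_cong:
  "(\<And>i. i \<in> gform_free \<phi> \<Longrightarrow> s i = s' i) \<Longrightarrow> gform_sat G s \<phi> \<longleftrightarrow> gform_sat G s' \<phi>"
proof (induction \<phi> arbitrary: s s')
  case (GEq t u)
  then show ?case
    using gterm_eval_cong[of t s s' G] gterm_eval_cong[of u s s' G] by auto
next
  case (GNot \<phi>)
  then show ?case
    by (metis gform_free.simps(2) gform_sat.simps(2))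
next
  case (GAnd \<phi> \<psi>)
  then show ?case
    by (metis UnCI gform_free.simps(3) gform_sat.simps(3))
next
  case (GOr \<phi> \<psi>)
  then show ?case
    by (metis UnCI gform_free.simps(4) gform_sat.simps(4))
next
  case (GAll i \<phi>)
  have "gform_sat G (s(i := a)) \<phi> \<longleftrightarrow> gform_sat G (s'(i := a)) \<phi>" for a
    by (rule GAll.IH) (use GAll.prems in auto)
  then show ?case
    by simp
next
  case (GEx i \<phi>)
  have "gform_sat G (s(i := a)) \<phi> \<longleftrightarrow> gform_sat G (s'(i := a)) \<phi>" for a
    by (rule GEx.IH) (use GEx.prems in auto)
  then show ?case
    by simp
qed

text \<open>The Tarski-Vaught test. The universal case applies the witness property to the negated
  formula; being a subgroup ensures that inverses computed in \<open>C\<close> and in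
  \<open>G\<close> agree.\<close>

lemma tarski_vaught:
  fixes G :: "('a, 'b) monoid_scheme"
  assumes G: "group G" and C: "subgroup C G"
    and wit: "\<And>\<phi> i s. range s \<subseteq> C \<Longrightarrow> gform_sat G s (GEx i \<phi>) \<Longrightarrow>
      \<exists>a\<in>C. gform_sat G (s(i := a)) \<phi>"
  shows "range s \<subseteq> C \<Longrightarrow> gform_sat (G\<lparr>carrier := C\<rparr>) s \<phi> \<longleftrightarrow> gform_sat G s \<phi>"
proof (induction \<phi> arbitrary: s)
  case (GEq t u)
  interpret group G by fact
  interpret C: group "G\<lparr>carrier := C\<rparr>"
    using C by (rule subgroup_imp_group)
  have "gterm_eval (G\<lparr>carrier := C\<rparr>) s t = gterm_eval G s t" for t
  proof (induction t)
    case (GInv t)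
    have "gterm_eval (G\<lparr>carrier := C\<rparr>) s t \<in> C"
      using gterm_eval_closed[OF C.group_axioms, of s t] GEq by auto
    with GInv show ?case
      using m_inv_consistent[OF C] by simp
  qed simp_all
  then show ?case
    by simp
next
  case (GAll i \<phi>)
  have IH: "gform_sat (G\<lparr>carrier := C\<rparr>) (s(i := a)) \<phi> \<longleftrightarrow> gform_sat G (s(i := a)) \<phi>"
    if "a \<in> C" for a
    by (rule GAll.IH) (use GAll.prems that in auto)
  show ?case
    using IH wit[of s i "GNot \<phi>"] GAll.prems subgroup.subset[OF C] by auto
next
  case (GEx i \<phi>)
  have IH: "gform_sat (G\<lparr>carrier := C\<rparr>) (s(i := a)) \<phi> \<longleftrightarrow> gform_sat G (s(i := a)) \<phi>"
    if "a \<in> C" for a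
    by (rule GEx.IH) (use GEx.prems that in auto)
  show ?case
    using IH wit[of s i \<phi>] GEx.prems subgroup.subset[OF C] by auto
qed auto

text \<open>Closing \<open>A\<close> under Skolem functions gives a countable set with the witness
  property, since there are countably many formulas and countably many finite lists of
  parameters.\<close>

lemma lowenheim_skolem:
  fixes G :: "('a, 'b) monoid_scheme"
  assumes G: "group G" and A: "countable A" "A \<subseteq> carrier G"
  obtains C where "subgroup C G" "A \<subseteq> C" "countable C" "group_elem_equiv G (G\<lparr>carrier := C\<rparr>)"
proof -
  interpret group G by fact
  \<comment> \<open>Assignments are coded by finite lists padded with the identity: lists over a
    countable set form a countable set, unlike functions on \<open>nat\<close>.\<close>
  define asg where "asg xs = (\<lambda>j. if j < length xs then xs ! j else \<one>\<^bsub>G\<^esub>)" for xs :: "'a list"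
  define sk where "sk = (\<lambda>(\<phi>, i, xs). SOME a. a \<in> carrier G \<and>
    ((\<exists>b\<in>carrier G. gform_sat G ((asg xs)(i := b)) \<phi>) \<longrightarrow> gform_sat G ((asg xs)(i := a)) \<phi>))"
  have "\<exists>a. a \<in> carrier G \<and>
    ((\<exists>b\<in>carrier G. gform_sat G ((asg xs)(i := b)) \<phi>) \<longrightarrow> gform_sat G ((asg xs)(i := a)) \<phi>)" for xs i \<phi>
    using one_closed by blast
  then have "sk (\<phi>, i, xs) \<in> carrier G \<and>
    ((\<exists>b\<in>carrier G. gform_sat G ((asg xs)(i := b)) \<phi>) \<longrightarrow> gform_sat G ((asg xs)(i := sk (\<phi>, i, xs))) \<phi>)"
    for xs i \<phi>
    unfolding sk_def prod.case by (rule someI_ex)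
  then have sk: "sk (\<phi>, i, xs) \<in> carrier G"
    "b \<in> carrier G \<Longrightarrow> gform_sat G ((asg xs)(i := b)) \<phi> \<Longrightarrow> gform_sat G ((asg xs)(i := sk (\<phi>, i, xs))) \<phi>"
    for xs i \<phi> b
    by blast+
  define D where "D = rec_nat (insert \<one>\<^bsub>G\<^esub> A) (\<lambda>_ Y. Y \<union> sk ` (UNIV \<times> UNIV \<times> lists Y))"
  have D0: "D 0 = insert \<one>\<^bsub>G\<^esub> A" and DS: "D (Suc n) = D n \<union> sk ` (UNIV \<times> UNIV \<times> lists (D n))" for n
    by (auto simp: D_def)
  define C where "C = (\<Union>n. D n)"
  have "countable (D n)" for n
    by (induction n) (auto simp: D0 DS A intro!: countable_SIGMA countable_lists)
  then have "countable C"
    by (auto simp: C_def)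
  have "D n \<subseteq> carrier G" for n
    by (induction n) (use A sk(1) in \<open>auto simp: D0 DS\<close>)
  then have CG: "C \<subseteq> carrier G"
    by (auto simp: C_def)
  have Dmono: "m \<le> n \<Longrightarrow> D m \<subseteq> D n" for m n
    by (rule lift_Suc_mono_le) (auto simp: DS)
  have lists: "\<exists>n. set xs \<subseteq> D n" if "set xs \<subseteq> C" for xs
    using that
  proof (induction xs)
    case (Cons x xs)
    then obtain m n where "set xs \<subseteq> D m" "x \<in> D n"
      by (auto simp: C_def)
    then have "set (x # xs) \<subseteq> D (max m n)"
      using Dmono[of m "max m n"] Dmono[of n "max m n"] by auto
    then show ?case
      by blast
  qed auto
  have wit: "\<exists>a\<in>C. gform_sat G (s(i := a)) \<phi>"
    if s: "range s \<subseteq> C" and ex: "gform_sat G s (GEx i \<phi>)" for \<phi> i s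
  proof -
    \<comment> \<open>One more than the largest free variable, so the list of the first
      \<open>N\<close> values determines the truth of \<open>\<phi>\<close>. Inserting 0 covers
      formulas without free variables.\<close>
    define N where "N = Suc (Max (insert 0 (gform_free \<phi>)))"
    define xs where "xs = map s [0..<N]"
    have agree: "asg xs j = s j" if "j \<in> gform_free \<phi>" for j
    proof -
      have "j < N"
        unfolding N_def
        by (intro le_imp_less_Suc Max_ge) (use that in \<open>auto simp: finite_gform_free\<close>)
      then show ?thesis
        by (simp add: asg_def xs_def)
    qed
    then have sat: "gform_sat G ((asg xs)(i := a)) \<phi> \<longleftrightarrow> gform_sat G (s(i := a)) \<phi>" for a
      by (intro gform_sat_cong) auto
    obtain b where "b \<in> carrier G" "gform_sat G ((asg xs)(i := b)) \<phi>"
      using ex sat by auto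
    then have "gform_sat G (s(i := sk (\<phi>, i, xs))) \<phi>"
      using sk(2) sat by blast
    moreover have "set xs \<subseteq> C"
      using s by (auto simp: xs_def)
    then obtain n where "set xs \<subseteq> D n"
      using lists by blast
    then have "sk (\<phi>, i, xs) \<in> D (Suc n)"
      by (auto simp: DS)
    then have "sk (\<phi>, i, xs) \<in> C"
      by (auto simp: C_def)
    ultimately show ?thesis
      by blast
  qed
  have one: "\<one>\<^bsub>G\<^esub> \<in> C"
    by (auto simp: C_def D0 intro!: exI[of _ 0])
  \<comment> \<open>Closure under the operations is itself a case of the witness property, for
    equations that define the inverse and the product.\<close>
  have C: "subgroup C G"
  proof (rule subgroupI)
    show "C \<subseteq> carrier G" "C \<noteq> {}"
      using CG one by auto
    fix x assume x: "x \<in> C"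
    show "inv\<^bsub>G\<^esub> x \<in> C"
      using wit[of "(\<lambda>_. \<one>\<^bsub>G\<^esub>)(0 := x)" 1 "GEq (GVar 1) (GInv (GVar 0))"] x one CG by auto
    fix y assume y: "y \<in> C"
    show "x \<otimes>\<^bsub>G\<^esub> y \<in> C"
      using wit[of "(\<lambda>_. \<one>\<^bsub>G\<^esub>)(0 := x, 1 := y)" 2 "GEq (GVar 2) (GMul (GVar 0) (GVar 1))"] x y one CG
      by auto
  qed
  have "group_elem_equiv G (G\<lparr>carrier := C\<rparr>)"
    using tarski_vaught[OF G C wit, of "\<lambda>_. \<one>\<^bsub>G\<^esub>"] one
    by (auto simp: group_elem_equiv_def group_models_def)
  moreover have "A \<subseteq> C"
    by (auto simp: C_def D0 intro!: exI[of _ 0])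
  ultimately show ?thesis
    using that C \<open>countable C\<close> by blast
qed

text \<open>The groups constructed consist of matrices and vectors, whereas the theorem asks for
  groups on natural numbers; an enumeration transports the structure.\<close>

lemma countable_group_nat_copy:
  assumes "group G" "countable (carrier G)"
  obtains B :: "nat monoid" and f where "group B" "f \<in> iso G B"
proof -
  interpret group G by fact
  define f where "f = to_nat_on (carrier G)"
  define g where "g = from_nat_into (carrier G)"
  have fg: "g (f x) = x" if "x \<in> carrier G" for x
    using that assms(2) by (simp add: f_def g_def)
  define B where "B = \<lparr>carrier = f ` carrier G, mult = (\<lambda>x y. f (g x \<otimes>\<^bsub>G\<^esub> g y)), one = f \<one>\<^bsub>G\<^esub>\<rparr>"
  have iso: "f \<in> iso G B"
    using fg by (auto simp: iso_def hom_def B_def bij_betw_def intro!: inj_onI) metis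
  have "group B"
  proof (rule groupI)
    fix x assume "x \<in> carrier B"
    then obtain y where y: "y \<in> carrier G" "x = f y"
      by (auto simp: B_def)
    then show "\<exists>z\<in>carrier B. z \<otimes>\<^bsub>B\<^esub> x = \<one>\<^bsub>B\<^esub>"
      by (auto simp: B_def fg intro!: bexI[of _ "inv\<^bsub>G\<^esub> y"])
  qed (auto simp: B_def fg m_assoc)
  then show ?thesis
    using iso that by blast
qed

section \<open>Square-summable functions\<close>

lemma ell2_summable: "f \<in> ell2 S \<Longrightarrow> (\<lambda>x. (cmod (f x))\<^sup>2) summable_on S"
  by (simp add: ell2_def)

lemma ell2_off: "f \<in> ell2 S \<Longrightarrow> x \<notin> S \<Longrightarrow> f x = 0"
  by (simp add: ell2_def)

lemma ell2_comparison:
  assumes "h summable_on S" "\<And>x. x \<in> S \<Longrightarrow> (cmod (g x))\<^sup>2 \<le> h x" "\<And>x. x \<notin> S \<Longrightarrow> g x = 0"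
  shows "g \<in> ell2 S"
proof -
  have "(\<lambda>x. (cmod (g x))\<^sup>2) summable_on S"
    by (rule summable_on_comparison_test[OF assms(1)]) (use assms(2) in auto)
  with assms(3) show ?thesis
    by (simp add: ell2_def)
qed

lemma cmod_add_sq_le: "(cmod (a + b))\<^sup>2 \<le> 2 * (cmod a)\<^sup>2 + 2 * (cmod b)\<^sup>2"
proof -
  have "(cmod (a + b))\<^sup>2 \<le> (cmod a + cmod b)\<^sup>2"
    by (intro power_mono norm_triangle_ineq) auto
  also have "\<dots> \<le> 2 * (cmod a)\<^sup>2 + 2 * (cmod b)\<^sup>2"
    using zero_le_power2[of "cmod a - cmod b"] by (simp add: power2_eq_square algebra_simps)
  finally show ?thesis .
qed

lemma ell2_zero [simp]: "(\<lambda>x. 0) \<in> ell2 S"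
  by (simp add: ell2_def)

lemma ell2_add: "f \<in> ell2 S \<Longrightarrow> g \<in> ell2 S \<Longrightarrow> (\<lambda>x. f x + g x) \<in> ell2 S"
  by (rule ell2_comparison[where h = "\<lambda>x. 2 * (cmod (f x))\<^sup>2 + 2 * (cmod (g x))\<^sup>2"])
    (auto simp: ell2_off cmod_add_sq_le intro!: summable_on_add summable_on_cmult_right ell2_summable)

lemma ell2_scale: "f \<in> ell2 S \<Longrightarrow> (\<lambda>x. c * f x) \<in> ell2 S"
  by (rule ell2_comparison[where h = "\<lambda>x. (cmod c)\<^sup>2 * (cmod (f x))\<^sup>2"])
    (auto simp: ell2_off norm_mult power_mult_distrib intro!: summable_on_cmult_right ell2_summable)

lemma ell2_diff: "f \<in> ell2 S \<Longrightarrow> g \<in> ell2 S \<Longrightarrow> (\<lambda>x. f x - g x) \<in> ell2 S"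
  using ell2_add[of f S "\<lambda>x. - 1 * g x"] ell2_scale[of g S "- 1"] by simp

lemma ell2_sum: "(\<And>i. i \<in> I \<Longrightarrow> f i \<in> ell2 S) \<Longrightarrow> (\<lambda>x. \<Sum>i\<in>I. f i x) \<in> ell2 S"
  by (induction I rule: infinite_finite_induct) (auto intro: ell2_add)

lemma ell2_if: "f \<in> ell2 S \<Longrightarrow> (\<lambda>x. if P x then f x else 0) \<in> ell2 S"
  by (rule ell2_comparison[OF ell2_summable]) (auto simp: ell2_off)

lemma delta_ell2 [simp]: "x \<in> S \<Longrightarrow> delta x \<in> ell2 S"
proof -
  assume "x \<in> S"
  have "(\<lambda>y. (cmod (delta x y))\<^sup>2) summable_on S \<longleftrightarrow> (\<lambda>y. (cmod (delta x y))\<^sup>2) summable_on {x}"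
    by (rule summable_on_cong_neutral) (auto simp: delta_def \<open>x \<in> S\<close>)
  with \<open>x \<in> S\<close> show ?thesis
    by (auto simp: ell2_def delta_def)
qed

lemma ell2_inner_abs_summable:
  assumes "f \<in> ell2 S" "g \<in> ell2 S"
  shows "(\<lambda>x. f x * cnj (g x)) abs_summable_on S"
proof (rule summable_on_comparison_test)
  show "(\<lambda>x. (cmod (f x))\<^sup>2 + (cmod (g x))\<^sup>2) summable_on S"
    using assms by (intro summable_on_add ell2_summable)
  show "norm (f x * cnj (g x)) \<le> (cmod (f x))\<^sup>2 + (cmod (g x))\<^sup>2" for x
  proof -
    have "0 \<le> cmod (f x) * cmod (g x)"
      by simp
    then show ?thesis
      using sum_squares_bound[of "cmod (f x)" "cmod (g x)"]
      unfolding norm_mult complex_mod_cnj by linarith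
  qed
qed auto

lemma ell2_inner_summable:
  "f \<in> ell2 S \<Longrightarrow> g \<in> ell2 S \<Longrightarrow> (\<lambda>x. f x * cnj (g x)) summable_on S"
  by (rule abs_summable_summable) (rule ell2_inner_abs_summable)

lemma ell2_inner_add_left:
  "f \<in> ell2 S \<Longrightarrow> g \<in> ell2 S \<Longrightarrow> h \<in> ell2 S \<Longrightarrow>
    ell2_inner S (\<lambda>x. f x + g x) h = ell2_inner S f h + ell2_inner S g h"
  by (simp add: ell2_inner_def distrib_right infsum_add ell2_inner_summable)

lemma ell2_inner_scale_left: "ell2_inner S (\<lambda>x. c * f x) h = c * ell2_inner S f h"
  by (simp add: ell2_inner_def mult.assoc infsum_cmult_right')

lemma ell2_inner_cnj: "ell2_inner S g f = cnj (ell2_inner S f g)"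
  by (simp add: ell2_inner_def mult.commute flip: infsum_cnj)

lemma ell2_inner_add_right:
  "f \<in> ell2 S \<Longrightarrow> g \<in> ell2 S \<Longrightarrow> h \<in> ell2 S \<Longrightarrow>
    ell2_inner S h (\<lambda>x. f x + g x) = ell2_inner S h f + ell2_inner S h g"
  by (subst (1 2 3) ell2_inner_cnj) (simp add: ell2_inner_add_left)

lemma ell2_inner_scale_right: "ell2_inner S h (\<lambda>x. c * f x) = cnj c * ell2_inner S h f"
  by (subst (1 2) ell2_inner_cnj) (simp add: ell2_inner_scale_left)

lemma ell2_norm_nonneg [simp]: "0 \<le> ell2_norm S f"
  by (simp add: ell2_norm_def infsum_nonneg)

lemma ell2_norm_sq: "(ell2_norm S f)\<^sup>2 = (\<Sum>\<^sub>\<infinity>x\<in>S. (cmod (f x))\<^sup>2)"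
  by (simp add: ell2_norm_def infsum_nonneg)

lemma ell2_norm_zero [simp]: "ell2_norm S (\<lambda>x. 0) = 0"
  by (simp add: ell2_norm_def)

lemma ell2_inner_self: "f \<in> ell2 S \<Longrightarrow> ell2_inner S f f = of_real ((ell2_norm S f)\<^sup>2)"
proof -
  assume f: "f \<in> ell2 S"
  have "ell2_inner S f f = (\<Sum>\<^sub>\<infinity>x\<in>S. of_real ((cmod (f x))\<^sup>2))"
    unfolding ell2_inner_def by (simp only: complex_norm_square)
  also have "\<dots> = of_real (\<Sum>\<^sub>\<infinity>x\<in>S. (cmod (f x))\<^sup>2)"
    by (rule infsumI has_sum_of_real has_sum_infsum ell2_summable f)+
  finally show ?thesis
    by (simp add: ell2_norm_sq)
qed

lemma ell2_inner_delta: "x \<in> S \<Longrightarrow> ell2_inner S f (delta x) = f x"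
proof -
  assume "x \<in> S"
  then have "ell2_inner S f (delta x) = (\<Sum>\<^sub>\<infinity>y\<in>{x}. f y * cnj (delta x y))"
    unfolding ell2_inner_def by (intro infsum_cong_neutral) (auto simp: delta_def)
  then show ?thesis
    by (simp add: delta_def)
qed

lemma ell2_norm_delta [simp]: "x \<in> S \<Longrightarrow> ell2_norm S (delta x) = 1"
proof -
  assume "x \<in> S"
  then have "complex_of_real ((ell2_norm S (delta x))\<^sup>2) = 1"
    by (subst ell2_inner_self[symmetric]) (simp_all add: ell2_inner_delta, simp add: delta_def)
  then have "(ell2_norm S (delta x))\<^sup>2 = 1"
    using of_real_eq_1_iff by blast
  then show ?thesis
    using ell2_norm_nonneg[of S "delta x"] by (simp add: power2_eq_1_iff)
qed

lemma ell2_eqI: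
  assumes "u \<in> ell2 S" "v \<in> ell2 S" "\<And>f. f \<in> ell2 S \<Longrightarrow> ell2_inner S f u = ell2_inner S f v"
  shows "u = v"
proof
  fix x
  show "u x = v x"
  proof (cases "x \<in> S")
    case True
    have "ell2_inner S u (delta x) = ell2_inner S v (delta x)"
      using assms(3)[of "delta x"] True by (subst (1 2) ell2_inner_cnj) simp
    with True show ?thesis
      by (simp add: ell2_inner_delta)
  qed (use assms in \<open>simp add: ell2_off\<close>)
qed

lemma ell2_norm_add_sq:
  assumes "f \<in> ell2 S" "g \<in> ell2 S"
  shows "(ell2_norm S (\<lambda>x. f x + g x))\<^sup>2 = (ell2_norm S f)\<^sup>2 + (ell2_norm S g)\<^sup>2 + 2 * Re (ell2_inner S f g)"
proof -
  have "complex_of_real ((ell2_norm S (\<lambda>x. f x + g x))\<^sup>2) =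
      of_real ((ell2_norm S f)\<^sup>2) + of_real ((ell2_norm S g)\<^sup>2) + (ell2_inner S f g + ell2_inner S g f)"
    by (subst (1 2 3) ell2_inner_self[symmetric])
      (simp_all add: assms ell2_inner_add_left ell2_inner_add_right ell2_add)
  then have "Re (complex_of_real ((ell2_norm S (\<lambda>x. f x + g x))\<^sup>2)) =
      Re (of_real ((ell2_norm S f)\<^sup>2) + of_real ((ell2_norm S g)\<^sup>2) + (ell2_inner S f g + ell2_inner S g f))"
    by (rule arg_cong)
  moreover have "Re (ell2_inner S g f) = Re (ell2_inner S f g)"
    by (subst ell2_inner_cnj) simp
  ultimately show ?thesis
    by simp
qed

lemma ell2_norm_scale: "ell2_norm S (\<lambda>x. c * f x) = cmod c * ell2_norm S f"
proof -
  have "(ell2_norm S (\<lambda>x. c * f x))\<^sup>2 = (cmod c * ell2_norm S f)\<^sup>2"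
    by (simp add: ell2_norm_sq norm_mult power_mult_distrib infsum_cmult_right')
  then show ?thesis
    by (simp add: power2_eq_iff_nonneg)
qed

lemma ell2_inner_eq_0:
  assumes "f \<in> ell2 S" "ell2_norm S f = 0"
  shows "f = (\<lambda>x. 0)"
proof
  fix x
  have "(\<Sum>\<^sub>\<infinity>x\<in>S. (cmod (f x))\<^sup>2) = 0"
    using assms(2) ell2_norm_sq[of S f] by simp
  then have "x \<in> S \<Longrightarrow> (cmod (f x))\<^sup>2 = 0"
    using nonneg_infsum_le_0D[of "\<lambda>x. (cmod (f x))\<^sup>2" S x] ell2_summable[OF assms(1)] by auto
  then show "f x = 0"
    using ell2_off[OF assms(1), of x] by auto
qed

lemma ell2_cauchy_schwarz:
  assumes f: "f \<in> ell2 S" and g: "g \<in> ell2 S"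
  shows "cmod (ell2_inner S f g) \<le> ell2_norm S f * ell2_norm S g"
proof (cases "ell2_norm S g = 0")
  case True
  then have "g = (\<lambda>x. 0)"
    using g by (rule ell2_inner_eq_0[rotated])
  then show ?thesis
    by (simp add: ell2_inner_def)
next
  case False
  define B where "B = (ell2_norm S g)\<^sup>2"
  have B: "B > 0"
    using False by (simp add: B_def)
  define I where "I = ell2_inner S f g"
  \<comment> \<open>This coefficient minimises the norm of \<open>f + c g\<close>.\<close>
  define c where "c = - I / of_real B"
  have "0 \<le> (ell2_norm S (\<lambda>x. f x + c * g x))\<^sup>2"
    by simp
  also have "\<dots> = (ell2_norm S f)\<^sup>2 + (cmod c)\<^sup>2 * B + 2 * Re (cnj c * I)"
    by (simp add: ell2_norm_add_sq f g ell2_scale ell2_norm_scale ell2_inner_scale_right power_mult_distrib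
        B_def I_def)
  also have "cnj c * I = - of_real ((cmod I)\<^sup>2 / B)"
    unfolding c_def by (simp add: complex_norm_square mult.commute del: of_real_power)
  also have "(cmod c)\<^sup>2 * B = (cmod I)\<^sup>2 / B"
    using B by (simp add: c_def norm_divide power_divide power2_eq_square)
  finally have "(cmod I)\<^sup>2 / B \<le> (ell2_norm S f)\<^sup>2"
    by simp
  then have "(cmod I)\<^sup>2 \<le> (ell2_norm S f * ell2_norm S g)\<^sup>2"
    using B by (simp add: B_def field_simps power_mult_distrib)
  then show ?thesis
    unfolding I_def by (rule power2_le_imp_le) simp
qed

lemma ell2_norm_triangle:
  assumes f: "f \<in> ell2 S" and g: "g \<in> ell2 S"
  shows "ell2_norm S (\<lambda>x. f x + g x) \<le> ell2_norm S f + ell2_norm S g"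
proof (rule power2_le_imp_le)
  have "Re (ell2_inner S f g) \<le> ell2_norm S f * ell2_norm S g"
    using ell2_cauchy_schwarz[OF f g] complex_Re_le_cmod order_trans by blast
  then show "(ell2_norm S (\<lambda>x. f x + g x))\<^sup>2 \<le> (ell2_norm S f + ell2_norm S g)\<^sup>2"
    by (simp add: ell2_norm_add_sq f g power2_sum)
qed simp

lemma ell2_norm_diff_triangle:
  assumes f: "f \<in> ell2 S" and g: "g \<in> ell2 S"
  shows "ell2_norm S (\<lambda>x. f x - g x) \<le> ell2_norm S f + ell2_norm S g"
  using ell2_norm_triangle[OF f ell2_scale[OF g, of "- 1"]] ell2_norm_scale[of S "- 1" g] by simp

text \<open>Density of the finitely supported functions, stated through the tail because the finite
  part is always treated exactly and only the tail is estimated.\<close>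

lemma ell2_finite_approx:
  assumes f: "f \<in> ell2 S" and "\<epsilon> > 0"
  obtains E where "finite E" "E \<subseteq> S" "ell2_norm S (\<lambda>x. if x \<in> E then 0 else f x) \<le> \<epsilon>"
proof -
  obtain E where E: "finite E" "E \<subseteq> S"
    and app: "dist (\<Sum>x\<in>E. (cmod (f x))\<^sup>2) (\<Sum>\<^sub>\<infinity>x\<in>S. (cmod (f x))\<^sup>2) \<le> \<epsilon>\<^sup>2"
    using infsum_finite_approximation[OF ell2_summable[OF f], of "\<epsilon>\<^sup>2"] \<open>\<epsilon> > 0\<close> by auto
  have "(\<Sum>\<^sub>\<infinity>x\<in>S. (cmod (if x \<in> E then 0 else f x))\<^sup>2) = (\<Sum>\<^sub>\<infinity>x\<in>S - E. (cmod (f x))\<^sup>2)"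
    by (rule infsum_cong_neutral) auto
  also have "\<dots> = (\<Sum>\<^sub>\<infinity>x\<in>S. (cmod (f x))\<^sup>2) - (\<Sum>\<^sub>\<infinity>x\<in>E. (cmod (f x))\<^sup>2)"
    using E by (intro infsum_Diff ell2_summable[OF f]) auto
  also have "\<dots> \<le> \<epsilon>\<^sup>2"
    using app E by (simp add: dist_real_def)
  finally have "(ell2_norm S (\<lambda>x. if x \<in> E then 0 else f x))\<^sup>2 \<le> \<epsilon>\<^sup>2"
    by (simp add: ell2_norm_sq)
  then have "ell2_norm S (\<lambda>x. if x \<in> E then 0 else f x) \<le> \<epsilon>"
    by (rule power2_le_imp_le) (use \<open>\<epsilon> > 0\<close> in simp)
  with E that show ?thesis
    by blast
qed

section \<open>Bounded operators and adjoints\<close>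

lemma bounded_ops_closed: "T \<in> bounded_ops S \<Longrightarrow> f \<in> ell2 S \<Longrightarrow> T f \<in> ell2 S"
  by (auto simp: bounded_ops_def)

lemma bounded_ops_undefined: "T \<in> bounded_ops S \<Longrightarrow> f \<notin> ell2 S \<Longrightarrow> T f = undefined"
  by (auto simp: bounded_ops_def)

lemma bounded_ops_add:
  "T \<in> bounded_ops S \<Longrightarrow> f \<in> ell2 S \<Longrightarrow> g \<in> ell2 S \<Longrightarrow> T (\<lambda>x. f x + g x) = (\<lambda>x. T f x + T g x)"
  by (auto simp: bounded_ops_def)

lemma bounded_ops_scale:
  "T \<in> bounded_ops S \<Longrightarrow> f \<in> ell2 S \<Longrightarrow> T (\<lambda>x. c * f x) = (\<lambda>x. c * T f x)"
  by (auto simp: bounded_ops_def)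

lemma bounded_ops_zero: "T \<in> bounded_ops S \<Longrightarrow> T (\<lambda>x. 0) = (\<lambda>x. 0)"
  using bounded_ops_scale[of T S "\<lambda>x. 0" 0] by simp

lemma bounded_ops_sum:
  assumes "T \<in> bounded_ops S" "\<And>i. i \<in> I \<Longrightarrow> f i \<in> ell2 S"
  shows "T (\<lambda>x. \<Sum>i\<in>I. f i x) = (\<lambda>x. \<Sum>i\<in>I. T (f i) x)"
  using assms(2)
  by (induction I rule: infinite_finite_induct)
    (simp_all add: bounded_ops_zero[OF assms(1)] bounded_ops_add[OF assms(1)] ell2_sum)

lemma bounded_ops_bound:
  assumes "T \<in> bounded_ops S"
  obtains K where "K \<ge> 0" "\<And>f. f \<in> ell2 S \<Longrightarrow> ell2_norm S (T f) \<le> K * ell2_norm S f"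
proof -
  obtain K where K: "\<forall>f\<in>ell2 S. ell2_norm S (T f) \<le> K * ell2_norm S f"
    using assms by (auto simp: bounded_ops_def)
  show ?thesis
  proof (rule that[of "\<bar>K\<bar>"])
    fix f assume "f \<in> ell2 S"
    then have "ell2_norm S (T f) \<le> K * ell2_norm S f"
      using K by blast
    also have "\<dots> \<le> \<bar>K\<bar> * ell2_norm S f"
      by (intro mult_right_mono) auto
    finally show "ell2_norm S (T f) \<le> \<bar>K\<bar> * ell2_norm S f" .
  qed simp
qed

lemma bounded_opsI:
  assumes "\<And>f. f \<notin> ell2 S \<Longrightarrow> T f = undefined"
    "\<And>f. f \<in> ell2 S \<Longrightarrow> T f \<in> ell2 S"
    "\<And>f g. f \<in> ell2 S \<Longrightarrow> g \<in> ell2 S \<Longrightarrow> T (\<lambda>x. f x + g x) = (\<lambda>x. T f x + T g x)"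
    "\<And>c f. f \<in> ell2 S \<Longrightarrow> T (\<lambda>x. c * f x) = (\<lambda>x. c * T f x)"
    "\<And>f. f \<in> ell2 S \<Longrightarrow> ell2_norm S (T f) \<le> K * ell2_norm S f"
  shows "T \<in> bounded_ops S"
proof -
  have "T \<in> ell2 S \<rightarrow>\<^sub>E ell2 S"
    using assms(1,2) by (intro PiE_I) auto
  then show ?thesis
    unfolding bounded_ops_def using assms(3-5) by blast
qed

lemma bounded_ops_compose:
  assumes T: "T \<in> bounded_ops S" and U: "U \<in> bounded_ops S"
  shows "compose (ell2 S) T U \<in> bounded_ops S"
proof -
  obtain K where K: "K \<ge> 0" "\<And>f. f \<in> ell2 S \<Longrightarrow> ell2_norm S (T f) \<le> K * ell2_norm S f"
    using bounded_ops_bound[OF T] by blast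
  obtain L where L: "L \<ge> 0" "\<And>f. f \<in> ell2 S \<Longrightarrow> ell2_norm S (U f) \<le> L * ell2_norm S f"
    using bounded_ops_bound[OF U] by blast
  have "ell2_norm S (T (U f)) \<le> (K * L) * ell2_norm S f" if "f \<in> ell2 S" for f
  proof -
    have "ell2_norm S (T (U f)) \<le> K * ell2_norm S (U f)"
      using K that U by (simp add: bounded_ops_closed)
    also have "\<dots> \<le> K * (L * ell2_norm S f)"
      using K L that by (intro mult_left_mono) auto
    finally show ?thesis
      by (simp add: mult.assoc)
  qed
  then show ?thesis
    using T U
    by (intro bounded_opsI[where K = "K * L"])
      (auto simp: compose_def bounded_ops_closed bounded_ops_add bounded_ops_scale ell2_add ell2_scale)
qed

lemma bounded_ops_lincomb:
  assumes T: "T \<in> bounded_ops S" and U: "U \<in> bounded_ops S"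
  shows "(\<lambda>f\<in>ell2 S. \<lambda>x. T f x + c * U f x) \<in> bounded_ops S"
proof -
  obtain K where K: "K \<ge> 0" "\<And>f. f \<in> ell2 S \<Longrightarrow> ell2_norm S (T f) \<le> K * ell2_norm S f"
    using bounded_ops_bound[OF T] by blast
  obtain L where L: "L \<ge> 0" "\<And>f. f \<in> ell2 S \<Longrightarrow> ell2_norm S (U f) \<le> L * ell2_norm S f"
    using bounded_ops_bound[OF U] by blast
  have "ell2_norm S (\<lambda>x. T f x + c * U f x) \<le> (K + cmod c * L) * ell2_norm S f" if "f \<in> ell2 S" for f
  proof -
    have "ell2_norm S (\<lambda>x. T f x + c * U f x) \<le> ell2_norm S (T f) + cmod c * ell2_norm S (U f)"
      using ell2_norm_triangle[of "T f" S "\<lambda>x. c * U f x"] that T U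
      by (simp add: bounded_ops_closed ell2_scale ell2_norm_scale)
    also have "\<dots> \<le> K * ell2_norm S f + cmod c * (L * ell2_norm S f)"
      using K L that by (intro add_mono mult_left_mono) auto
    finally show ?thesis
      by (simp add: algebra_simps)
  qed
  then show ?thesis
    using T U
    by (intro bounded_opsI[where K = "K + cmod c * L"])
      (auto simp: bounded_ops_closed bounded_ops_add bounded_ops_scale ell2_add ell2_scale algebra_simps)
qed

text \<open>The adjoint of \<open>T\<close> must send \<open>g\<close> to \<open>x \<mapsto> \<langle>g, T \<delta>\<^sub>x\<rangle>\<close>. This is square-summable: testing on
  finite sets \<open>E\<close>, the sum of its squares over \<open>E\<close> is \<open>\<langle>g, T u\<rangle>\<close>, with \<open>u\<close> its restriction to \<open>E\<close>.\<close>

lemma bounded_ops_adjoint_exists: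
  assumes T: "T \<in> bounded_ops S"
  obtains A where "A \<in> bounded_ops S"
    "\<And>f g. f \<in> ell2 S \<Longrightarrow> g \<in> ell2 S \<Longrightarrow> ell2_inner S (T f) g = ell2_inner S f (A g)"
proof -
  obtain K where K: "K \<ge> 0" "\<And>f. f \<in> ell2 S \<Longrightarrow> ell2_norm S (T f) \<le> K * ell2_norm S f"
    using bounded_ops_bound[OF T] by blast
  define a where "a g x = (if x \<in> S then ell2_inner S g (T (delta x)) else 0)" for g x
  have fin: "ell2_inner S (T (\<lambda>x. if x \<in> E then f x else 0)) g = (\<Sum>x\<in>E. f x * cnj (a g x))"
    if "finite E" "E \<subseteq> S" "g \<in> ell2 S" for f g E
  proof -
    have "(\<lambda>x. if x \<in> E then f x else 0) = (\<lambda>x. \<Sum>y\<in>E. f y * delta y x)"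
      using \<open>finite E\<close> by (simp add: delta_def if_distrib cong: if_cong)
    then have "T (\<lambda>x. if x \<in> E then f x else 0) = (\<lambda>x. \<Sum>y\<in>E. f y * T (delta y) x)"
      using that T bounded_ops_sum[OF T, of E "\<lambda>y x. f y * delta y x"]
      by (simp add: bounded_ops_scale ell2_scale subset_iff)
    then have "ell2_inner S (T (\<lambda>x. if x \<in> E then f x else 0)) g =
        ell2_inner S (\<lambda>x. \<Sum>y\<in>E. f y * T (delta y) x) g"
      by (rule arg_cong)
    also have "ell2_inner S (\<lambda>x. \<Sum>y\<in>E. f y * T (delta y) x) g = (\<Sum>y\<in>E. f y * ell2_inner S (T (delta y)) g)"
      using \<open>finite E\<close> \<open>E \<subseteq> S\<close>
    proof (induction E)
      case (insert y E)
      then show ?case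
        using T \<open>g \<in> ell2 S\<close>
        by (simp add: ell2_inner_add_left ell2_inner_scale_left ell2_scale ell2_sum bounded_ops_closed subset_iff)
    qed (simp add: ell2_inner_def)
    also have "\<dots> = (\<Sum>x\<in>E. f x * cnj (a g x))"
      using that by (intro sum.cong refl) (auto simp: a_def simp flip: ell2_inner_cnj)
    finally show ?thesis .
  qed
  have bound: "(\<Sum>x\<in>E. (cmod (a g x))\<^sup>2) \<le> (K * ell2_norm S g)\<^sup>2"
    if E: "finite E" "E \<subseteq> S" and g: "g \<in> ell2 S" for E g
  proof -
    define u where "u = (\<lambda>x. if x \<in> E then a g x else 0)"
    have "(\<lambda>x. (cmod (u x))\<^sup>2) summable_on S \<longleftrightarrow> (\<lambda>x. (cmod (u x))\<^sup>2) summable_on E"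
      using E by (intro summable_on_cong_neutral) (auto simp: u_def)
    then have u: "u \<in> ell2 S"
      using E by (auto simp: ell2_def u_def a_def)
    define s where "s = (\<Sum>x\<in>E. (cmod (a g x))\<^sup>2)"
    have s: "s \<ge> 0"
      by (simp add: s_def sum_nonneg)
    have "(\<Sum>\<^sub>\<infinity>x\<in>S. (cmod (u x))\<^sup>2) = (\<Sum>\<^sub>\<infinity>x\<in>E. (cmod (u x))\<^sup>2)"
      using E by (intro infsum_cong_neutral) (auto simp: u_def)
    then have nu: "(ell2_norm S u)\<^sup>2 = s"
      using E by (simp add: ell2_norm_sq s_def u_def)
    have "ell2_inner S (T u) g = of_real s"
      using fin[OF E g, of "a g"] by (simp only: u_def s_def of_real_sum complex_norm_square)
    then have "s \<le> cmod (ell2_inner S (T u) g)"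
      using s by simp
    also have "\<dots> \<le> ell2_norm S (T u) * ell2_norm S g"
      using u g T by (intro ell2_cauchy_schwarz bounded_ops_closed[OF T])
    also have "\<dots> \<le> (K * ell2_norm S u) * ell2_norm S g"
      using u K by (intro mult_right_mono) auto
    \<comment> \<open>Squaring turns the norm of \<open>u\<close> into \<open>s\<close>, so that one
      factor \<open>s\<close> cancels on both sides.\<close>
    finally have "s\<^sup>2 \<le> ((K * ell2_norm S g) * ell2_norm S u)\<^sup>2"
      using s by (intro power_mono) (auto simp: mult.commute mult.left_commute)
    also have "\<dots> = (K * ell2_norm S g)\<^sup>2 * s"
      using nu by (simp add: power_mult_distrib)
    finally show ?thesis
      using s unfolding s_def[symmetric]
      by (cases "s = 0") (auto simp: power2_eq_square)
  qed
  have summ: "(\<lambda>x. (cmod (a g x))\<^sup>2) summable_on S" if "g \<in> ell2 S" for g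
    by (rule nonneg_bounded_partial_sums_imp_summable_on[where C = "(K * ell2_norm S g)\<^sup>2"])
      (use bound that in \<open>auto simp: eventually_finite_subsets_at_top intro!: exI[of _ "{}"]\<close>)
  then have a_ell2: "a g \<in> ell2 S" if "g \<in> ell2 S" for g
    using that by (auto simp: ell2_def a_def)
  have a_norm: "ell2_norm S (a g) \<le> K * ell2_norm S g" if "g \<in> ell2 S" for g
  proof (rule power2_le_imp_le)
    show "(ell2_norm S (a g))\<^sup>2 \<le> (K * ell2_norm S g)\<^sup>2"
      unfolding ell2_norm_sq[of S "a g"]
      by (rule infsum_le_finite_sums) (use summ bound that in auto)
  qed (use K in simp)
  have adj: "ell2_inner S (T f) g = ell2_inner S f (a g)" if f: "f \<in> ell2 S" and g: "g \<in> ell2 S" for f g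
  proof -
    have "cmod (ell2_inner S (T f) g - ell2_inner S f (a g)) \<le> 0 + e" if "e > 0" for e
    proof -
      \<comment> \<open>The summand 1 keeps the divisor positive even if \<open>K\<close> or
        \<open>g\<close> vanishes.\<close>
      define M where "M = 2 * K * ell2_norm S g + 1"
      have M: "M > 0"
        using K by (simp add: M_def add_nonneg_pos)
      obtain E where E: "finite E" "E \<subseteq> S" "ell2_norm S (\<lambda>x. if x \<in> E then 0 else f x) \<le> e / M"
        using ell2_finite_approx[OF f, of "e / M"] \<open>e > 0\<close> M by auto
      define f0 where "f0 = (\<lambda>x. if x \<in> E then f x else 0)"
      define f1 where "f1 = (\<lambda>x. if x \<in> E then 0 else f x)"
      have f01: "f0 \<in> ell2 S" "f1 \<in> ell2 S"
        using ell2_if[OF f, of "\<lambda>x. x \<in> E"] ell2_diff[OF f ell2_if[OF f, of "\<lambda>x. x \<in> E"]]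
        by (simp_all add: f0_def f1_def if_distrib cong: if_cong)
      have fdec: "f = (\<lambda>x. f0 x + f1 x)"
        by (auto simp: f0_def f1_def)
      have "ell2_inner S f0 (a g) = (\<Sum>\<^sub>\<infinity>x\<in>E. f x * cnj (a g x))"
        unfolding ell2_inner_def using E by (intro infsum_cong_neutral) (auto simp: f0_def)
      then have "ell2_inner S (T f0) g = ell2_inner S f0 (a g)"
        using fin[OF E(1,2) g, of f] E(1) by (simp add: f0_def)
      then have "ell2_inner S (T f) g - ell2_inner S f (a g) = ell2_inner S (T f1) g - ell2_inner S f1 (a g)"
        using f01 g T a_ell2
        by (subst (1 2) fdec) (simp add: bounded_ops_add ell2_inner_add_left bounded_ops_closed)
      also have "cmod \<dots> \<le> cmod (ell2_inner S (T f1) g) + cmod (ell2_inner S f1 (a g))"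
        by (rule norm_triangle_ineq4)
      also have "\<dots> \<le> ell2_norm S (T f1) * ell2_norm S g + ell2_norm S f1 * ell2_norm S (a g)"
        using f01 g T a_ell2 by (intro add_mono ell2_cauchy_schwarz bounded_ops_closed[OF T])
      also have "\<dots> \<le> (K * ell2_norm S f1) * ell2_norm S g + ell2_norm S f1 * (K * ell2_norm S g)"
        using f01 g K a_norm by (intro add_mono mult_mono) auto
      also have "\<dots> = ell2_norm S f1 * (2 * K * ell2_norm S g)"
        by simp
      also have "\<dots> \<le> (e / M) * M"
        using E(3) K M \<open>e > 0\<close> by (intro mult_mono) (auto simp: f1_def M_def)
      finally show ?thesis
        using M by simp
    qed
    then have "cmod (ell2_inner S (T f) g - ell2_inner S f (a g)) \<le> 0"
      by (rule field_le_epsilon)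
    then show ?thesis
      by simp
  qed
  define A where "A = restrict a (ell2 S)"
  have "A \<in> bounded_ops S"
  proof (rule bounded_opsI[where K = K])
    show "A (\<lambda>x. f x + g x) = (\<lambda>x. A f x + A g x)" if "f \<in> ell2 S" "g \<in> ell2 S" for f g
      using that T by (auto simp: A_def ell2_add a_def ell2_inner_add_left bounded_ops_closed)
    show "A (\<lambda>x. c * f x) = (\<lambda>x. c * A f x)" if "f \<in> ell2 S" for c f
      using that by (auto simp: A_def ell2_scale a_def ell2_inner_scale_left)
  qed (simp_all add: A_def a_ell2 a_norm)
  then show ?thesis
    using adj by (intro that[of A]) (simp_all add: A_def)
qed

lemma op_adjoint_props:
  assumes T: "T \<in> bounded_ops S"
  shows "op_adjoint S T \<in> bounded_ops S \<and>
    (\<forall>f\<in>ell2 S. \<forall>g\<in>ell2 S. ell2_inner S (T f) g = ell2_inner S f (op_adjoint S T g))"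
proof -
  obtain A where A: "A \<in> bounded_ops S"
    "\<And>f g. f \<in> ell2 S \<Longrightarrow> g \<in> ell2 S \<Longrightarrow> ell2_inner S (T f) g = ell2_inner S f (A g)"
    using bounded_ops_adjoint_exists[OF T] by blast
  have "\<exists>!A. A \<in> bounded_ops S \<and>
    (\<forall>f\<in>ell2 S. \<forall>g\<in>ell2 S. ell2_inner S (T f) g = ell2_inner S f (A g))"
  proof (rule ex1I[of _ A])
    fix B assume B: "B \<in> bounded_ops S \<and>
      (\<forall>f\<in>ell2 S. \<forall>g\<in>ell2 S. ell2_inner S (T f) g = ell2_inner S f (B g))"
    show "B = A"
    proof
      fix g
      show "B g = A g"
      proof (cases "g \<in> ell2 S")
        case True
        then show ?thesis
          using A B by (intro ell2_eqI[of _ S]) (auto simp: bounded_ops_closed)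
      qed (use A(1) B in \<open>metis bounded_ops_undefined\<close>)
    qed
  qed (use A in auto)
  then show ?thesis
    unfolding op_adjoint_def by (rule theI')
qed

lemmas op_adjoint_bounded = op_adjoint_props[THEN conjunct1]
  and op_adjoint_inner = op_adjoint_props[THEN conjunct2, rule_format]

lemma op_adjointI:
  assumes "T \<in> bounded_ops S" "A \<in> bounded_ops S"
    "\<And>f g. f \<in> ell2 S \<Longrightarrow> g \<in> ell2 S \<Longrightarrow> ell2_inner S (T f) g = ell2_inner S f (A g)"
  shows "op_adjoint S T = A"
proof
  fix g
  show "op_adjoint S T g = A g"
  proof (cases "g \<in> ell2 S")
    case True
    then show ?thesis
      using assms op_adjoint_props[OF assms(1)] by (intro ell2_eqI[of _ S]) (auto simp: bounded_ops_closed)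
  qed (use assms op_adjoint_props[OF assms(1)] in \<open>metis bounded_ops_undefined\<close>)
qed

section \<open>Commutants and the operator norm\<close>

lemma commutantD:
  "T \<in> commutant S Y \<Longrightarrow> T \<in> bounded_ops S"
  "T \<in> commutant S Y \<Longrightarrow> A \<in> Y \<Longrightarrow> f \<in> ell2 S \<Longrightarrow> T (A f) = A (T f)"
proof -
  show "T \<in> commutant S Y \<Longrightarrow> T \<in> bounded_ops S"
    by (simp add: commutant_def)
  assume "T \<in> commutant S Y" "A \<in> Y" "f \<in> ell2 S"
  then have "compose (ell2 S) T A f = compose (ell2 S) A T f"
    by (simp add: commutant_def)
  with \<open>f \<in> ell2 S\<close> show "T (A f) = A (T f)"
    by (simp add: compose_def)
qed

lemma commutantI:
  assumes "T \<in> bounded_ops S" "\<And>A f. A \<in> Y \<Longrightarrow> f \<in> ell2 S \<Longrightarrow> T (A f) = A (T f)"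
  shows "T \<in> commutant S Y"
  using assms by (auto simp: commutant_def compose_def fun_eq_iff)

text \<open>The triple commutant always equals the commutant, so only adjoints need an argument: if
  \<open>T\<close> commutes with the adjoint of \<open>A\<close>, then the adjoint of
  \<open>T\<close> commutes with \<open>A\<close>.\<close>

lemma von_neumann_algebra_commutant:
  assumes Y: "Y \<subseteq> bounded_ops S" "\<And>T. T \<in> Y \<Longrightarrow> op_adjoint S T \<in> Y"
  shows "von_neumann_algebra S (commutant S Y)"
  unfolding von_neumann_algebra_def
proof (intro conjI ballI)
  show "commutant S Y \<subseteq> bounded_ops S"
    by (auto simp: commutantD)
  show "commutant S (commutant S (commutant S Y)) = commutant S Y"
    using Y(1) by (fastforce simp: commutant_def)
  fix T assume T: "T \<in> commutant S Y"
  note Tb = commutantD(1)[OF T] and Ta = op_adjoint_bounded[OF commutantD(1)[OF T]]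
  show "op_adjoint S T \<in> commutant S Y"
  proof (rule commutantI[OF Ta])
    fix A g assume A: "A \<in> Y" and g: "g \<in> ell2 S"
    define B where "B = op_adjoint S A"
    have Ab: "A \<in> bounded_ops S" and B: "B \<in> Y" "B \<in> bounded_ops S"
      using A Y by (auto simp: B_def)
    have adj: "ell2_inner S f (A h) = ell2_inner S (B f) h" if "f \<in> ell2 S" "h \<in> ell2 S" for f h
    proof -
      have "ell2_inner S f (A h) = cnj (ell2_inner S (A h) f)"
        by (rule ell2_inner_cnj)
      also have "\<dots> = cnj (ell2_inner S h (B f))"
        using that Ab by (simp add: op_adjoint_inner B_def)
      also have "\<dots> = ell2_inner S (B f) h"
        by (rule ell2_inner_cnj[symmetric])
      finally show ?thesis .
    qed
    show "op_adjoint S T (A g) = A (op_adjoint S T g)"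
    proof (rule ell2_eqI)
      fix f assume f: "f \<in> ell2 S"
      have "ell2_inner S f (op_adjoint S T (A g)) = ell2_inner S (T f) (A g)"
        using f g Tb Ab by (simp add: op_adjoint_inner bounded_ops_closed)
      also have "\<dots> = ell2_inner S (B (T f)) g"
        using f g Tb by (simp add: adj bounded_ops_closed)
      also have "B (T f) = T (B f)"
        using commutantD(2)[OF T B(1) f] by simp
      also have "ell2_inner S (T (B f)) g = ell2_inner S f (A (op_adjoint S T g))"
        using f g Tb Ta B by (simp add: adj op_adjoint_inner bounded_ops_closed)
      finally show "ell2_inner S f (op_adjoint S T (A g)) = ell2_inner S f (A (op_adjoint S T g))" .
    qed (use g Ab Ta in \<open>simp_all add: bounded_ops_closed\<close>)
  qed
qed

lemma op_norm_upper:
  assumes T: "T \<in> bounded_ops S" and f: "f \<in> ell2 S" "ell2_norm S f \<le> 1"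
  shows "ell2_norm S (T f) \<le> op_norm S T"
proof -
  obtain K where K: "K \<ge> 0" "\<And>f. f \<in> ell2 S \<Longrightarrow> ell2_norm S (T f) \<le> K * ell2_norm S f"
    using bounded_ops_bound[OF T] by blast
  have "ell2_norm S (T g) \<le> K" if "g \<in> ell2 S" "ell2_norm S g \<le> 1" for g
    using K(2)[OF that(1)] mult_left_mono[OF that(2) K(1)] by simp
  then have "bdd_above ((\<lambda>f. ell2_norm S (T f)) ` {f \<in> ell2 S. ell2_norm S f \<le> 1})"
    by (auto intro!: bdd_aboveI[of _ K])
  then show ?thesis
    unfolding op_norm_def using f by (intro cSUP_upper) auto
qed

lemma op_norm_le_1:
  assumes "\<And>f. f \<in> ell2 S \<Longrightarrow> ell2_norm S (T f) \<le> ell2_norm S f"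
  shows "op_norm S T \<le> 1"
  unfolding op_norm_def
proof (rule cSUP_least)
  show "{f \<in> ell2 S. ell2_norm S f \<le> 1} \<noteq> {}"
    by (auto intro!: exI[of _ "\<lambda>x. 0"])
qed (use assms order_trans in blast)

section \<open>Permutation operators\<close>

text \<open>Left and right translations of a group are both of this form, as is every action by
  permutations, so that boundedness, norms and adjoints are computed once.\<close>

definition perm_op :: "'a set \<Rightarrow> ('a \<Rightarrow> 'a) \<Rightarrow> 'a operator" where
  "perm_op S \<phi> = (\<lambda>f\<in>ell2 S. \<lambda>x. if x \<in> S then f (\<phi> x) else 0)"

lemma perm_op_apply: "f \<in> ell2 S \<Longrightarrow> perm_op S \<phi> f = (\<lambda>x. if x \<in> S then f (\<phi> x) else 0)"
  by (simp add: perm_op_def)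

lemma perm_op_ell2:
  assumes "bij_betw \<phi> S S" "f \<in> ell2 S"
  shows "(\<lambda>x. if x \<in> S then f (\<phi> x) else 0) \<in> ell2 S"
proof -
  have "(\<lambda>x. (cmod (f (\<phi> x)))\<^sup>2) summable_on S"
    using summable_on_reindex_bij_betw[OF assms(1), of "\<lambda>x. (cmod (f x))\<^sup>2"] ell2_summable[OF assms(2)]
    by simp
  then show ?thesis
    by (rule ell2_comparison) auto
qed

lemma perm_op_norm:
  assumes "bij_betw \<phi> S S"
  shows "ell2_norm S (\<lambda>x. if x \<in> S then f (\<phi> x) else 0) = ell2_norm S f"
proof -
  have "(\<Sum>\<^sub>\<infinity>x\<in>S. (cmod (if x \<in> S then f (\<phi> x) else 0))\<^sup>2) = (\<Sum>\<^sub>\<infinity>x\<in>S. (cmod (f (\<phi> x)))\<^sup>2)"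
    by (rule infsum_cong) auto
  also have "\<dots> = (\<Sum>\<^sub>\<infinity>x\<in>S. (cmod (f x))\<^sup>2)"
    by (rule infsum_reindex_bij_betw[OF assms])
  finally show ?thesis
    by (simp add: ell2_norm_def)
qed

lemma perm_op_bounded:
  assumes "bij_betw \<phi> S S"
  shows "perm_op S \<phi> \<in> bounded_ops S"
proof (rule bounded_opsI[where K = 1])
  fix f assume f: "f \<in> ell2 S"
  show "perm_op S \<phi> f \<in> ell2 S" "ell2_norm S (perm_op S \<phi> f) \<le> 1 * ell2_norm S f"
    using f by (simp_all add: perm_op_apply perm_op_ell2[OF assms] perm_op_norm[OF assms])
  show "perm_op S \<phi> (\<lambda>x. c * f x) = (\<lambda>x. c * perm_op S \<phi> f x)" for c
    using f by (auto simp: perm_op_apply ell2_scale)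
  show "perm_op S \<phi> (\<lambda>x. f x + g x) = (\<lambda>x. perm_op S \<phi> f x + perm_op S \<phi> g x)" if "g \<in> ell2 S" for g
    using f that by (auto simp: perm_op_apply ell2_add)
qed (simp add: perm_op_def)

lemma perm_op_inner:
  assumes \<phi>: "\<phi> \<in> S \<rightarrow> S" and \<psi>: "\<psi> \<in> S \<rightarrow> S"
    and inv: "\<And>x. x \<in> S \<Longrightarrow> \<psi> (\<phi> x) = x" "\<And>x. x \<in> S \<Longrightarrow> \<phi> (\<psi> x) = x"
    and fg: "f \<in> ell2 S" "g \<in> ell2 S"
  shows "ell2_inner S (perm_op S \<phi> f) g = ell2_inner S f (perm_op S \<psi> g)"
proof -
  have \<psi>_bij: "bij_betw \<psi> S S"
    by (rule bij_betwI[where g = \<phi>]) (use assms in auto)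
  have "ell2_inner S (perm_op S \<phi> f) g = (\<Sum>\<^sub>\<infinity>x\<in>S. f (\<phi> x) * cnj (g x))"
    unfolding ell2_inner_def by (rule infsum_cong) (use fg in \<open>auto simp: perm_op_def\<close>)
  also have "\<dots> = (\<Sum>\<^sub>\<infinity>x\<in>S. f (\<phi> (\<psi> x)) * cnj (g (\<psi> x)))"
    by (rule infsum_reindex_bij_betw[OF \<psi>_bij, symmetric])
  also have "\<dots> = ell2_inner S f (perm_op S \<psi> g)"
    unfolding ell2_inner_def by (rule infsum_cong) (use fg inv in \<open>auto simp: perm_op_def\<close>)
  finally show ?thesis .
qed

section \<open>Elements of group von Neumann algebras\<close>

text \<open>The group ring element with coefficients \<open>c\<close> on \<open>N\<close>, acting by
  left convolution.\<close>

definition conv_op :: "('a, 'b) monoid_scheme \<Rightarrow> 'a set \<Rightarrow> ('a \<Rightarrow> complex) \<Rightarrow> 'a operator" where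
  "conv_op G N c = (\<lambda>f\<in>ell2 (carrier G). \<lambda>x. \<Sum>h\<in>N. c h * left_regular G h f x)"

context group begin

lemma left_regular_eq: "left_regular G g = perm_op (carrier G) (\<lambda>x. inv g \<otimes> x)"
  by (simp add: left_regular_def perm_op_def)

lemma bij_left: "g \<in> carrier G \<Longrightarrow> bij_betw (\<lambda>x. g \<otimes> x) (carrier G) (carrier G)"
  by (rule bij_betwI[where g = "\<lambda>x. inv g \<otimes> x"]) (auto simp: m_assoc[symmetric])

lemma bij_right: "g \<in> carrier G \<Longrightarrow> bij_betw (\<lambda>x. x \<otimes> g) (carrier G) (carrier G)"
  by (rule bij_betwI[where g = "\<lambda>x. x \<otimes> inv g"]) (auto simp: m_assoc)

lemma left_regular_bounded: "g \<in> carrier G \<Longrightarrow> left_regular G g \<in> bounded_ops (carrier G)"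
  by (simp add: left_regular_eq perm_op_bounded bij_left)

text \<open>The commutant of the right translations is a von Neumann algebra that contains the left
  translations, hence contains the algebra they generate.\<close>

lemma vN_generated_commutes_right:
  assumes T: "T \<in> vN_generated (carrier G) (left_regular G ` carrier G)"
  shows "T \<in> bounded_ops (carrier G)"
    and "g \<in> carrier G \<Longrightarrow> f \<in> ell2 (carrier G) \<Longrightarrow>
      T (perm_op (carrier G) (\<lambda>x. x \<otimes> g) f) = perm_op (carrier G) (\<lambda>x. x \<otimes> g) (T f)"
proof -
  define Y where "Y = (\<lambda>g. perm_op (carrier G) (\<lambda>x. x \<otimes> g)) ` carrier G"
  have "von_neumann_algebra (carrier G) (commutant (carrier G) Y)"
  proof (rule von_neumann_algebra_commutant)
    show "Y \<subseteq> bounded_ops (carrier G)"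
      by (auto simp: Y_def perm_op_bounded bij_right)
    fix T assume "T \<in> Y"
    then obtain g where g: "g \<in> carrier G" "T = perm_op (carrier G) (\<lambda>x. x \<otimes> g)"
      by (auto simp: Y_def)
    have "op_adjoint (carrier G) T = perm_op (carrier G) (\<lambda>x. x \<otimes> inv g)"
      unfolding g(2)
      by (rule op_adjointI)
        (use g in \<open>auto simp: m_assoc intro!: perm_op_bounded bij_right perm_op_inner\<close>)
    with g show "op_adjoint (carrier G) T \<in> Y"
      by (auto simp: Y_def)
  qed
  moreover have "left_regular G ` carrier G \<subseteq> commutant (carrier G) Y"
  proof clarify
    fix g assume g: "g \<in> carrier G"
    show "left_regular G g \<in> commutant (carrier G) Y"
    proof (rule commutantI[OF left_regular_bounded[OF g]])
      fix A f assume "A \<in> Y" and f: "f \<in> ell2 (carrier G)"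
      then obtain h where h: "h \<in> carrier G" "A = perm_op (carrier G) (\<lambda>x. x \<otimes> h)"
        by (auto simp: Y_def)
      show "left_regular G g (A f) = A (left_regular G g f)"
        unfolding h(2) left_regular_eq
        using g h(1) f
        by (simp add: perm_op_apply[of f] perm_op_apply[OF perm_op_ell2[OF bij_left]]
            perm_op_apply[OF perm_op_ell2[OF bij_right]]) (auto simp: m_assoc)
    qed
  qed
  ultimately have T: "T \<in> commutant (carrier G) Y"
    using T by (auto simp: vN_generated_def)
  then show "T \<in> bounded_ops (carrier G)"
    by (rule commutantD)
  show "T (perm_op (carrier G) (\<lambda>x. x \<otimes> g) f) = perm_op (carrier G) (\<lambda>x. x \<otimes> g) (T f)"
    if "g \<in> carrier G" "f \<in> ell2 (carrier G)"
    using commutantD(2)[OF T] that by (auto simp: Y_def)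
qed

text \<open>As \<open>delta g\<close> is a right translate of \<open>delta \<one>\<close>, the
  vector \<open>T (delta \<one>)\<close> determines \<open>T\<close> on all basis vectors. This
  vector is the symbol through which operators are studied below.\<close>

lemma vN_generated_delta:
  assumes T: "T \<in> vN_generated (carrier G) (left_regular G ` carrier G)" and g: "g \<in> carrier G"
  shows "T (delta g) = (\<lambda>x. if x \<in> carrier G then T (delta \<one>) (x \<otimes> inv g) else 0)"
proof -
  have "perm_op (carrier G) (\<lambda>x. x \<otimes> inv g) (delta \<one>) = delta g"
    using g inv_equality[of _ "inv g"] by (subst perm_op_apply, simp) (auto simp: delta_def fun_eq_iff)
  then have "T (delta g) = perm_op (carrier G) (\<lambda>x. x \<otimes> inv g) (T (delta \<one>))"
    using vN_generated_commutes_right(2)[OF T, of "inv g" "delta \<one>"] g by simp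
  then show ?thesis
    using vN_generated_commutes_right(1)[OF T] by (simp add: perm_op_apply bounded_ops_closed)
qed

lemma left_regular_delta:
  "g \<in> carrier G \<Longrightarrow> h \<in> carrier G \<Longrightarrow> left_regular G g (delta h) = delta (g \<otimes> h)"
  unfolding left_regular_eq by (subst perm_op_apply, simp) (auto simp: delta_def fun_eq_iff m_assoc[symmetric])

lemma conv_op_bounded:
  assumes "finite N" "N \<subseteq> carrier G"
  shows "conv_op G N c \<in> bounded_ops (carrier G)"
  using assms
proof (induction N)
  case empty
  show ?case
    by (rule bounded_opsI[where K = 0]) (auto simp: conv_op_def ell2_add ell2_scale)
next
  case (insert h N)
  have "conv_op G (insert h N) c =
      (\<lambda>f\<in>ell2 (carrier G). \<lambda>x. conv_op G N c f x + c h * left_regular G h f x)"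
    using insert.hyps unfolding conv_op_def by (intro restrict_ext) (simp add: add.commute)
  also have "\<dots> \<in> bounded_ops (carrier G)"
    using insert by (intro bounded_ops_lincomb left_regular_bounded) auto
  finally show ?case .
qed

text \<open>A von Neumann algebra is its own double commutant, so it is enough that sums of left
  translations commute with its commutant.\<close>

lemma conv_op_in_vN:
  assumes "finite N" "N \<subseteq> carrier G"
  shows "conv_op G N c \<in> vN_generated (carrier G) (left_regular G ` carrier G)"
  unfolding vN_generated_def
proof clarify
  fix V assume V: "von_neumann_algebra (carrier G) V" "left_regular G ` carrier G \<subseteq> V"
  have "conv_op G N c \<in> commutant (carrier G) (commutant (carrier G) V)"
  proof (rule commutantI[OF conv_op_bounded[OF assms]])
    fix A f assume A: "A \<in> commutant (carrier G) V" and f: "f \<in> ell2 (carrier G)"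
    note Ab = commutantD(1)[OF A]
    have lf: "left_regular G h f \<in> ell2 (carrier G)" if "h \<in> N" for h
      using that assms f by (auto intro: bounded_ops_closed left_regular_bounded)
    have "A (conv_op G N c f) = (\<lambda>x. \<Sum>h\<in>N. A (\<lambda>x. c h * left_regular G h f x) x)"
      using f lf bounded_ops_sum[OF Ab, of N "\<lambda>h x. c h * left_regular G h f x"]
      by (simp add: conv_op_def ell2_scale)
    also have "\<dots> = (\<lambda>x. \<Sum>h\<in>N. c h * A (left_regular G h f) x)"
      using lf by (simp add: bounded_ops_scale[OF Ab])
    also have "\<dots> = (\<lambda>x. \<Sum>h\<in>N. c h * left_regular G h (A f) x)"
    proof -
      have "A (left_regular G h f) = left_regular G h (A f)" if "h \<in> N" for h
        using that assms V by (intro commutantD(2)[OF A _ f]) auto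
      then show ?thesis
        by simp
    qed
    also have "\<dots> = conv_op G N c (A f)"
      using Ab f by (simp add: conv_op_def bounded_ops_closed)
    finally show "conv_op G N c (A f) = A (conv_op G N c f)" ..
  qed
  then show "conv_op G N c \<in> V"
    using V by (simp add: von_neumann_algebra_def)
qed

lemma left_regular_in_vN:
  "g \<in> carrier G \<Longrightarrow> left_regular G g \<in> vN_generated (carrier G) (left_regular G ` carrier G)"
  by (auto simp: vN_generated_def)

lemma left_regular_norm:
  "g \<in> carrier G \<Longrightarrow> f \<in> ell2 (carrier G) \<Longrightarrow>
    ell2_norm (carrier G) (left_regular G g f) = ell2_norm (carrier G) f"
  by (simp add: left_regular_def perm_op_norm bij_left)

text \<open>The trace of the adjoint of \<open>C\<close> times \<open>C\<close> is the squared norm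
  of \<open>C (delta \<one>)\<close>. All distances in the sentence thereby become norms of
  vectors.\<close>

lemma dist2_group_vN:
  assumes T: "T \<in> bounded_ops (carrier G)" and U: "U \<in> bounded_ops (carrier G)"
  shows "dist2 (group_vN G) T U = ell2_norm (carrier G) (\<lambda>x. T (delta \<one>) x - U (delta \<one>) x)"
proof -
  define C where "C = (\<lambda>f\<in>ell2 (carrier G). \<lambda>x. T f x + (- 1) * U f x)"
  have C: "C \<in> bounded_ops (carrier G)"
    unfolding C_def by (rule bounded_ops_lincomb[OF T U])
  have eq: "T \<oplus>\<^bsub>group_vN G\<^esub> (- 1) \<odot>\<^bsub>group_vN G\<^esub> U = C"
    by (auto simp: group_vN_def operator_algebra_def C_def)
  define v where "v = C (delta \<one>)"
  have v: "v \<in> ell2 (carrier G)"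
    using C by (simp add: v_def bounded_ops_closed)
  have "tau (group_vN G) (adj (group_vN G) C \<otimes>\<^bsub>group_vN G\<^esub> C)
      = ell2_inner (carrier G) (op_adjoint (carrier G) C v) (delta \<one>)"
    by (simp add: group_vN_def operator_algebra_def compose_def v_def)
  also have "\<dots> = cnj (ell2_inner (carrier G) v v)"
    using op_adjoint_inner[OF C, of "delta \<one>" v] v
    by (subst ell2_inner_cnj) (simp add: v_def)
  also have "\<dots> = of_real ((ell2_norm (carrier G) v)\<^sup>2)"
    using v by (simp add: ell2_inner_self)
  finally have "dist2 (group_vN G) T U = sqrt ((ell2_norm (carrier G) v)\<^sup>2)"
    by (simp add: dist2_def eq del: of_real_power)
  also have "v = (\<lambda>x. T (delta \<one>) x - U (delta \<one>) x)"
    by (simp add: v_def C_def)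
  finally show ?thesis
    by simp
qed

end

section \<open>Convolution by idempotents of the group ring\<close>

text \<open>A symmetric idempotent acts by an orthogonal projection in every permutation
  representation.\<close>

lemma (in group) idempotent_contraction:
  fixes c :: "'a \<Rightarrow> real" and \<alpha> :: "'a \<Rightarrow> 'c \<Rightarrow> 'c"
  assumes N: "subgroup N G" "finite N"
    and sym: "\<And>h. h \<in> N \<Longrightarrow> c (inv h) = c h"
    and idem: "\<And>x. x \<in> N \<Longrightarrow> (\<Sum>h\<in>N. c h * c (inv h \<otimes> x)) = c x"
    and \<alpha>: "\<And>h x. h \<in> N \<Longrightarrow> x \<in> S \<Longrightarrow> \<alpha> h x \<in> S"
    and \<alpha>1: "\<And>x. x \<in> S \<Longrightarrow> \<alpha> \<one> x = x"
    and \<alpha>m: "\<And>g h x. g \<in> N \<Longrightarrow> h \<in> N \<Longrightarrow> x \<in> S \<Longrightarrow> \<alpha> g (\<alpha> h x) = \<alpha> (h \<otimes> g) x"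
    and f: "f \<in> ell2 S"
  shows "(\<lambda>x. if x \<in> S then \<Sum>h\<in>N. of_real (c h) * f (\<alpha> h x) else 0) \<in> ell2 S"
    and "ell2_norm S (\<lambda>x. if x \<in> S then \<Sum>h\<in>N. of_real (c h) * f (\<alpha> h x) else 0) \<le> ell2_norm S f"
proof -
  interpret N: subgroup N G by fact
  define Q where "Q f = (\<lambda>x. \<Sum>h\<in>N. of_real (c h) * perm_op S (\<alpha> h) f x)" for f
  have \<alpha>inv: "\<alpha> (inv h) (\<alpha> h x) = x" "\<alpha> h (\<alpha> (inv h) x) = x" if "h \<in> N" "x \<in> S" for h x
    using that by (simp_all add: \<alpha>m \<alpha>1 N.mem_carrier)
  have bij: "bij_betw (\<alpha> h) S S" if "h \<in> N" for h
    by (rule bij_betwI[where g = "\<alpha> (inv h)"]) (use that \<alpha> \<alpha>inv in auto)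
  have Q: "Q f \<in> ell2 S" if "f \<in> ell2 S" for f
    unfolding Q_def using that bij
    by (intro ell2_sum ell2_scale bounded_ops_closed[OF perm_op_bounded])
  have Q_eq: "Q f = (\<lambda>x. if x \<in> S then \<Sum>h\<in>N. of_real (c h) * f (\<alpha> h x) else 0)" if "f \<in> ell2 S" for f
    using that by (auto simp: Q_def perm_op_apply)
  \<comment> \<open>Substituting \<open>y = h \<otimes> g\<close> in the double sum produces the
    convolution of \<open>c\<close> with itself, which is \<open>c\<close>.\<close>
  have QQ: "Q (Q f) = Q f"
  proof
    fix x
    show "Q (Q f) x = Q f x"
    proof (cases "x \<in> S")
      case True
      have "Q (Q f) x = (\<Sum>h\<in>N. \<Sum>g\<in>N. of_real (c h) * (of_real (c g) * f (\<alpha> (h \<otimes> g) x)))"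
        unfolding Q_eq[OF Q[OF f]] unfolding Q_eq[OF f]
        using True by (simp add: \<alpha> \<alpha>m sum_distrib_left)
      also have "\<dots> = (\<Sum>h\<in>N. \<Sum>y\<in>N. of_real (c h * c (inv h \<otimes> y)) * f (\<alpha> y x))"
      proof (rule sum.cong[OF refl])
        fix h assume h: "h \<in> N"
        show "(\<Sum>g\<in>N. of_real (c h) * (of_real (c g) * f (\<alpha> (h \<otimes> g) x))) =
            (\<Sum>y\<in>N. of_real (c h * c (inv h \<otimes> y)) * f (\<alpha> y x))"
          by (rule sum.reindex_bij_witness[where i = "\<lambda>y. inv h \<otimes> y" and j = "\<lambda>g. h \<otimes> g"])
            (use h in \<open>auto simp: m_assoc[symmetric] N.mem_carrier mult.assoc\<close>)
      qed
      also have "\<dots> = (\<Sum>y\<in>N. of_real (\<Sum>h\<in>N. c h * c (inv h \<otimes> y)) * f (\<alpha> y x))"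
        by (subst sum.swap) (simp add: sum_distrib_right)
      also have "\<dots> = Q f x"
        using True by (simp add: Q_eq f idem)
      finally show ?thesis .
    qed (use Q_eq[OF Q[OF f]] Q_eq[OF f] in simp)
  qed
  have inner_sum: "ell2_inner S (\<lambda>x. \<Sum>h\<in>M. of_real (c h) * u h x) g = (\<Sum>h\<in>M. of_real (c h) * ell2_inner S (u h) g)"
    if "finite M" "g \<in> ell2 S" "\<And>h. h \<in> M \<Longrightarrow> u h \<in> ell2 S" for M u g
    using that
    by (induction M) (simp_all add: ell2_inner_add_left ell2_inner_scale_left ell2_scale ell2_sum,
        simp add: ell2_inner_def)
  have adj: "ell2_inner S (Q f) g = ell2_inner S f (Q g)" if fg: "f \<in> ell2 S" "g \<in> ell2 S" for f g
  proof -
    have P: "perm_op S (\<alpha> h) u \<in> ell2 S" if "h \<in> N" "u \<in> ell2 S" for h u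
      using that bij by (intro bounded_ops_closed[OF perm_op_bounded])
    have "ell2_inner S (Q f) g = (\<Sum>h\<in>N. of_real (c h) * ell2_inner S (perm_op S (\<alpha> h) f) g)"
      unfolding Q_def by (rule inner_sum) (use N fg P in auto)
    also have "\<dots> = (\<Sum>h\<in>N. of_real (c h) * ell2_inner S f (perm_op S (\<alpha> (inv h)) g))"
      by (intro sum.cong refl arg_cong2[of _ _ _ _ "(*)"] perm_op_inner) (use fg \<alpha> \<alpha>inv in auto)
    also have "\<dots> = (\<Sum>h\<in>N. of_real (c h) * ell2_inner S f (perm_op S (\<alpha> h) g))"
      by (rule sum.reindex_bij_witness[where i = "\<lambda>h. inv h" and j = "\<lambda>h. inv h"])
        (auto simp: sym N.mem_carrier)
    also have "\<dots> = cnj (\<Sum>h\<in>N. of_real (c h) * ell2_inner S (perm_op S (\<alpha> h) g) f)"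
      by (simp flip: ell2_inner_cnj)
    also have "(\<Sum>h\<in>N. of_real (c h) * ell2_inner S (perm_op S (\<alpha> h) g) f) = ell2_inner S (Q g) f"
      unfolding Q_def by (rule inner_sum[symmetric]) (use N fg P in auto)
    also have "cnj \<dots> = ell2_inner S f (Q g)"
      by (rule ell2_inner_cnj[symmetric])
    finally show ?thesis .
  qed
  \<comment> \<open>Since \<open>Q\<close> is self-adjoint and idempotent, the squared norm of
    \<open>Q f\<close> is the inner product of \<open>Q f\<close> with \<open>f\<close>.
    Cauchy-Schwarz then bounds it, and one factor cancels.\<close>
  have "complex_of_real ((ell2_norm S (Q f))\<^sup>2) = ell2_inner S (Q f) f"
    using adj[of f "Q f"] adj[of f f] f QQ by (simp only: ell2_inner_self[symmetric] Q)
  then have "(ell2_norm S (Q f))\<^sup>2 = cmod (ell2_inner S (Q f) f)"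
    by (metis norm_of_real abs_of_nonneg zero_le_power2)
  also have "\<dots> \<le> ell2_norm S (Q f) * ell2_norm S f"
    by (intro ell2_cauchy_schwarz Q f)
  finally have "ell2_norm S (Q f) * ell2_norm S (Q f) \<le> ell2_norm S (Q f) * ell2_norm S f"
    by (simp add: power2_eq_square)
  then have "ell2_norm S (Q f) \<le> ell2_norm S f"
    using ell2_norm_nonneg[of S "Q f"] ell2_norm_nonneg[of S f]
    by (cases "ell2_norm S (Q f) = 0") (auto simp: mult_le_cancel_left)
  then show "ell2_norm S (\<lambda>x. if x \<in> S then \<Sum>h\<in>N. of_real (c h) * f (\<alpha> h x) else 0) \<le> ell2_norm S f"
    and "(\<lambda>x. if x \<in> S then \<Sum>h\<in>N. of_real (c h) * f (\<alpha> h x) else 0) \<in> ell2 S"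
    using Q[OF f] by (simp_all add: Q_eq f)
qed

section \<open>The separating sentence\<close>

declare One_nat_def [simp del]

text \<open>A projection of trace \<open>t\<close> has squared distance \<open>t (1 - t)\<close>
  from the scalars. This exceeds the threshold 1/8 for all \<open>t\<close> between 3/16 and 3/4,
  the range of traces realised over finite planes.\<close>

definition gap_connective :: "(nat \<Rightarrow> real) \<Rightarrow> real" where
  "gap_connective z = z 0 + z 1 + max 0 (1 / 8 - ((z 2)\<^sup>2 - (z 3)\<^sup>2 - (z 4)\<^sup>2))"

text \<open>Since \<open>\<parallel>y - \<tau>(y)\<parallel>\<^sub>2\<^sup>2 = \<parallel>y\<parallel>\<^sub>2\<^sup>2 - \<bar>\<tau>(y)\<bar>\<^sup>2\<close>, the sentence takes the value \<open>0\<close> if any two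
  elements of the unit ball almost commute with some element of the unit ball that is bounded away
  from the scalars in 2-norm. This is a form of property Gamma.\<close>

definition gap_sentence :: tform where
  "gap_sentence = TSup 0 1 (TSup 1 1 (TInf 2 1 (TConn gap_connective
    [TDist (TMul (TVar 0) (TVar 2)) (TMul (TVar 2) (TVar 0)),
     TDist (TMul (TVar 1) (TVar 2)) (TMul (TVar 2) (TVar 1)),
     TDist (TVar 2) TZero, TReTr (TVar 2), TImTr (TVar 2)])))"

definition gap_value :: "('x, 'z) tracial_algebra_scheme \<Rightarrow> 'x \<Rightarrow> 'x \<Rightarrow> 'x \<Rightarrow> real" where
  "gap_value M x1 x2 y = dist2 M (x1 \<otimes>\<^bsub>M\<^esub> y) (y \<otimes>\<^bsub>M\<^esub> x1) + dist2 M (x2 \<otimes>\<^bsub>M\<^esub> y) (y \<otimes>\<^bsub>M\<^esub> x2)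
    + max 0 (1 / 8 - ((dist2 M y \<zero>\<^bsub>M\<^esub>)\<^sup>2 - (Re (tau M y))\<^sup>2 - (Im (tau M y))\<^sup>2))"

lemma tracial_sentence_gap: "tracial_sentence gap_sentence"
proof -
  have "continuous_on UNIV gap_connective"
    unfolding gap_connective_def by (intro continuous_intros continuous_on_product_coordinates)
  then show ?thesis
    by (auto simp: tracial_sentence_def gap_sentence_def)
qed

lemma sentence_value_gap:
  "sentence_value M gap_sentence =
    (SUP x1\<in>norm_ball M 1. SUP x2\<in>norm_ball M 1. INF y\<in>norm_ball M 1. gap_value M x1 x2 y)"
  by (simp add: sentence_value_def gap_sentence_def gap_value_def gap_connective_def)

context group begin

lemma norm_ball_group_vN:
  "norm_ball (group_vN G) 1 =
    {T \<in> vN_generated (carrier G) (left_regular G ` carrier G). op_norm (carrier G) T \<le> 1}"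
  by (simp add: norm_ball_def group_vN_def operator_algebra_def)

lemma norm_ball_bounded: "T \<in> norm_ball (group_vN G) 1 \<Longrightarrow> T \<in> bounded_ops (carrier G)"
  by (simp add: norm_ball_group_vN vN_generated_commutes_right)

lemma dist2_commutator:
  assumes "x \<in> bounded_ops (carrier G)" "y \<in> bounded_ops (carrier G)"
  shows "dist2 (group_vN G) (x \<otimes>\<^bsub>group_vN G\<^esub> y) (y \<otimes>\<^bsub>group_vN G\<^esub> x) =
    ell2_norm (carrier G) (\<lambda>k. x (y (delta \<one>)) k - y (x (delta \<one>)) k)"
proof -
  have "dist2 (group_vN G) (compose (ell2 (carrier G)) x y) (compose (ell2 (carrier G)) y x) =
    ell2_norm (carrier G) (\<lambda>k. x (y (delta \<one>)) k - y (x (delta \<one>)) k)"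
    using assms by (subst dist2_group_vN) (simp_all add: bounded_ops_compose, simp add: compose_def)
  then show ?thesis
    by (simp add: group_vN_def operator_algebra_def)
qed

lemma gap_value_group_vN:
  assumes "x1 \<in> bounded_ops (carrier G)" "x2 \<in> bounded_ops (carrier G)" "y \<in> bounded_ops (carrier G)"
  shows "gap_value (group_vN G) x1 x2 y =
    ell2_norm (carrier G) (\<lambda>k. x1 (y (delta \<one>)) k - y (x1 (delta \<one>)) k) +
    ell2_norm (carrier G) (\<lambda>k. x2 (y (delta \<one>)) k - y (x2 (delta \<one>)) k) +
    max 0 (1 / 8 - ((ell2_norm (carrier G) (y (delta \<one>)))\<^sup>2 - (cmod (y (delta \<one>) \<one>))\<^sup>2))"
proof -
  have zero: "(\<lambda>f\<in>ell2 (carrier G). \<lambda>x. 0) \<in> bounded_ops (carrier G)"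
    by (rule bounded_opsI[where K = 0]) (auto simp: ell2_add ell2_scale)
  have "dist2 (group_vN G) y \<zero>\<^bsub>group_vN G\<^esub> = dist2 (group_vN G) y (\<lambda>f\<in>ell2 (carrier G). \<lambda>x. 0)"
    by (simp add: group_vN_def operator_algebra_def)
  also have "\<dots> = ell2_norm (carrier G) (y (delta \<one>))"
    by (subst dist2_group_vN[OF assms(3) zero]) simp
  finally have 1: "dist2 (group_vN G) y \<zero>\<^bsub>group_vN G\<^esub> = ell2_norm (carrier G) (y (delta \<one>))" .
  have 2: "tau (group_vN G) y = y (delta \<one>) \<one>"
    by (simp add: group_vN_def operator_algebra_def ell2_inner_delta)
  show ?thesis
    using assms by (simp add: gap_value_def dist2_commutator 1 2 cmod_power2)
qed

lemma gap_value_nonneg: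
  assumes "x1 \<in> bounded_ops (carrier G)" "x2 \<in> bounded_ops (carrier G)" "y \<in> bounded_ops (carrier G)"
  shows "0 \<le> gap_value (group_vN G) x1 x2 y"
  using assms by (simp add: gap_value_group_vN)

lemma zero_in_norm_ball: "(\<lambda>f\<in>ell2 (carrier G). \<lambda>x. 0) \<in> norm_ball (group_vN G) 1"
  using conv_op_in_vN[of "{}"] by (auto simp: norm_ball_group_vN conv_op_def intro!: op_norm_le_1)

lemma left_regular_in_norm_ball: "g \<in> carrier G \<Longrightarrow> left_regular G g \<in> norm_ball (group_vN G) 1"
  by (auto simp: norm_ball_group_vN left_regular_in_vN left_regular_norm intro!: op_norm_le_1)

lemma gap_INF_le:
  assumes "x1 \<in> norm_ball (group_vN G) 1" "x2 \<in> norm_ball (group_vN G) 1" "y \<in> norm_ball (group_vN G) 1"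
  shows "(INF y\<in>norm_ball (group_vN G) 1. gap_value (group_vN G) x1 x2 y) \<le> gap_value (group_vN G) x1 x2 y"
  using assms
  by (intro cINF_lower) (auto intro!: bdd_belowI[of _ 0] gap_value_nonneg norm_ball_bounded)

text \<open>Taking \<open>y = 0\<close> costs exactly the threshold. The bound guarantees that the
  suprema in the sentence are taken over bounded sets.\<close>

lemma gap_INF_le_eighth:
  assumes "x1 \<in> norm_ball (group_vN G) 1" "x2 \<in> norm_ball (group_vN G) 1"
  shows "(INF y\<in>norm_ball (group_vN G) 1. gap_value (group_vN G) x1 x2 y) \<le> 1 / 8"
proof -
  have "gap_value (group_vN G) x1 x2 (\<lambda>f\<in>ell2 (carrier G). \<lambda>x. 0) = 1 / 8"
    using assms[THEN norm_ball_bounded] norm_ball_bounded[OF zero_in_norm_ball]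
    by (simp add: gap_value_group_vN bounded_ops_zero bounded_ops_closed)
  then show ?thesis
    using gap_INF_le[OF assms zero_in_norm_ball] by simp
qed

lemma gap_sentence_le:
  assumes "\<And>x1 x2. x1 \<in> norm_ball (group_vN G) 1 \<Longrightarrow> x2 \<in> norm_ball (group_vN G) 1 \<Longrightarrow>
    (INF y\<in>norm_ball (group_vN G) 1. gap_value (group_vN G) x1 x2 y) \<le> r"
  shows "sentence_value (group_vN G) gap_sentence \<le> r"
  unfolding sentence_value_gap
  using zero_in_norm_ball assms by (intro cSUP_least) auto

lemma gap_sentence_ge:
  assumes "x1 \<in> norm_ball (group_vN G) 1" "x2 \<in> norm_ball (group_vN G) 1"
    and le: "\<And>y. y \<in> norm_ball (group_vN G) 1 \<Longrightarrow> r \<le> gap_value (group_vN G) x1 x2 y"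
  shows "r \<le> sentence_value (group_vN G) gap_sentence"
proof -
  let ?B = "norm_ball (group_vN G) 1"
  let ?I = "\<lambda>x1 x2. INF y\<in>?B. gap_value (group_vN G) x1 x2 y"
  have ne: "?B \<noteq> {}"
    using zero_in_norm_ball by blast
  have sup: "(SUP x2\<in>?B. ?I x x2) \<le> 1 / 8" if "x \<in> ?B" for x
    using ne that by (intro cSUP_least gap_INF_le_eighth)
  have "r \<le> ?I x1 x2"
    using ne le by (rule cINF_greatest)
  also have "\<dots> \<le> (SUP x2\<in>?B. ?I x1 x2)"
    using assms gap_INF_le_eighth by (intro cSUP_upper) (auto intro!: bdd_aboveI[of _ "1 / 8"])
  also have "\<dots> \<le> (SUP x1\<in>?B. SUP x2\<in>?B. ?I x1 x2)"
    using assms sup by (intro cSUP_upper) (auto intro!: bdd_aboveI[of _ "1 / 8"])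
  finally show ?thesis
    by (simp add: sentence_value_gap)
qed

end

section \<open>Groups with central projections\<close>

text \<open>In the group ring of \<open>G\<close> every finite set commutes with a projection, supported on a finite
  subgroup, the trace of which is bounded away from \<open>0\<close> and \<open>1\<close>.\<close>

definition locally_central_projections :: "('a, 'b) monoid_scheme \<Rightarrow> bool" where
  "locally_central_projections G \<longleftrightarrow> (\<forall>F. finite F \<and> F \<subseteq> carrier G \<longrightarrow>
    (\<exists>N c. subgroup N G \<and> finite N \<and>
      (\<forall>x\<in>carrier G - N. c x = 0) \<and>
      (\<forall>x\<in>carrier G. c (inv\<^bsub>G\<^esub> x) = c x) \<and>
      (\<forall>x\<in>N. (\<Sum>h\<in>N. c h * c (inv\<^bsub>G\<^esub> h \<otimes>\<^bsub>G\<^esub> x)) = c x) \<and>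
      (\<forall>s\<in>F. \<forall>x\<in>carrier G. c (s \<otimes>\<^bsub>G\<^esub> x \<otimes>\<^bsub>G\<^esub> inv\<^bsub>G\<^esub> s) = c x) \<and>
      1 / 8 \<le> c \<one>\<^bsub>G\<^esub> * (1 - c \<one>\<^bsub>G\<^esub> :: real)))"

context group begin

text \<open>Write the symbol of \<open>x\<close> as a part on \<open>F\<close> and a tail. The
  projection commutes exactly with the first part; left and right convolution by it are contractions
  on the tail, which gives the factor 2.\<close>

lemma conv_op_commutator_small:
  fixes c :: "'a \<Rightarrow> real"
  assumes N: "subgroup N G" "finite N"
    and off: "\<And>x. x \<in> carrier G - N \<Longrightarrow> c x = 0"
    and sym: "\<And>x. x \<in> carrier G \<Longrightarrow> c (inv x) = c x"
    and idem: "\<And>x. x \<in> N \<Longrightarrow> (\<Sum>h\<in>N. c h * c (inv h \<otimes> x)) = c x"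
    and conj: "\<And>s x. s \<in> F \<Longrightarrow> x \<in> carrier G \<Longrightarrow> c (s \<otimes> x \<otimes> inv s) = c x"
    and F: "finite F" "F \<subseteq> carrier G"
    and x: "x \<in> vN_generated (carrier G) (left_regular G ` carrier G)"
    and small: "ell2_norm (carrier G) (\<lambda>k. if k \<in> F then 0 else x (delta \<one>) k) \<le> \<epsilon>"
  shows "ell2_norm (carrier G) (\<lambda>k. x (conv_op G N c (delta \<one>)) k - conv_op G N c (x (delta \<one>)) k) \<le> 2 * \<epsilon>"
proof -
  interpret N: subgroup N G by fact
  define \<xi> where "\<xi> = x (delta \<one>)"
  note xb = vN_generated_commutes_right(1)[OF x]
  have \<xi>: "\<xi> \<in> ell2 (carrier G)"
    using xb by (simp add: \<xi>_def bounded_ops_closed)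
  define \<xi>0 where "\<xi>0 = (\<lambda>k. if k \<in> F then \<xi> k else 0)"
  define \<xi>1 where "\<xi>1 = (\<lambda>k. if k \<in> F then 0 else \<xi> k)"
  have \<xi>1: "\<xi>1 \<in> ell2 (carrier G)"
    using ell2_diff[OF \<xi> ell2_if[OF \<xi>, of "\<lambda>k. k \<in> F"]] by (simp add: \<xi>1_def if_distrib cong: if_cong)
  have dec: "\<xi> = (\<lambda>k. \<xi>0 k + \<xi>1 k)"
    by (auto simp: \<xi>0_def \<xi>1_def)
  define L where "L f = (\<lambda>k. if k \<in> carrier G then \<Sum>h\<in>N. of_real (c h) * f (inv h \<otimes> k) else 0)"
    for f :: "'a \<Rightarrow> complex"
  define R where "R f = (\<lambda>k. if k \<in> carrier G then \<Sum>h\<in>N. of_real (c h) * f (k \<otimes> h) else 0)"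
    for f :: "'a \<Rightarrow> complex"
  have L1: "L \<xi>1 \<in> ell2 (carrier G)" "ell2_norm (carrier G) (L \<xi>1) \<le> ell2_norm (carrier G) \<xi>1"
    unfolding L_def
    by (rule idempotent_contraction[OF N _ idem, where \<alpha> = "\<lambda>h k. inv h \<otimes> k"];
        use \<xi>1 sym in \<open>simp add: N.mem_carrier inv_mult_group m_assoc\<close>)+
  have R1: "R \<xi>1 \<in> ell2 (carrier G)" "ell2_norm (carrier G) (R \<xi>1) \<le> ell2_norm (carrier G) \<xi>1"
    unfolding R_def
    by (rule idempotent_contraction[OF N _ idem, where \<alpha> = "\<lambda>h k. k \<otimes> h"];
        use \<xi>1 sym in \<open>simp add: N.mem_carrier m_assoc\<close>)+
  have conv: "conv_op G N c f = L f" if "f \<in> ell2 (carrier G)" for f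
    using that by (auto simp: conv_op_def L_def left_regular_def fun_eq_iff intro!: sum.cong)
  have "conv_op G N c (delta \<one>) = (\<lambda>k. \<Sum>h\<in>N. of_real (c h) * delta h k)"
    using left_regular_delta[of _ \<one>] by (auto simp: conv_op_def N.mem_carrier fun_eq_iff intro!: sum.cong)
  then have "x (conv_op G N c (delta \<one>)) = (\<lambda>k. \<Sum>h\<in>N. of_real (c h) * x (delta h) k)"
    using bounded_ops_sum[OF xb, of N "\<lambda>h k. of_real (c h) * delta h k"]
    by (simp add: ell2_scale N.mem_carrier bounded_ops_scale[OF xb])
  \<comment> \<open>Because \<open>x\<close> commutes with right translations, it sends the symbol
    of the projection to the right convolution of its own symbol. Symmetry of \<open>c\<close>
    replaces \<open>inv h\<close> by \<open>h\<close>.\<close>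
  also have "\<dots> = R \<xi>"
  proof
    fix k
    have "(\<Sum>h\<in>N. of_real (c h) * x (delta h) k) =
        (\<Sum>h\<in>N. of_real (c h) * (if k \<in> carrier G then \<xi> (k \<otimes> inv h) else 0))"
    proof (intro sum.cong refl)
      fix h assume "h \<in> N"
      then show "of_real (c h) * x (delta h) k = of_real (c h) * (if k \<in> carrier G then \<xi> (k \<otimes> inv h) else 0)"
        using vN_generated_delta[OF x, of h] by (simp add: N.mem_carrier \<xi>_def)
    qed
    also have "\<dots> = (\<Sum>h\<in>N. of_real (c h) * (if k \<in> carrier G then \<xi> (k \<otimes> h) else 0))"
      by (rule sum.reindex_bij_witness[where i = "\<lambda>h. inv h" and j = "\<lambda>h. inv h"])
        (auto simp: sym N.mem_carrier)
    also have "\<dots> = R \<xi> k"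
      by (simp add: R_def)
    finally show "(\<Sum>h\<in>N. of_real (c h) * x (delta h) k) = R \<xi> k" .
  qed
  finally have xE: "x (conv_op G N c (delta \<one>)) = R \<xi>" .
  \<comment> \<open>Both sides become sums over \<open>F\<close>, with coefficients
    \<open>c (inv k \<otimes> s)\<close> and \<open>c (k \<otimes> inv s)\<close>. Symmetry sends
    the first to \<open>c (inv s \<otimes> k)\<close>, and conjugation by \<open>s\<close> sends
    this to the second. Terms lost or gained in reindexing vanish, as \<open>c\<close> is zero off
    \<open>N\<close> and \<open>\<xi>0\<close> off \<open>F\<close>.\<close>
  have LR0: "R \<xi>0 k = L \<xi>0 k" if k: "k \<in> carrier G" for k
  proof -
    have FG: "s \<in> carrier G" if "s \<in> F" for s
      using that F by auto
    have cancel: "k \<otimes> (inv k \<otimes> h) = h" if "h \<in> N" for h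
      using that k by (simp add: m_assoc[symmetric] N.mem_carrier)
    have "R \<xi>0 k = (\<Sum>h\<in>N. of_real (c h) * \<xi>0 (k \<otimes> h))"
      using k by (simp add: R_def)
    also have "\<dots> = (\<Sum>s\<in>F. of_real (c (inv k \<otimes> s)) * \<xi>0 s)"
    proof (rule sum.reindex_bij_witness_not_neutral[where i = "\<lambda>s. inv k \<otimes> s" and j = "\<lambda>h. k \<otimes> h"
          and S' = "{h \<in> N. k \<otimes> h \<notin> F}" and T' = "{s \<in> F. inv k \<otimes> s \<notin> N}"])
      show "of_real (c (inv k \<otimes> s)) * \<xi>0 s = 0" if "s \<in> {s \<in> F. inv k \<otimes> s \<notin> N}" for s
        using that off[of "inv k \<otimes> s"] FG[of s] k by simp
    qed (use N F k FG in \<open>simp_all add: inv_solve_left' m_assoc[symmetric] N.mem_carrier \<xi>0_def\<close>)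
    also have "\<dots> = (\<Sum>s\<in>F. of_real (c (k \<otimes> inv s)) * \<xi>0 s)"
    proof (intro sum.cong refl arg_cong2[of _ _ _ _ "(*)"] arg_cong[of _ _ of_real])
      fix s assume s: "s \<in> F"
      then have sG: "s \<in> carrier G"
        using F by auto
      have "c (inv k \<otimes> s) = c (inv (inv k \<otimes> s))"
        using sG k by (simp add: sym)
      also have "inv (inv k \<otimes> s) = inv s \<otimes> k"
        using sG k by (simp add: inv_mult_group)
      also have "c (inv s \<otimes> k) = c (s \<otimes> (inv s \<otimes> k) \<otimes> inv s)"
        using conj[OF s, of "inv s \<otimes> k"] sG k by simp
      also have "s \<otimes> (inv s \<otimes> k) \<otimes> inv s = k \<otimes> inv s"
        using sG k by (simp add: m_assoc[symmetric])
      finally show "c (inv k \<otimes> s) = c (k \<otimes> inv s)" .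
    qed
    also have "\<dots> = (\<Sum>h\<in>N. of_real (c h) * \<xi>0 (inv h \<otimes> k))"
    proof (rule sum.reindex_bij_witness_not_neutral[where j = "\<lambda>s. k \<otimes> inv s" and i = "\<lambda>h. inv h \<otimes> k"
          and T' = "{h \<in> N. inv h \<otimes> k \<notin> F}" and S' = "{s \<in> F. k \<otimes> inv s \<notin> N}"])
      show "of_real (c (k \<otimes> inv s)) * \<xi>0 s = 0" if "s \<in> {s \<in> F. k \<otimes> inv s \<notin> N}" for s
        using that off[of "k \<otimes> inv s"] FG[of s] k by simp
    qed (use N F k FG cancel in \<open>auto simp: inv_mult_group m_assoc N.mem_carrier \<xi>0_def\<close>)
    also have "\<dots> = L \<xi>0 k"
      using k by (simp add: L_def)
    finally show ?thesis .
  qed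
  have "R \<xi> k - L \<xi> k = R \<xi>1 k - L \<xi>1 k" for k
    using LR0[of k] by (subst (1 2) dec) (simp add: R_def L_def distrib_left sum.distrib)
  then have "ell2_norm (carrier G) (\<lambda>k. x (conv_op G N c (delta \<one>)) k - conv_op G N c \<xi> k) =
      ell2_norm (carrier G) (\<lambda>k. R \<xi>1 k - L \<xi>1 k)"
    by (simp add: xE conv[OF \<xi>])
  also have "\<dots> \<le> ell2_norm (carrier G) (R \<xi>1) + ell2_norm (carrier G) (L \<xi>1)"
    by (rule ell2_norm_diff_triangle[OF R1(1) L1(1)])
  also have "\<dots> \<le> 2 * \<epsilon>"
    using L1(2) R1(2) small[folded \<xi>_def, folded \<xi>1_def] by linarith
  finally show ?thesis
    by (simp add: \<xi>_def)
qed

text \<open>Elements of the unit ball have symbols of finite support up to a small tail, so a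
  projection commuting with the finite supports almost commutes with the operators
  themselves.\<close>

lemma gap_sentence_locally_central_projections:
  assumes "locally_central_projections G"
  shows "sentence_value (group_vN G) gap_sentence \<le> 0"
proof (rule gap_sentence_le)
  fix x1 x2 assume x: "x1 \<in> norm_ball (group_vN G) 1" "x2 \<in> norm_ball (group_vN G) 1"
  note xb = x[THEN norm_ball_bounded]
  let ?S = "carrier G"
  let ?I = "INF y\<in>norm_ball (group_vN G) 1. gap_value (group_vN G) x1 x2 y"
  show "?I \<le> 0"
  proof (rule field_le_epsilon)
    fix e :: real assume e: "e > 0"
    \<comment> \<open>Each commutator costs twice its tail and there are two of them, so tails of
      size \<open>e / 4\<close> add up to \<open>e\<close>.\<close>
    obtain E1 where E1: "finite E1" "E1 \<subseteq> ?S" "ell2_norm ?S (\<lambda>k. if k \<in> E1 then 0 else x1 (delta \<one>) k) \<le> e / 4"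
      using ell2_finite_approx[of "x1 (delta \<one>)" ?S "e / 4"] e xb by (auto simp: bounded_ops_closed)
    obtain E2 where E2: "finite E2" "E2 \<subseteq> ?S" "ell2_norm ?S (\<lambda>k. if k \<in> E2 then 0 else x2 (delta \<one>) k) \<le> e / 4"
      using ell2_finite_approx[of "x2 (delta \<one>)" ?S "e / 4"] e xb by (auto simp: bounded_ops_closed)
    obtain N and c :: "'a \<Rightarrow> real" where N: "subgroup N G" "finite N"
      and off: "\<And>x. x \<in> carrier G - N \<Longrightarrow> c x = 0"
      and sym: "\<And>x. x \<in> carrier G \<Longrightarrow> c (inv x) = c x"
      and idem: "\<And>x. x \<in> N \<Longrightarrow> (\<Sum>h\<in>N. c h * c (inv h \<otimes> x)) = c x"
      and conj: "\<And>s x. s \<in> E1 \<union> E2 \<Longrightarrow> x \<in> carrier G \<Longrightarrow> c (s \<otimes> x \<otimes> inv s) = c x"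
      and c1: "1 / 8 \<le> c \<one> * (1 - c \<one>)"
    proof -
      have fin: "finite (E1 \<union> E2) \<and> E1 \<union> E2 \<subseteq> carrier G"
        using E1 E2 by simp
      obtain N and c :: "'a \<Rightarrow> real" where "subgroup N G \<and> finite N \<and>
          (\<forall>x\<in>carrier G - N. c x = 0) \<and> (\<forall>x\<in>carrier G. c (inv x) = c x) \<and>
          (\<forall>x\<in>N. (\<Sum>h\<in>N. c h * c (inv h \<otimes> x)) = c x) \<and>
          (\<forall>s\<in>E1 \<union> E2. \<forall>x\<in>carrier G. c (s \<otimes> x \<otimes> inv s) = c x) \<and> 1 / 8 \<le> c \<one> * (1 - c \<one>)"
        using assms[unfolded locally_central_projections_def, THEN spec, THEN mp, OF fin]
        by (elim exE) (rule that)
      then show ?thesis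
        by (intro that[of N c]) blast+
    qed
    interpret N: subgroup N G by fact
    define y where "y = conv_op G N c"
    have y_vN: "y \<in> vN_generated ?S (left_regular G ` ?S)"
      unfolding y_def by (rule conv_op_in_vN) (use N N.subset in auto)
    note yb = vN_generated_commutes_right(1)[OF y_vN]
    have y_apply: "y f = (\<lambda>k. if k \<in> ?S then \<Sum>h\<in>N. of_real (c h) * f (inv h \<otimes> k) else 0)"
      if "f \<in> ell2 ?S" for f
      using that by (auto simp: y_def conv_op_def left_regular_def fun_eq_iff intro!: sum.cong)
    have "ell2_norm ?S (y f) \<le> ell2_norm ?S f" if f: "f \<in> ell2 ?S" for f
      unfolding y_apply[OF f]
      by (rule idempotent_contraction[OF N _ idem, where \<alpha> = "\<lambda>h k. inv h \<otimes> k"])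
        (use f sym in \<open>simp_all add: N.mem_carrier inv_mult_group m_assoc\<close>)
    then have y_ball: "y \<in> norm_ball (group_vN G) 1"
      using y_vN by (auto simp: norm_ball_group_vN intro!: op_norm_le_1)
    have y1: "y (delta \<one>) = (\<lambda>k. if k \<in> N then of_real (c k) else 0)"
    proof
      fix k
      have "y (delta \<one>) k = (\<Sum>h\<in>N. of_real (c h) * delta h k)"
        using left_regular_delta[of _ \<one>] by (auto simp: y_def conv_op_def N.mem_carrier intro!: sum.cong)
      also have "\<dots> = (\<Sum>h\<in>N. if k = h then of_real (c k) else 0)"
        by (intro sum.cong) (auto simp: delta_def)
      finally show "y (delta \<one>) k = (if k \<in> N then of_real (c k) else 0)"
        using N by simp
    qed
    \<comment> \<open>Idempotence evaluated at the identity: the squared 2-norm of a projection is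
      its trace \<open>c \<one>\<close>.\<close>
    have "(ell2_norm ?S (y (delta \<one>)))\<^sup>2 = (\<Sum>\<^sub>\<infinity>k\<in>N. (c k)\<^sup>2)"
      unfolding ell2_norm_sq y1 by (rule infsum_cong_neutral) (use N.subset in auto)
    also have "\<dots> = (\<Sum>k\<in>N. c k * c (inv k \<otimes> \<one>))"
      using N by (simp add: power2_eq_square N.mem_carrier sym)
    also have "\<dots> = c \<one>"
      by (rule idem) simp
    finally have y2: "(ell2_norm ?S (y (delta \<one>)))\<^sup>2 = c \<one>" .
    have com: "ell2_norm ?S (\<lambda>k. x1 (y (delta \<one>)) k - y (x1 (delta \<one>)) k) \<le> 2 * (e / 4)"
      unfolding y_def
      by (rule conv_op_commutator_small[OF N off sym idem conj]) (use x E1 in \<open>auto simp: norm_ball_group_vN\<close>)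
    have com2: "ell2_norm ?S (\<lambda>k. x2 (y (delta \<one>)) k - y (x2 (delta \<one>)) k) \<le> 2 * (e / 4)"
      unfolding y_def
      by (rule conv_op_commutator_small[OF N off sym idem conj]) (use x E2 in \<open>auto simp: norm_ball_group_vN\<close>)
    have "gap_value (group_vN G) x1 x2 y \<le> e + max 0 (1 / 8 - (c \<one> - (c \<one>)\<^sup>2))"
      using com com2 by (simp add: gap_value_group_vN xb yb y2) (simp add: y1)
    also have "\<dots> = e"
      using c1 by (simp add: power2_eq_square algebra_simps max_def)
    finally show "?I \<le> 0 + e"
      using gap_INF_le[OF x y_ball] by simp
  qed
qed

end

section \<open>Groups with a ping-pong pair\<close>

text \<open>Writing \<open>p\<close>, \<open>q\<close>, \<open>r\<close>, \<open>t\<close> for the masses of four disjoint sets, such functions arise from an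
  equivariant map from \<open>G - {1}\<close>, with the conjugation action, to probability measures on a space
  on which \<open>a\<close> and \<open>b\<close> play ping-pong.\<close>

definition ping_pong :: "('a, 'b) monoid_scheme \<Rightarrow> bool" where
  "ping_pong G \<longleftrightarrow> (\<exists>a\<in>carrier G. \<exists>b\<in>carrier G. \<exists>p q r t :: 'a \<Rightarrow> real.
    \<forall>x\<in>carrier G - {\<one>\<^bsub>G\<^esub>}. 0 \<le> p x \<and> 0 \<le> q x \<and> 0 \<le> r x \<and> 0 \<le> t x \<and> p x + q x + r x + t x \<le> 1 \<and>
      1 \<le> p (a \<otimes>\<^bsub>G\<^esub> x \<otimes>\<^bsub>G\<^esub> inv\<^bsub>G\<^esub> a) + q x \<and> 1 \<le> r (b \<otimes>\<^bsub>G\<^esub> x \<otimes>\<^bsub>G\<^esub> inv\<^bsub>G\<^esub> b) + t x)"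

text \<open>Factor the difference of squares and apply Young's inequality. The resulting error terms
  are all squares, so the bound can be summed term by term.\<close>

lemma cmod_sq_diff_bound:
  assumes "\<epsilon> > 0"
  shows "(cmod u)\<^sup>2 \<le> (cmod v)\<^sup>2 + (cmod (u - v))\<^sup>2 / (2 * \<epsilon>) + \<epsilon> * ((cmod u)\<^sup>2 + (cmod v)\<^sup>2)"
proof -
  define d where "d = cmod (u - v)"
  define s where "s = cmod u + cmod v"
  have "cmod u - cmod v \<le> d"
    unfolding d_def by (rule norm_triangle_ineq2)
  then have "(cmod u - cmod v) * s \<le> d * s"
    by (intro mult_right_mono) (auto simp: s_def)
  then have 1: "(cmod u)\<^sup>2 - (cmod v)\<^sup>2 \<le> d * s"
    by (simp add: s_def power2_eq_square algebra_simps)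
  have "0 \<le> (d - \<epsilon> * s)\<^sup>2 / (2 * \<epsilon>)"
    using assms by simp
  also have "\<dots> = d\<^sup>2 / (2 * \<epsilon>) - d * s + \<epsilon> * s\<^sup>2 / 2"
    using assms by (simp add: power2_eq_square field_simps)
  finally have 2: "d * s \<le> d\<^sup>2 / (2 * \<epsilon>) + \<epsilon> * s\<^sup>2 / 2"
    by simp
  have "s\<^sup>2 \<le> 2 * ((cmod u)\<^sup>2 + (cmod v)\<^sup>2)"
    using zero_le_power2[of "cmod u - cmod v"] by (simp add: s_def power2_eq_square algebra_simps)
  then have "\<epsilon> * s\<^sup>2 / 2 \<le> \<epsilon> * ((cmod u)\<^sup>2 + (cmod v)\<^sup>2)"
    using assms by simp
  with 1 2 show ?thesis
    by (simp add: d_def)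
qed

text \<open>The mass at \<open>\<phi> k\<close> is divided between the weights \<open>p k\<close>
  and \<open>q (\<phi> k)\<close>. In the first share it is compared with the mass at
  \<open>k\<close>, at the price of the error; in the second the sum is reindexed along
  \<open>\<phi>\<close>.\<close>

lemma ping_pong_mass:
  fixes \<xi> :: "'a \<Rightarrow> complex" and p q :: "'a \<Rightarrow> real"
  assumes summ: "(\<lambda>k. (cmod (\<xi> k))\<^sup>2) summable_on Y" and \<phi>: "bij_betw \<phi> Y Y"
    and p: "\<And>k. k \<in> Y \<Longrightarrow> 0 \<le> p k \<and> p k \<le> 1" and q: "\<And>k. k \<in> Y \<Longrightarrow> 0 \<le> q k \<and> q k \<le> 1"
    and pq: "\<And>k. k \<in> Y \<Longrightarrow> 1 \<le> p k + q (\<phi> k)" and \<epsilon>: "\<epsilon> > 0"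
    and D: "(\<lambda>k. (cmod (\<xi> (\<phi> k) - \<xi> k))\<^sup>2) summable_on Y"
  shows "(\<Sum>\<^sub>\<infinity>k\<in>Y. (cmod (\<xi> k))\<^sup>2) \<le> (\<Sum>\<^sub>\<infinity>k\<in>Y. (cmod (\<xi> k))\<^sup>2 * p k) + (\<Sum>\<^sub>\<infinity>k\<in>Y. (cmod (\<xi> k))\<^sup>2 * q k) +
    (\<Sum>\<^sub>\<infinity>k\<in>Y. (cmod (\<xi> (\<phi> k) - \<xi> k))\<^sup>2) / (2 * \<epsilon>) + 2 * \<epsilon> * (\<Sum>\<^sub>\<infinity>k\<in>Y. (cmod (\<xi> k))\<^sup>2)"
proof -
  define m where "m k = (cmod (\<xi> k))\<^sup>2" for k
  define d where "d k = (cmod (\<xi> (\<phi> k) - \<xi> k))\<^sup>2" for k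
  have m: "m summable_on Y" and d: "d summable_on Y"
    using summ D by (simp_all add: m_def[abs_def] d_def[abs_def])
  have mult: "(\<lambda>k. m k * w k) summable_on Y" if "\<And>k. k \<in> Y \<Longrightarrow> 0 \<le> w k \<and> w k \<le> 1" for w
    by (rule summable_on_comparison_test[OF m])
      (use that in \<open>auto simp: m_def abs_mult intro!: mult_left_le\<close>)
  have m\<phi>: "(\<lambda>k. m (\<phi> k)) summable_on Y" "(\<Sum>\<^sub>\<infinity>k\<in>Y. m (\<phi> k)) = (\<Sum>\<^sub>\<infinity>k\<in>Y. m k)"
    using summable_on_reindex_bij_betw[OF \<phi>, of m] infsum_reindex_bij_betw[OF \<phi>, of m] m by simp_all
  have q\<phi>: "(\<lambda>k. m (\<phi> k) * q (\<phi> k)) summable_on Y"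
      "(\<Sum>\<^sub>\<infinity>k\<in>Y. m (\<phi> k) * q (\<phi> k)) = (\<Sum>\<^sub>\<infinity>k\<in>Y. m k * q k)"
    using summable_on_reindex_bij_betw[OF \<phi>, of "\<lambda>k. m k * q k"] mult[of q] q
      infsum_reindex_bij_betw[OF \<phi>, of "\<lambda>k. m k * q k"] by simp_all
  note summable = mult[of p] q\<phi>(1) d m m\<phi>(1)
  \<comment> \<open>The error is multiplied by \<open>p k\<close>, which is at most 1, and may
    therefore be kept without this factor.\<close>
  have "m (\<phi> k) \<le> m k * p k + m (\<phi> k) * q (\<phi> k) + d k * (1 / (2 * \<epsilon>)) + \<epsilon> * (m (\<phi> k) + m k)"
    if k: "k \<in> Y" for k
  proof -
    have "m (\<phi> k) * 1 \<le> m (\<phi> k) * (p k + q (\<phi> k))"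
      using pq[OF k] by (intro mult_left_mono) (auto simp: m_def)
    moreover have "m (\<phi> k) * p k \<le> (m k + (d k * (1 / (2 * \<epsilon>)) + \<epsilon> * (m (\<phi> k) + m k))) * p k"
      using cmod_sq_diff_bound[OF \<epsilon>, of "\<xi> (\<phi> k)" "\<xi> k"] p[OF k]
      by (intro mult_right_mono) (auto simp: m_def d_def)
    moreover have "(d k * (1 / (2 * \<epsilon>)) + \<epsilon> * (m (\<phi> k) + m k)) * p k \<le> d k * (1 / (2 * \<epsilon>)) + \<epsilon> * (m (\<phi> k) + m k)"
      using p[OF k] \<epsilon> by (intro mult_left_le) (auto simp: m_def d_def)
    ultimately show ?thesis
      by (simp add: algebra_simps)
  qed
  then have "(\<Sum>\<^sub>\<infinity>k\<in>Y. m (\<phi> k)) \<le>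
      (\<Sum>\<^sub>\<infinity>k\<in>Y. m k * p k + m (\<phi> k) * q (\<phi> k) + d k * (1 / (2 * \<epsilon>)) + \<epsilon> * (m (\<phi> k) + m k))"
    using summable p by (intro infsum_mono summable_on_add summable_on_cmult_right summable_on_cmult_left) auto
  also have "\<dots> = (\<Sum>\<^sub>\<infinity>k\<in>Y. m k * p k) + (\<Sum>\<^sub>\<infinity>k\<in>Y. m (\<phi> k) * q (\<phi> k)) + (\<Sum>\<^sub>\<infinity>k\<in>Y. d k) * (1 / (2 * \<epsilon>)) +
      \<epsilon> * ((\<Sum>\<^sub>\<infinity>k\<in>Y. m (\<phi> k)) + (\<Sum>\<^sub>\<infinity>k\<in>Y. m k))"
    using summable p
    by (simp add: infsum_add summable_on_add summable_on_cmult_right summable_on_cmult_left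
        infsum_cmult_left' infsum_cmult_right' del: times_divide_eq_right)
  finally have "(\<Sum>\<^sub>\<infinity>k\<in>Y. m k) \<le> (\<Sum>\<^sub>\<infinity>k\<in>Y. m k * p k) + (\<Sum>\<^sub>\<infinity>k\<in>Y. m k * q k) +
      (\<Sum>\<^sub>\<infinity>k\<in>Y. d k) / (2 * \<epsilon>) + 2 * \<epsilon> * (\<Sum>\<^sub>\<infinity>k\<in>Y. m k)"
    unfolding m\<phi>(2) q\<phi>(2) by (simp add: algebra_simps)
  then show ?thesis
    by (simp only: m_def d_def)
qed

text \<open>If the symbol of \<open>y\<close> is almost invariant under conjugation by both
  \<open>a\<close> and \<open>b\<close>, the two mass estimates leave almost no mass off the
  identity. Then \<open>y\<close> is nearly scalar, and the last term of the gap value is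
  large.\<close>

lemma (in group) gap_sentence_ping_pong:
  assumes "ping_pong G"
  shows "1 / 64 \<le> sentence_value (group_vN G) gap_sentence"
proof -
  let ?S = "carrier G"
  define Y where "Y = ?S - {\<one>}"
  obtain a b and p q r t :: "'a \<Rightarrow> real" where ab: "a \<in> ?S" "b \<in> ?S"
    and nonneg: "\<And>x. x \<in> Y \<Longrightarrow> 0 \<le> p x" "\<And>x. x \<in> Y \<Longrightarrow> 0 \<le> q x" "\<And>x. x \<in> Y \<Longrightarrow> 0 \<le> r x" "\<And>x. x \<in> Y \<Longrightarrow> 0 \<le> t x"
    and le1: "\<And>x. x \<in> Y \<Longrightarrow> p x + q x + r x + t x \<le> 1"
    and pq: "\<And>x. x \<in> Y \<Longrightarrow> 1 \<le> p (a \<otimes> x \<otimes> inv a) + q x"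
    and rt: "\<And>x. x \<in> Y \<Longrightarrow> 1 \<le> r (b \<otimes> x \<otimes> inv b) + t x"
  proof -
    obtain a b and p q r t :: "'a \<Rightarrow> real" where "a \<in> ?S" "b \<in> ?S" and
      *: "\<forall>x\<in>?S - {\<one>}. 0 \<le> p x \<and> 0 \<le> q x \<and> 0 \<le> r x \<and> 0 \<le> t x \<and> p x + q x + r x + t x \<le> 1 \<and>
        1 \<le> p (a \<otimes> x \<otimes> inv a) + q x \<and> 1 \<le> r (b \<otimes> x \<otimes> inv b) + t x"
      using assms unfolding ping_pong_def by (elim bexE exE) (rule that)
    then show ?thesis
      by (intro that[of a b p q r t]) (use * in \<open>auto simp: Y_def\<close>)
  qed
  show ?thesis
  proof (rule gap_sentence_ge[OF left_regular_in_norm_ball[OF ab(1)] left_regular_in_norm_ball[OF ab(2)]])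
    fix y assume y: "y \<in> norm_ball (group_vN G) 1"
    define \<xi> where "\<xi> = y (delta \<one>)"
    have yb: "y \<in> bounded_ops ?S" and y_vN: "y \<in> vN_generated ?S (left_regular G ` ?S)"
      using y by (auto simp: norm_ball_bounded norm_ball_group_vN)
    have \<xi>: "\<xi> \<in> ell2 ?S"
      using yb by (simp add: \<xi>_def bounded_ops_closed)
    have "ell2_norm ?S \<xi> \<le> 1"
      using op_norm_upper[OF yb, of "delta \<one>"] y by (simp add: \<xi>_def norm_ball_group_vN)
    then have \<xi>1: "(ell2_norm ?S \<xi>)\<^sup>2 \<le> 1"
      by (simp add: power_le_one)
    define m where "m k = (cmod (\<xi> k))\<^sup>2" for k
    have mX: "m summable_on Y"
      using ell2_summable[OF \<xi>] summable_on_subset[of _ ?S Y] by (auto simp: m_def[abs_def] Y_def)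
    define Mtot where "Mtot = (\<Sum>\<^sub>\<infinity>k\<in>Y. m k)"
    have "(\<Sum>\<^sub>\<infinity>k\<in>?S. m k) = m \<one> + Mtot"
      using infsum_insert[of m Y \<one>] mX by (simp add: Y_def Mtot_def insert_absorb)
    then have Mtot: "Mtot = (ell2_norm ?S \<xi>)\<^sup>2 - (cmod (\<xi> \<one>))\<^sup>2"
      by (simp add: ell2_norm_sq m_def)
    then have Mtot1: "Mtot \<le> 1"
      using \<xi>1 zero_le_power2[of "cmod (\<xi> \<one>)"] by linarith
    define D where "D g = ell2_norm ?S (\<lambda>k. left_regular G g \<xi> k - y (left_regular G g (delta \<one>)) k)" for g
    have mass: "Mtot \<le> (\<Sum>\<^sub>\<infinity>k\<in>Y. m k * u k) + (\<Sum>\<^sub>\<infinity>k\<in>Y. m k * v k) + 64 * (D g)\<^sup>2 + 1 / 64"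
      if g: "g \<in> ?S" and u: "\<And>x. x \<in> Y \<Longrightarrow> 0 \<le> u x \<and> u x \<le> 1" and v: "\<And>x. x \<in> Y \<Longrightarrow> 0 \<le> v x \<and> v x \<le> 1"
        and uv: "\<And>x. x \<in> Y \<Longrightarrow> 1 \<le> u (g \<otimes> x \<otimes> inv g) + v x" for g u v
    proof -
      define \<phi> where "\<phi> k = inv g \<otimes> k \<otimes> g" for k
      have \<phi>_inv: "g \<otimes> \<phi> k \<otimes> inv g = k" "\<phi> (g \<otimes> k \<otimes> inv g) = k" if "k \<in> ?S" for k
      proof -
        have "g \<otimes> (inv g \<otimes> k) = k" "inv g \<otimes> (g \<otimes> k) = k"
          using g that by (simp_all add: m_assoc[symmetric])
        then show "g \<otimes> \<phi> k \<otimes> inv g = k" "\<phi> (g \<otimes> k \<otimes> inv g) = k"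
          using g that by (simp_all add: \<phi>_def m_assoc)
      qed
      have \<phi>1: "\<phi> \<one> = \<one>" "g \<otimes> \<one> \<otimes> inv g = \<one>" and \<phi>S: "\<phi> k \<in> ?S" if "k \<in> ?S" for k
        using g that by (simp_all add: \<phi>_def)
      have \<phi>: "bij_betw \<phi> Y Y"
      proof (rule bij_betwI[where g = "\<lambda>k. g \<otimes> k \<otimes> inv g"])
        show "\<phi> \<in> Y \<rightarrow> Y"
          using \<phi>_inv(1) \<phi>1(2)[OF one_closed] \<phi>S by (fastforce simp: Y_def)
        show "(\<lambda>k. g \<otimes> k \<otimes> inv g) \<in> Y \<rightarrow> Y"
          using \<phi>_inv(2) \<phi>1(1)[OF one_closed] g by (fastforce simp: Y_def)
      qed (use \<phi>_inv in \<open>auto simp: Y_def\<close>)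
      have uv': "1 \<le> u k + v (\<phi> k)" if "k \<in> Y" for k
        using uv[of "\<phi> k"] bij_betwE[OF \<phi>] that g
        by (simp add: \<phi>_def Y_def m_assoc) (simp add: m_assoc[symmetric])
      define w where "w = (\<lambda>k. left_regular G g \<xi> k - y (left_regular G g (delta \<one>)) k)"
      have w: "w \<in> ell2 ?S"
        unfolding w_def using g \<xi> yb
        by (intro ell2_diff) (simp_all add: bounded_ops_closed left_regular_bounded)
      \<comment> \<open>Up to a right translation, which preserves norms, the commutator of
        \<open>y\<close> with the translation by \<open>g\<close> is the difference between the
        symbol and its conjugate.\<close>
      have w_eq: "w (k \<otimes> g) = \<xi> (\<phi> k) - \<xi> k" if "k \<in> ?S" for k
        using that g \<xi> by (simp add: w_def left_regular_delta vN_generated_delta[OF y_vN g] \<xi>_def[symmetric])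
          (simp add: left_regular_def \<phi>_def m_assoc)
      have "(\<lambda>k. (cmod (w (k \<otimes> g)))\<^sup>2) summable_on ?S \<and>
          (\<Sum>\<^sub>\<infinity>k\<in>?S. (cmod (w (k \<otimes> g)))\<^sup>2) = (\<Sum>\<^sub>\<infinity>k\<in>?S. (cmod (w k))\<^sup>2)"
        using summable_on_reindex_bij_betw[OF bij_right[OF g], of "\<lambda>k. (cmod (w k))\<^sup>2"]
          infsum_reindex_bij_betw[OF bij_right[OF g], of "\<lambda>k. (cmod (w k))\<^sup>2"] ell2_summable[OF w] by simp
      then have dS: "(\<lambda>k. (cmod (\<xi> (\<phi> k) - \<xi> k))\<^sup>2) summable_on ?S"
        and dD: "(\<Sum>\<^sub>\<infinity>k\<in>?S. (cmod (\<xi> (\<phi> k) - \<xi> k))\<^sup>2) = (D g)\<^sup>2"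
        by (simp_all add: w_eq D_def ell2_norm_sq w_def[symmetric] cong: summable_on_cong infsum_cong)
      have dX: "(\<lambda>k. (cmod (\<xi> (\<phi> k) - \<xi> k))\<^sup>2) summable_on Y"
        by (rule summable_on_subset[OF dS]) (auto simp: Y_def)
      have le: "(\<Sum>\<^sub>\<infinity>k\<in>Y. (cmod (\<xi> (\<phi> k) - \<xi> k))\<^sup>2) \<le> (D g)\<^sup>2"
        unfolding dD[symmetric] by (rule infsum_mono2) (use dS dX in \<open>auto simp: Y_def\<close>)
      \<comment> \<open>For \<open>\<epsilon> = 1 / 128\<close> the errors are 64 times the squared
        commutator and \<open>Mtot / 64\<close>; the latter is at most 1/64 because
        \<open>Mtot \<le> 1\<close>.\<close>
      have "Mtot \<le> (\<Sum>\<^sub>\<infinity>k\<in>Y. m k * u k) + (\<Sum>\<^sub>\<infinity>k\<in>Y. m k * v k) +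
          (\<Sum>\<^sub>\<infinity>k\<in>Y. (cmod (\<xi> (\<phi> k) - \<xi> k))\<^sup>2) / (2 * (1 / 128)) + 2 * (1 / 128) * Mtot"
        unfolding Mtot_def m_def
        by (rule ping_pong_mass[where p = u and q = v and \<phi> = \<phi>, OF _ \<phi> u v uv' _ dX]) (use mX in \<open>auto simp: m_def[abs_def]\<close>)
      with le Mtot1 show ?thesis
        by simp
    qed
    have bounds: "0 \<le> p x \<and> p x \<le> 1" "0 \<le> q x \<and> q x \<le> 1" "0 \<le> r x \<and> r x \<le> 1" "0 \<le> t x \<and> t x \<le> 1"
      if "x \<in> Y" for x
      using nonneg[OF that] le1[OF that] by auto
    have summ: "(\<lambda>k. m k * u k) summable_on Y" if "\<And>k. k \<in> Y \<Longrightarrow> 0 \<le> u k \<and> u k \<le> 1" for u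
      by (rule summable_on_comparison_test[OF mX])
        (use that in \<open>auto simp: m_def abs_mult intro!: mult_left_le\<close>)
    have "(\<Sum>\<^sub>\<infinity>k\<in>Y. m k * p k) + (\<Sum>\<^sub>\<infinity>k\<in>Y. m k * q k) + (\<Sum>\<^sub>\<infinity>k\<in>Y. m k * r k) + (\<Sum>\<^sub>\<infinity>k\<in>Y. m k * t k) =
        (\<Sum>\<^sub>\<infinity>k\<in>Y. m k * (p k + q k + r k + t k))"
      using summ[of p] summ[of q] summ[of r] summ[of t] bounds
      by (simp add: distrib_left infsum_add summable_on_add)
    also have "\<dots> \<le> Mtot"
      unfolding Mtot_def
    proof (rule infsum_mono[OF summ mX])
      show "m k * (p k + q k + r k + t k) \<le> m k" if "k \<in> Y" for k
        using le1[OF that] by (intro mult_left_le) (auto simp: m_def)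
    qed (use le1 nonneg in \<open>auto intro!: add_nonneg_nonneg\<close>)
    \<comment> \<open>Adding the estimates for \<open>a\<close> and \<open>b\<close> yields
      \<open>2 * Mtot\<close> on the left, while the four weighted masses on the right total at most
      one \<open>Mtot\<close>.\<close>
    finally have "Mtot \<le> 64 * ((D a)\<^sup>2 + (D b)\<^sup>2) + 1 / 32"
      using mass[of a p q, OF ab(1) bounds(1) bounds(2) pq] mass[of b r t, OF ab(2) bounds(3) bounds(4) rt]
      by simp
    moreover have "gap_value (group_vN G) (left_regular G a) (left_regular G b) y = D a + D b + max 0 (1 / 8 - Mtot)"
      using ab yb by (simp add: gap_value_group_vN left_regular_bounded D_def \<xi>_def[symmetric] Mtot)
    \<comment> \<open>Otherwise both commutators together stay below 1/64, hence \<open>Mtot\<close>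
      is at most 1/64 + 1/32 = 3/64, and the last term alone is at least 1/8 - 3/64 = 5/64.\<close>
    moreover have "1 / 64 \<le> D a + D b + max 0 (1 / 8 - Mtot)"
      if M: "Mtot \<le> 64 * ((D a)\<^sup>2 + (D b)\<^sup>2) + 1 / 32"
    proof (rule ccontr)
      assume *: "\<not> ?thesis"
      have D: "0 \<le> D a" "0 \<le> D b"
        by (simp_all add: D_def)
      have "(D a)\<^sup>2 + (D b)\<^sup>2 \<le> (D a + D b)\<^sup>2"
        using D by (simp add: power2_sum)
      also have "\<dots> \<le> (1 / 64)\<^sup>2"
        using * D max.cobounded1[of 0 "1 / 8 - Mtot"] by (intro power_mono; linarith)
      finally show False
        using M * D max.cobounded2[of "1 / 8 - Mtot" 0] unfolding power2_eq_square by simp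
    qed
    ultimately show "1 / 64 \<le> gap_value (group_vN G) (left_regular G a) (left_regular G b) y"
      by simp
  qed
qed

declare One_nat_def [simp]

section \<open>The algebraic closure of the field with two elements\<close>

definition is_subring :: "'a::comm_ring_1 set \<Rightarrow> bool" where
  "is_subring R \<longleftrightarrow> 1 \<in> R \<and> (\<forall>x\<in>R. \<forall>y\<in>R. x - y \<in> R \<and> x * y \<in> R)"

definition is_subfield :: "'a::field set \<Rightarrow> bool" where
  "is_subfield E \<longleftrightarrow> is_subring E \<and> (\<forall>x\<in>E. inverse x \<in> E)"

lemma is_subringD:
  assumes "is_subring R"
  shows "1 \<in> R" "0 \<in> R" "x \<in> R \<Longrightarrow> y \<in> R \<Longrightarrow> x - y \<in> R" "x \<in> R \<Longrightarrow> y \<in> R \<Longrightarrow> x * y \<in> R"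
    "x \<in> R \<Longrightarrow> - x \<in> R" "x \<in> R \<Longrightarrow> y \<in> R \<Longrightarrow> x + y \<in> R"
proof -
  show 1: "1 \<in> R" and d: "\<And>x y. x \<in> R \<Longrightarrow> y \<in> R \<Longrightarrow> x - y \<in> R"
    and "x \<in> R \<Longrightarrow> y \<in> R \<Longrightarrow> x * y \<in> R"
    using assms by (auto simp: is_subring_def)
  show 0: "0 \<in> R"
    using d[OF 1 1] by simp
  show m: "- x \<in> R" if "x \<in> R" for x
    using d[OF 0 that] by simp
  show "x \<in> R \<Longrightarrow> y \<in> R \<Longrightarrow> x + y \<in> R"
    using d[OF _ m, of x y] by simp
qed

lemma is_subring_sum: "is_subring R \<Longrightarrow> (\<And>i. i \<in> I \<Longrightarrow> f i \<in> R) \<Longrightarrow> sum f I \<in> R"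
  by (induction I rule: infinite_finite_induct) (auto intro: is_subringD)

lemma is_subring_power: "is_subring R \<Longrightarrow> x \<in> R \<Longrightarrow> x ^ n \<in> R"
  by (induction n) (auto intro: is_subringD)

section \<open>Finite subfields in characteristic two\<close>

lemma char2_add_self: "x + x = (0 :: bit alg_closure)"
proof -
  have "x + x = x * to_ac (1 + 1)"
    by (simp only: to_ac_add to_ac_1 distrib_left mult_1_right)
  also have "(1 + 1 :: bit) = 0"
    by simp
  finally show ?thesis
    by simp
qed

lemma char2_uminus: "- x = (x :: bit alg_closure)"
  using char2_add_self[of x] by (simp add: add_eq_0_iff)

text \<open>For \<open>m > 0\<close> this is the field with 2 to the power \<open>m\<close>
  elements; for \<open>m = 0\<close> it is everything.\<close>

definition frobenius_fixed :: "nat \<Rightarrow> bit alg_closure set" where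
  "frobenius_fixed m = {x. x ^ 2 ^ m = x}"

lemma frobenius_add: "(x + y :: bit alg_closure) ^ 2 ^ m = x ^ 2 ^ m + y ^ 2 ^ m"
proof (induction m)
  case (Suc m)
  have "(x + y) ^ 2 ^ Suc m = ((x + y) ^ 2 ^ m)\<^sup>2"
    by (simp add: power_mult[symmetric] mult.commute)
  also have "\<dots> = (x ^ 2 ^ m)\<^sup>2 + (y ^ 2 ^ m)\<^sup>2 + (x ^ 2 ^ m * y ^ 2 ^ m + x ^ 2 ^ m * y ^ 2 ^ m)"
    unfolding Suc.IH by (simp add: power2_eq_square algebra_simps)
  also have "\<dots> = x ^ 2 ^ Suc m + y ^ 2 ^ Suc m"
    by (simp add: char2_add_self power_mult[symmetric] mult.commute)
  finally show ?case .
qed simp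

lemma is_subfield_frobenius_fixed: "is_subfield (frobenius_fixed m)"
proof -
  have "x - y \<in> frobenius_fixed m" if "x \<in> frobenius_fixed m" "y \<in> frobenius_fixed m" for x y
    using that char2_uminus[of y] frobenius_add[of x y m]
    by (metis (mono_tags) diff_conv_add_uminus frobenius_fixed_def mem_Collect_eq)
  then show ?thesis
    by (auto simp: is_subfield_def is_subring_def frobenius_fixed_def power_mult_distrib power_inverse)
qed

lemma finite_frobenius_fixed: "m > 0 \<Longrightarrow> finite (frobenius_fixed m)"
proof -
  assume "m > 0"
  define p :: "bit alg_closure poly" where "p = monom 1 (2 ^ m) - [:0, 1:]"
  have "coeff p 1 = - 1"
    using \<open>m > 0\<close> by (simp add: p_def)
  then have "p \<noteq> 0"
    by auto
  then have "finite {x. poly p x = 0}"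
    by (rule poly_roots_finite)
  then show ?thesis
    by (simp add: p_def frobenius_fixed_def poly_monom)
qed

text \<open>Two finite subfields with exponents \<open>m\<close> and \<open>n\<close> thus lie in a
  common one with exponent \<open>m * n\<close>.\<close>

lemma frobenius_fixed_mult: "x \<in> frobenius_fixed m \<Longrightarrow> x \<in> frobenius_fixed (m * k)"
proof (induction k)
  case (Suc k)
  have "x ^ 2 ^ (m * Suc k) = (x ^ 2 ^ (m * k)) ^ 2 ^ m"
    by (simp add: power_mult[symmetric] power_add mult.commute)
  with Suc show ?case
    by (simp add: frobenius_fixed_def)
qed (simp add: frobenius_fixed_def)

text \<open>The powers of an element \<open>x\<close> lie in the finite set of values at \<open>x\<close> of the polynomials over
  the prime field of bounded degree, so \<open>x\<close> has finite multiplicative order, which is odd since the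
  Frobenius map is injective.\<close>

lemma ex_frobenius_fixed: "\<exists>m>0. (x :: bit alg_closure) \<in> frobenius_fixed m"
proof (cases "x = 0")
  case True
  then show ?thesis
    by (intro exI[of _ 1]) (simp add: frobenius_fixed_def)
next
  case False
  obtain p :: "bit poly" where p: "p \<noteq> 0" "poly (map_poly to_ac p) x = 0"
    by (rule alg_closure_algebraic)
  define ev where "ev q = poly (map_poly to_ac q) x" for q :: "bit poly"
  have ev_add: "ev (q + r) = ev q + ev r" for q r
    unfolding ev_def by (subst poly_add[symmetric], rule arg_cong[of _ _ "\<lambda>p. poly p x"])
      (rule poly_eqI, simp only: coeff_map_poly[of to_ac, OF to_ac_0] coeff_add to_ac_add)
  have ev_mult: "ev (q * r) = ev q * ev r" for q r
    unfolding ev_def by (subst poly_mult[symmetric], rule arg_cong[of _ _ "\<lambda>p. poly p x"])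
      (rule poly_eqI, simp only: coeff_map_poly[of to_ac, OF to_ac_0] coeff_mult to_ac_sum to_ac_mult)
  define Q where "Q = {q :: bit poly. degree q \<le> degree p}"
  have "Q \<subseteq> Poly ` {xs. set xs \<subseteq> UNIV \<and> length xs \<le> Suc (degree p)}"
  proof
    fix q assume "q \<in> Q"
    then have "length (coeffs q) \<le> Suc (degree p)"
      by (cases "q = 0") (auto simp: Q_def length_coeffs_degree)
    then show "q \<in> Poly ` {xs. set xs \<subseteq> UNIV \<and> length xs \<le> Suc (degree p)}"
      by (intro image_eqI[of _ _ "coeffs q"]) auto
  qed
  moreover have "finite (UNIV :: bit set)"
    by (rule finite_subset[of _ "{0, 1}"]) auto
  ultimately have "finite Q"
    using finite_lists_length_le[of "UNIV :: bit set" "Suc (degree p)"] by (meson finite_imageI finite_subset)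
  have "x ^ n \<in> ev ` Q" for n
  proof -
    \<comment> \<open>Division with remainder by \<open>p\<close>, which vanishes at
      \<open>x\<close>, bounds the degree without changing the value at \<open>x\<close>.\<close>
    have "monom 1 n = monom 1 n div p * p + monom 1 n mod p"
      by simp
    then have "ev (monom 1 n) = ev (monom 1 n mod p)"
      using p ev_add ev_mult by (metis add_0 ev_def mult_zero_right)
    moreover have "monom 1 n mod p \<in> Q"
      using degree_mod_less[OF p(1), of "monom 1 n"] by (auto simp: Q_def)
    ultimately show ?thesis
      by (auto simp: ev_def map_poly_monom poly_monom intro: image_eqI)
  qed
  then have "finite (range (\<lambda>n. x ^ n))"
    using \<open>finite Q\<close> by (meson finite_imageI finite_subset image_subset_iff)
  then have "\<not> inj (\<lambda>n::nat. x ^ n)"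
    using finite_imageD infinite_UNIV_nat by blast
  then obtain i j :: nat where "x ^ i = x ^ j" "i < j"
    by (metis injI nat_neq_iff)
  have "x ^ i * x ^ (j - i) = x ^ j"
    using \<open>i < j\<close> by (simp flip: power_add)
  then have "x ^ i * x ^ (j - i) = x ^ i * 1"
    using \<open>x ^ i = x ^ j\<close> by simp
  then have "\<exists>k>0. x ^ k = 1"
    using False \<open>i < j\<close> by (intro exI[of _ "j - i"]) simp
  then obtain k where k: "k > 0" "x ^ k = 1" and min: "\<And>k'. 0 < k' \<Longrightarrow> x ^ k' = 1 \<Longrightarrow> k \<le> k'"
    using LeastI_ex[of "\<lambda>k. 0 < k \<and> x ^ k = 1"] Least_le[of "\<lambda>k. 0 < k \<and> x ^ k = 1"] by blast
  have "odd k"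
  proof
    assume "even k"
    then obtain l where l: "k = 2 * l"
      by blast
    \<comment> \<open>For even order \<open>k = 2 * l\<close> the square of \<open>x ^ l + 1\<close>
      vanishes in characteristic two, which gives the smaller exponent \<open>l\<close>.\<close>
    have "(x ^ l + 1)\<^sup>2 = x ^ k + 1 + (x ^ l + x ^ l)"
      by (simp add: l power2_eq_square algebra_simps power_mult)
    also have "\<dots> = 0"
      by (simp add: k char2_add_self del: one_add_one)
    finally have "x ^ l = 1"
      by (simp add: add_eq_0_iff char2_uminus)
    then show False
      using min[of l] k l by auto
  qed
  then have "coprime 2 k"
    by simp
  \<comment> \<open>By Euler's theorem the odd order divides \<open>2 ^ totient k - 1\<close>, so
    this iterate of the Frobenius map fixes \<open>x\<close>.\<close>
  then have "[2 ^ totient k = 1] (mod k)"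
    by (rule euler_theorem)
  moreover have "(1::nat) \<le> 2 ^ totient k"
    by simp
  ultimately have "k dvd 2 ^ totient k - 1"
    by (metis cong_altdef_nat cong_sym)
  then obtain r where "2 ^ totient k - 1 = k * r"
    by blast
  then have "2 ^ totient k = Suc (k * r)"
    using \<open>1 \<le> 2 ^ totient k\<close> by linarith
  then have "x ^ 2 ^ totient k = x"
    using k by (simp add: power_mult)
  then show ?thesis
    using k by (intro exI[of _ "totient k"]) (simp add: frobenius_fixed_def)
qed

lemma locally_finite_alg_closure:
  assumes "finite T"
  shows "\<exists>E. is_subfield E \<and> finite E \<and> (T :: bit alg_closure set) \<subseteq> E"
proof -
  have "\<exists>m>0. T \<subseteq> frobenius_fixed m"
    using assms
  proof (induction T)
    case (insert x T)
    then obtain m n where "m > 0" "T \<subseteq> frobenius_fixed m" "n > 0" "x \<in> frobenius_fixed n"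
      using ex_frobenius_fixed by meson
    then show ?case
      using frobenius_fixed_mult[of _ m n] frobenius_fixed_mult[of x n m]
      by (intro exI[of _ "m * n"]) (auto simp: mult.commute)
  qed auto
  then show ?thesis
    using is_subfield_frobenius_fixed finite_frobenius_fixed by blast
qed

text \<open>Over a finite field the product of all \<open>X - a\<close>, increased by 1, is a
  polynomial of positive degree without a root.\<close>

lemma infinite_alg_closed_field: "infinite (UNIV :: 'a :: alg_closed_field set)"
proof
  assume fin: "finite (UNIV :: 'a set)"
  define p :: "'a poly" where "p = (\<Prod>a\<in>UNIV. [:- a, 1:]) + 1"
  have p1: "poly p x = 1" for x
    using fin by (auto simp: p_def poly_prod)
  have "degree (\<Prod>a\<in>(UNIV::'a set). [:- a, 1:]) = card (UNIV :: 'a set)"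
    by (subst degree_prod_eq_sum_degree) auto
  then have "degree p = card (UNIV :: 'a set)"
    using fin by (simp add: p_def degree_add_eq_left finite_UNIV_card_ge_0)
  then have "degree p > 0"
    using fin by (simp add: finite_UNIV_card_ge_0)
  then obtain x where "poly p x = 0"
    using alg_closed_imp_poly_has_root by blast
  with p1 show False
    by simp
qed

lemma countable_alg_closure: "countable (UNIV :: bit alg_closure set)"
proof -
  have "countable (\<Union>m\<in>{0<..}. frobenius_fixed m)"
    by (rule countable_UN) (auto intro: countable_finite finite_frobenius_fixed)
  moreover have "(\<Union>m\<in>{0<..}. frobenius_fixed m) = UNIV"
    using ex_frobenius_fixed by auto
  ultimately show ?thesis
    by simp
qed

section \<open>Existence of valuation rings\<close>

text \<open>Polynomials with coefficients in the principal ideal sR. One that takes the value 1 at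
  \<open>x\<close> witnesses that s generates the unit ideal of R[x].\<close>

definition ideal_poly :: "'a::field set \<Rightarrow> 'a \<Rightarrow> 'a poly \<Rightarrow> bool" where
  "ideal_poly R s p \<longleftrightarrow> (\<forall>i. coeff p i \<in> (*) s ` R)"

lemma ideal_mult:
  assumes "is_subring R" "x \<in> (*) s ` R" "c \<in> R"
  shows "x * c \<in> (*) s ` R" "c * x \<in> (*) s ` R"
proof -
  obtain r where "x = s * r" "r \<in> R"
    using assms by auto
  then have "x * c = s * (r * c)" "c * x = s * (r * c)" "r * c \<in> R"
    using is_subringD(4)[OF assms(1), of r c] assms(3) by simp_all
  then show "x * c \<in> (*) s ` R" "c * x \<in> (*) s ` R"
    by auto
qed

lemma ideal_add: "is_subring R \<Longrightarrow> x \<in> (*) s ` R \<Longrightarrow> y \<in> (*) s ` R \<Longrightarrow> x + y \<in> (*) s ` R"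
  by (auto simp flip: distrib_left intro: is_subringD)

lemma ideal_zero: "is_subring R \<Longrightarrow> 0 \<in> (*) s ` R"
  using is_subringD(2) by force

lemma ideal_sum: "is_subring R \<Longrightarrow> (\<And>i. i \<in> I \<Longrightarrow> f i \<in> (*) s ` R) \<Longrightarrow> sum f I \<in> (*) s ` R"
  by (induction I rule: infinite_finite_induct) (auto intro: ideal_add ideal_zero)

text \<open>The relation \<open>q(1/x) = 1\<close> expresses the top power of \<open>x\<close> in the relation \<open>p(x) = 1\<close> through
  lower ones.\<close>

lemma ideal_poly_reduce:
  fixes s :: "'a::field"
  assumes R: "is_subring R" and s: "s \<in> R" "s \<noteq> 0" "inverse s \<notin> R"
    and unit: "\<And>c. c \<in> R \<Longrightarrow> inverse (1 - s * c) \<in> R"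
    and x: "x \<noteq> 0" and p: "ideal_poly R s p" "poly p x = 1" and q: "ideal_poly R s q" "poly q (inverse x) = 1"
    and le: "degree q \<le> degree p"
  shows "\<exists>p'. ideal_poly R s p' \<and> poly p' x = 1 \<and> degree p' < degree p"
proof -
  define n where "n = degree p"
  define m where "m = degree q"
  \<comment> \<open>The ideal sR is proper because \<open>inverse s\<close> does not lie in
    \<open>R\<close>.\<close>
  have not_one: "c \<noteq> 1" if "c \<in> (*) s ` R" for c
  proof
    assume "c = 1"
    with that obtain r where "s * r = 1" "r \<in> R"
      by auto
    then have "inverse s = r"
      using inverse_unique by blast
    then show False
      using s \<open>r \<in> R\<close> by simp
  qed
  have pc: "coeff p i \<in> (*) s ` R" and qc: "coeff q i \<in> (*) s ` R" for i
    using p q by (simp_all add: ideal_poly_def)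
  have "n > 0"
  proof (rule ccontr)
    assume "\<not> n > 0"
    then have "poly p x = coeff p 0"
      by (simp add: poly_altdef n_def)
    then show False
      using p(2) not_one[OF pc] by simp
  qed
  define u where "u = 1 - coeff q 0"
  define w where "w = inverse u"
  have "w \<in> R"
    using unit qc[of 0] by (auto simp: w_def u_def)
  have "u \<noteq> 0"
    using not_one[OF qc, of 0] by (simp add: u_def)
  \<comment> \<open>Multiplying the relation for \<open>inverse x\<close> by the \<open>n\<close>-th
    power of \<open>x\<close> gives \<open>poly t x = u * x ^ n\<close>, where \<open>t\<close> has
    degree below \<open>n\<close>. As \<open>u\<close> is a unit of \<open>R\<close>, this
    eliminates the top term of \<open>p\<close>.\<close>
  define t where "t = (\<Sum>i=1..m. monom (coeff q i) (n - i))"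
  have t_coeff: "coeff t j = (\<Sum>i=1..m. if n - i = j then coeff q i else 0)" for j
    by (simp add: t_def coeff_sum)
  have "1 = (\<Sum>i\<le>m. coeff q i * inverse x ^ i)"
    using q(2) by (simp add: poly_altdef m_def)
  also have "{..m} = insert 0 {1..m}"
    by auto
  also have "(\<Sum>i\<in>insert 0 {1..m}. coeff q i * inverse x ^ i) =
      coeff q 0 + (\<Sum>i=1..m. coeff q i * inverse x ^ i)"
    by simp
  finally have u: "u = (\<Sum>i=1..m. coeff q i * inverse x ^ i)"
    by (simp add: u_def algebra_simps)
  have t_poly: "poly t x = u * x ^ n"
    unfolding t_def poly_sum u sum_distrib_right
  proof (rule sum.cong[OF refl])
    fix i assume i: "i \<in> {1..m}"
    have "x ^ n = x ^ i * x ^ (n - i)"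
      using i le by (simp add: m_def n_def flip: power_add)
    then show "poly (monom (coeff q i) (n - i)) x = coeff q i * inverse x ^ i * x ^ n"
      using x by (simp add: poly_monom power_inverse)
  qed
  define l where "l = coeff p n"
  define p' where "p' = p - monom l n + smult (l * w) t"
  have "poly p' x = 1"
    using \<open>u \<noteq> 0\<close> p(2) by (simp add: p'_def poly_monom t_poly w_def)
  moreover have "ideal_poly R s p'"
    unfolding ideal_poly_def
  proof
    fix j
    have "coeff t j \<in> (*) s ` R"
      unfolding t_coeff by (intro ideal_sum R) (auto simp: qc ideal_zero[OF R])
    then have "w * coeff t j \<in> (*) s ` R"
      using \<open>w \<in> R\<close> by (rule ideal_mult[OF R])
    moreover have "l \<in> R"
      using pc[of n] s(1) is_subringD(4)[OF R] by (auto simp: l_def)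
    ultimately have "l * (w * coeff t j) \<in> (*) s ` R"
      by (rule ideal_mult[OF R])
    moreover have "coeff (p - monom l n) j \<in> (*) s ` R"
      using pc[of j] ideal_zero[OF R] by (simp add: l_def)
    ultimately show "coeff p' j \<in> (*) s ` R"
      by (simp add: p'_def ideal_add[OF R] mult.assoc)
  qed
  moreover have "degree p' < n"
  proof -
    have "coeff p' j = 0" if "j > n - 1" for j
    proof -
      have "coeff t j = 0"
        unfolding t_coeff using that \<open>n > 0\<close> by (intro sum.neutral) auto
      moreover have "coeff (p - monom l n) j = 0"
        using that by (cases "j = n") (auto simp: l_def n_def coeff_eq_0)
      ultimately show ?thesis
        by (simp add: p'_def)
    qed
    then have "degree p' \<le> n - 1"
      by (intro degree_le) auto
    then show ?thesis
      using \<open>n > 0\<close> by simp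
  qed
  ultimately show ?thesis
    by (auto simp: n_def)
qed

text \<open>Infinite descent on the sum of the degrees: the hypotheses are symmetric in
  \<open>x\<close> and \<open>inverse x\<close>, so whichever relation has the larger degree can be
  shortened.\<close>

lemma ideal_poly_not_both:
  fixes s :: "'a::field"
  assumes R: "is_subring R" and s: "s \<in> R" "s \<noteq> 0" "inverse s \<notin> R"
    and unit: "\<And>c. c \<in> R \<Longrightarrow> inverse (1 - s * c) \<in> R"
  shows "x \<noteq> 0 \<Longrightarrow> ideal_poly R s p \<Longrightarrow> ideal_poly R s q \<Longrightarrow> poly p x = 1 \<Longrightarrow> poly q (inverse x) = 1 \<Longrightarrow> False"
proof (induction "degree p + degree q" arbitrary: p q rule: less_induct)
  case less
  show ?case
  proof (cases "degree q \<le> degree p")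
    case True
    obtain p' where "ideal_poly R s p'" "poly p' x = 1" "degree p' < degree p"
      using ideal_poly_reduce[OF R s unit less.prems(1,2,4,3,5) True] by blast
    then show ?thesis
      using less.hyps[of p' q] less.prems by simp
  next
    case False
    obtain q' where "ideal_poly R s q'" "poly q' (inverse x) = 1" "degree q' < degree q"
      using ideal_poly_reduce[OF R s unit _ less.prems(3,5,2)] less.prems(1,4) False by auto
    then show ?thesis
      using less.hyps[of p q'] less.prems by simp
  qed
qed

lemma is_subring_adjoin:
  fixes x :: "'a::field"
  assumes R: "is_subring R"
  shows "is_subring {poly p x | p. \<forall>i. coeff p i \<in> R}" (is "is_subring ?A")
    and "R \<subseteq> {poly p x | p. \<forall>i. coeff p i \<in> R}" and "x \<in> {poly p x | p. \<forall>i. coeff p i \<in> R}"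
proof -
  note [intro] = is_subringD[OF R]
  have const: "c \<in> ?A" if "c \<in> R" for c
    using that by (auto intro!: exI[of _ "[:c:]"] simp: coeff_pCons split: nat.split)
  show "R \<subseteq> ?A"
    using const by blast
  show "x \<in> ?A"
    by (auto intro!: exI[of _ "[:0, 1:]"] simp: coeff_pCons split: nat.split)
  show "is_subring ?A"
    unfolding is_subring_def
  proof (intro conjI ballI)
    show "1 \<in> ?A"
      using const by blast
    fix y z assume "y \<in> ?A" "z \<in> ?A"
    then obtain p q where p: "y = poly p x" "\<And>i. coeff p i \<in> R" and q: "z = poly q x" "\<And>i. coeff q i \<in> R"
      by blast
    show "y - z \<in> ?A"
      using p q by (auto intro!: exI[of _ "p - q"] is_subringD(3)[OF R])
    show "y * z \<in> ?A"
      using p q by (auto intro!: exI[of _ "p * q"] is_subring_sum[OF R] is_subringD(4)[OF R] simp: coeff_mult)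
  qed
qed

text \<open>Chevalley's theorem: a subring that is maximal subject to not containing \<open>1/s\<close> is a valuation
  ring.\<close>

lemma valuation_ring_exists:
  fixes s :: "'a::field"
  assumes R0: "is_subring R0" and s: "s \<in> R0" "s \<noteq> 0" "inverse s \<notin> R0"
  obtains R where "is_subring R" "R0 \<subseteq> R" "inverse s \<notin> R" "\<And>x. x \<in> R \<or> inverse x \<in> R"
proof -
  define \<A> where "\<A> = {R. is_subring R \<and> R0 \<subseteq> R \<and> inverse s \<notin> R}"
  have "\<exists>M\<in>\<A>. \<forall>Y\<in>\<A>. M \<subseteq> Y \<longrightarrow> Y = M"
  proof (rule subset_Zorn_nonempty)
    show "\<A> \<noteq> {}"
      using assms by (auto simp: \<A>_def)
    fix \<C> assume "\<C> \<noteq> {}" and chain: "subset.chain \<A> \<C>"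
    have sub: "is_subring C" "R0 \<subseteq> C" "inverse s \<notin> C" if "C \<in> \<C>" for C
      using chain that by (auto simp: subset.chain_def \<A>_def)
    have "is_subring (\<Union>\<C>)"
      unfolding is_subring_def
    proof (intro conjI ballI)
      show "1 \<in> \<Union>\<C>"
        using \<open>\<C> \<noteq> {}\<close> sub(1) is_subringD(1) by blast
      fix x y assume "x \<in> \<Union>\<C>" "y \<in> \<Union>\<C>"
      then obtain C where "C \<in> \<C>" "x \<in> C" "y \<in> C"
      proof -
        from \<open>x \<in> \<Union>\<C>\<close> \<open>y \<in> \<Union>\<C>\<close> obtain B C where BC: "B \<in> \<C>" "x \<in> B" "C \<in> \<C>" "y \<in> C"
          by blast
        then have "B \<subseteq> C \<or> C \<subseteq> B"
          using chain by (auto simp: subset.chain_def)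
        then show ?thesis
          using BC that by blast
      qed
      then show "x - y \<in> \<Union>\<C>" "x * y \<in> \<Union>\<C>"
        using sub(1) is_subringD(3,4) by blast+
    qed
    moreover obtain C where "C \<in> \<C>"
      using \<open>\<C> \<noteq> {}\<close> by blast
    ultimately show "\<Union>\<C> \<in> \<A>"
      using sub(2)[of C] sub(3) by (auto simp: \<A>_def)
  qed
  then obtain R where RA: "R \<in> \<A>" and maxA: "\<And>Y. Y \<in> \<A> \<Longrightarrow> R \<subseteq> Y \<Longrightarrow> Y = R"
    by blast
  have R: "is_subring R" "R0 \<subseteq> R" "inverse s \<notin> R"
    using RA by (simp_all add: \<A>_def)
  have max: "Y = R" if "is_subring Y" "R \<subseteq> Y" "inverse s \<notin> Y" for Y
    by (rule maxA) (use that R(2) in \<open>auto simp: \<A>_def\<close>)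
  have sR: "s \<in> R"
    using s R by auto
  have not_one: "1 - s * c \<noteq> 0" if "c \<in> R" for c
  proof
    assume "1 - s * c = 0"
    then have "inverse s = c"
      by (intro inverse_unique) simp
    then show False
      using R that by simp
  qed
  \<comment> \<open>By maximality R[x] contains \<open>inverse s\<close>; multiplying such a
    polynomial expression by \<open>s\<close> gives the value 1.\<close>
  have adjoin: "\<exists>p. ideal_poly R s p \<and> poly p x = 1" if "x \<notin> R" for x
  proof -
    have "inverse s \<in> {poly p x | p. \<forall>i. coeff p i \<in> R}"
      using max[OF is_subring_adjoin(1,2)[OF R(1)], of x] is_subring_adjoin(3)[OF R(1), of x] that by blast
    then obtain p where "inverse s = poly p x" "\<And>i. coeff p i \<in> R"
      by blast
    then show ?thesis
      using s(2) by (intro exI[of _ "smult s p"]) (auto simp: ideal_poly_def simp flip: \<open>inverse s = poly p x\<close>)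
  qed
  \<comment> \<open>If the inverse of \<open>u\<close> were missing, clearing denominators in the
    relation for \<open>inverse u\<close> would put a power of \<open>u\<close> into sR. But
    \<open>u\<close>, and with it every power, is congruent to 1 modulo sR, so 1 would lie in
    sR.\<close>
  have unit: "inverse (1 - s * c) \<in> R" if c: "c \<in> R" for c
  proof (rule ccontr)
    define u where "u = 1 - s * c"
    assume "inverse (1 - s * c) \<notin> R"
    then obtain p where p: "ideal_poly R s p" "poly p (inverse u) = 1"
      using adjoin u_def by blast
    have u: "u \<noteq> 0" "u \<in> R"
      using not_one[OF c] is_subringD[OF R(1)] sR c by (auto simp: u_def)
    define n where "n = degree p"
    have "u ^ n = poly (reflect_poly p) u"
      using poly_reflect_poly_nz[OF u(1), of p] p by (simp add: n_def)
    also have "\<dots> \<in> (*) s ` R"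
      unfolding poly_altdef
    proof (rule ideal_sum[OF R(1)])
      fix i
      have "coeff (reflect_poly p) i \<in> (*) s ` R"
        using p(1) ideal_zero[OF R(1)] by (auto simp: coeff_reflect_poly ideal_poly_def)
      then show "coeff (reflect_poly p) i * u ^ i \<in> (*) s ` R"
        by (intro ideal_mult[OF R(1)] is_subring_power[OF R(1)] u)
    qed
    finally have un: "u ^ n \<in> (*) s ` R" .
    have "1 - u ^ n \<in> (*) s ` R"
    proof (induction n)
      case (Suc n)
      have "1 - u ^ Suc n = (1 - u ^ n) * u + s * c"
        by (simp add: u_def algebra_simps)
      then show ?case
        using ideal_add[OF R(1) ideal_mult(1)[OF R(1) Suc u(2)] imageI[OF c]] by simp
    qed (simp add: ideal_zero[OF R(1)])
    then have "1 \<in> (*) s ` R"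
      using ideal_add[OF R(1) un, of "1 - u ^ n"] by simp
    then obtain r where "r \<in> R" "1 - s * r = 0"
      by auto
    then show False
      using not_one by blast
  qed
  have "x \<in> R \<or> inverse x \<in> R" for x
  proof (cases "x = 0")
    case True
    then show ?thesis
      using is_subringD(2)[OF R(1)] by simp
  next
    case False
    then show ?thesis
      using adjoin[of x] adjoin[of "inverse x"] ideal_poly_not_both[OF R(1) sR s(2) R(3) unit, of x] by blast
  qed
  with R that show ?thesis
    by blast
qed

section \<open>Ultrapowers of fields\<close>

definition free_ultrafilter :: "nat filter" where
  "free_ultrafilter = (SOME U. U \<le> sequentially \<and> ultrafilter U)"

lemma free_ultrafilter: "free_ultrafilter \<le> sequentially" "ultrafilter free_ultrafilter"
  using someI_ex[OF ultrafilter_exists[OF sequentially_bot, unfolded Bex_def]]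
  by (auto simp: free_ultrafilter_def)

interpretation free_ultrafilter: ultrafilter free_ultrafilter
  by (rule free_ultrafilter)

quotient_type 'a ultrapower = "nat \<Rightarrow> 'a" / "\<lambda>f g. eventually (\<lambda>n. f n = g n) free_ultrafilter"
  by (intro equivpI reflpI sympI transpI) (auto elim: eventually_mono eventually_elim2)

instantiation ultrapower :: (field) comm_ring_1
begin

lift_definition zero_ultrapower :: "'a ultrapower" is "\<lambda>n. 0" .
lift_definition one_ultrapower :: "'a ultrapower" is "\<lambda>n. 1" .
lift_definition plus_ultrapower :: "'a ultrapower \<Rightarrow> 'a ultrapower \<Rightarrow> 'a ultrapower"
  is "\<lambda>f g n. f n + g n" by (erule (1) eventually_elim2) simp
lift_definition minus_ultrapower :: "'a ultrapower \<Rightarrow> 'a ultrapower \<Rightarrow> 'a ultrapower"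
  is "\<lambda>f g n. f n - g n" by (erule (1) eventually_elim2) simp
lift_definition times_ultrapower :: "'a ultrapower \<Rightarrow> 'a ultrapower \<Rightarrow> 'a ultrapower"
  is "\<lambda>f g n. f n * g n" by (erule (1) eventually_elim2) simp
lift_definition uminus_ultrapower :: "'a ultrapower \<Rightarrow> 'a ultrapower"
  is "\<lambda>f n. - f n" by (erule eventually_mono) simp

instance
  by (intro_classes; transfer) (simp_all add: algebra_simps free_ultrafilter.proper)

end

instantiation ultrapower :: (field) field
begin

lift_definition divide_ultrapower :: "'a ultrapower \<Rightarrow> 'a ultrapower \<Rightarrow> 'a ultrapower"
  is "\<lambda>f g n. f n / g n" by (erule (1) eventually_elim2) simp
lift_definition inverse_ultrapower :: "'a ultrapower \<Rightarrow> 'a ultrapower"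
  is "\<lambda>f n. inverse (f n)" by (erule eventually_mono) simp

instance
proof
  show "inverse a * a = 1" if "a \<noteq> 0" for a :: "'a ultrapower"
    using that
  proof transfer
    fix f :: "nat \<Rightarrow> 'a" assume "\<not> eventually (\<lambda>n. f n = 0) free_ultrafilter"
    then have "eventually (\<lambda>n. f n \<noteq> 0) free_ultrafilter"
      by (simp add: free_ultrafilter.eventually_not_iff)
    then show "eventually (\<lambda>n. inverse (f n) * f n = 1) free_ultrafilter"
      by (rule eventually_mono) simp
  qed
  show "a div b = a * inverse b" for a b :: "'a ultrapower"
    by transfer (simp add: divide_inverse)
  show "inverse (0 :: 'a ultrapower) = 0"
    by transfer simp
qed

end

lemma abs_ultrapower_eq_iff:
  "abs_ultrapower f = abs_ultrapower g \<longleftrightarrow> eventually (\<lambda>n. f n = g n) free_ultrafilter"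
  by (simp add: ultrapower.abs_eq_iff)

lemma ex_abs_ultrapower: "\<exists>f. x = abs_ultrapower f"
proof -
  have "abs_ultrapower (rep_ultrapower x) = x"
    by (rule Quotient_abs_rep[OF Quotient_ultrapower])
  then show ?thesis
    by metis
qed

text \<open>Roots are chosen in each coordinate. The quadratic case supplies the eigenlines and the
  primitive cube root of unity used for ping-pong.\<close>

lemma ultrapower_quadratic_root:
  fixes b c :: "'a::alg_closed_field ultrapower"
  shows "\<exists>z. z * z + b * z + c = 0"
proof transfer
  fix b c :: "nat \<Rightarrow> 'a"
  have "\<exists>z. z * z + b n * z + c n = 0" for n
  proof -
    obtain z where "poly [:c n, b n, 1:] z = 0"
      using alg_closed_imp_poly_has_root[of "[:c n, b n, 1:]"] by auto
    then show ?thesis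
      by (intro exI[of _ z]) (simp add: algebra_simps)
  qed
  then obtain z where "\<And>n. z n * z n + b n * z n + c n = 0"
    by metis
  then show "\<exists>z. eventually (\<lambda>n. z n * z n + b n * z n + c n = 0) free_ultrafilter"
    by (intro exI[of _ z]) simp
qed

text \<open>The class \<open>s\<close> of an injective sequence is transcendental over the constants, so \<open>1/s\<close> is not
  a polynomial in \<open>s\<close>.\<close>

lemma ultrapower_valuation_ring:
  assumes "infinite (UNIV :: 'a::field set)"
  obtains R and s :: "'a::field ultrapower" where "is_subring R" "s \<in> R" "s \<noteq> 0" "inverse s \<notin> R"
    "\<And>x. x \<in> R \<or> inverse x \<in> R"
proof -
  obtain \<sigma> :: "nat \<Rightarrow> 'a" where \<sigma>: "inj \<sigma>"
    using assms infinite_countable_subset by blast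
  define s where "s = abs_ultrapower \<sigma>"
  define R0 where "R0 = {abs_ultrapower (\<lambda>n. poly p (\<sigma> n)) | p. True}"
  \<comment> \<open>An injective sequence meets the finitely many roots only finitely often, and the
    free ultrafilter ignores finite sets.\<close>
  have root: "\<not> eventually (\<lambda>n. poly p (\<sigma> n) = 0) free_ultrafilter" if "p \<noteq> 0" for p
  proof -
    have "finite (\<sigma> -` {x. poly p x = 0})"
      using poly_roots_finite[OF that] \<sigma> by (intro finite_vimageI)
    then have "eventually (\<lambda>n. poly p (\<sigma> n) \<noteq> 0) sequentially"
      by (simp add: eventually_cofinite vimage_def flip: cofinite_eq_sequentially)
    then have "eventually (\<lambda>n. poly p (\<sigma> n) \<noteq> 0) free_ultrafilter"
      using free_ultrafilter(1) by (rule filter_leD[rotated])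
    then show ?thesis
      by (simp add: free_ultrafilter.eventually_not_iff)
  qed
  have s0: "s \<noteq> 0"
    using root[of "[:0, 1:]"] by (simp add: s_def zero_ultrapower_def abs_ultrapower_eq_iff)
  have "is_subring R0"
    unfolding is_subring_def
  proof (intro conjI ballI)
    show "1 \<in> R0"
      by (auto simp: R0_def one_ultrapower_def intro!: exI[of _ 1])
    fix x y assume "x \<in> R0" "y \<in> R0"
    then obtain p q where "x = abs_ultrapower (\<lambda>n. poly p (\<sigma> n))" "y = abs_ultrapower (\<lambda>n. poly q (\<sigma> n))"
      by (auto simp: R0_def)
    then show "x - y \<in> R0" "x * y \<in> R0"
      by (auto simp: R0_def minus_ultrapower.abs_eq times_ultrapower.abs_eq
          intro: exI[of _ "p - q"] exI[of _ "p * q"])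
  qed
  moreover have "s \<in> R0"
    by (auto simp: R0_def s_def intro!: exI[of _ "[:0, 1:]"])
  moreover have "inverse s \<notin> R0"
  proof
    assume "inverse s \<in> R0"
    then obtain p where p: "inverse s = abs_ultrapower (\<lambda>n. poly p (\<sigma> n))"
      by (auto simp: R0_def)
    have "s * inverse s = 1"
      using s0 by simp
    then have "eventually (\<lambda>n. \<sigma> n * poly p (\<sigma> n) = 1) free_ultrafilter"
      unfolding p by (simp add: s_def times_ultrapower.abs_eq one_ultrapower_def abs_ultrapower_eq_iff)
    \<comment> \<open>If \<open>inverse s\<close> were a polynomial \<open>p\<close> in
      \<open>s\<close>, then \<open>s\<close> would be a root of \<open>X p - 1\<close>, which is
      not zero since its value at 0 is -1.\<close>
    then have "eventually (\<lambda>n. poly ([:0, 1:] * p - 1) (\<sigma> n) = 0) free_ultrafilter"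
      by (rule eventually_mono) simp
    moreover have "poly ([:0, 1:] * p - 1) 0 \<noteq> 0"
      by simp
    then have "[:0, 1:] * p - 1 \<noteq> 0"
      by (metis poly_0)
    ultimately show False
      using root by blast
  qed
  ultimately obtain R where "is_subring R" "R0 \<subseteq> R" "inverse s \<notin> R" "\<And>x. x \<in> R \<or> inverse x \<in> R"
    using valuation_ring_exists[of R0 s] s0 by metis
  with \<open>s \<in> R0\<close> s0 that show ?thesis
    by blast
qed

section \<open>The affine group of the plane\<close>

type_synonym 'k vec2 = "'k \<times> 'k"
type_synonym 'k mat2 = "'k \<times> 'k \<times> 'k \<times> 'k"

fun mat_vec :: "'k::field mat2 \<Rightarrow> 'k vec2 \<Rightarrow> 'k vec2" where
  "mat_vec (a, b, c, d) (x, y) = (a * x + b * y, c * x + d * y)"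

fun mat_mult :: "'k::field mat2 \<Rightarrow> 'k mat2 \<Rightarrow> 'k mat2" where
  "mat_mult (a, b, c, d) (a', b', c', d') = (a * a' + b * c', a * b' + b * d', c * a' + d * c', c * b' + d * d')"

fun mat_det :: "'k::field mat2 \<Rightarrow> 'k" where
  "mat_det (a, b, c, d) = a * d - b * c"

text \<open>The adjugate, which is the inverse of a matrix of determinant one.\<close>

fun mat_adj :: "'k::field mat2 \<Rightarrow> 'k mat2" where
  "mat_adj (a, b, c, d) = (d, - b, - c, a)"

definition mat_one :: "'k::field mat2" where
  "mat_one = (1, 0, 0, 1)"

fun vec_add :: "'k::field vec2 \<Rightarrow> 'k vec2 \<Rightarrow> 'k vec2" where
  "vec_add (x, y) (x', y') = (x + x', y + y')"

fun vec_scale :: "'k::field \<Rightarrow> 'k vec2 \<Rightarrow> 'k vec2" where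
  "vec_scale c (x, y) = (c * x, c * y)"

lemma mat_vec_one [simp]: "mat_vec mat_one v = v"
  by (cases v) (simp add: mat_one_def)

lemma mat_vec_mult: "mat_vec (mat_mult g h) v = mat_vec g (mat_vec h v)"
  by (cases g; cases h; cases v) (simp add: algebra_simps)

lemma mat_vec_add: "mat_vec g (vec_add v w) = vec_add (mat_vec g v) (mat_vec g w)"
  by (cases g; cases v; cases w) (simp add: algebra_simps)

lemma mat_vec_scale: "mat_vec g (vec_scale c v) = vec_scale c (mat_vec g v)"
  by (cases g; cases v) (simp add: algebra_simps)

lemma mat_vec_zero [simp]: "mat_vec g (0, 0) = (0, 0)"
  by (cases g) simp

lemma mat_mult_assoc: "mat_mult (mat_mult g h) k = mat_mult g (mat_mult h k)"
  by (cases g; cases h; cases k) (simp add: algebra_simps)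

lemma mat_mult_one [simp]: "mat_mult mat_one g = g" "mat_mult g mat_one = g"
  by (cases g; simp add: mat_one_def)+

lemma mat_mult_adj: "mat_det g = 1 \<Longrightarrow> mat_mult g (mat_adj g) = mat_one" "mat_det g = 1 \<Longrightarrow> mat_mult (mat_adj g) g = mat_one"
  by (cases g; simp add: mat_one_def algebra_simps)+

lemma mat_det_mult: "mat_det (mat_mult g h) = mat_det g * mat_det h"
  by (cases g; cases h) (simp add: algebra_simps)

lemma mat_det_adj [simp]: "mat_det (mat_adj g) = mat_det g"
  by (cases g) (simp add: algebra_simps)

lemma mat_det_one [simp]: "mat_det mat_one = 1"
  by (simp add: mat_one_def)

lemma vec_add_assoc: "vec_add (vec_add u v) w = vec_add u (vec_add v w)"
  by (cases u; cases v; cases w) (simp add: add.assoc)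

lemma vec_add_commute: "vec_add u v = vec_add v u"
  by (cases u; cases v) (simp add: add.commute)

lemma vec_add_zero [simp]: "vec_add (0, 0) v = v" "vec_add v (0, 0) = v"
  by (cases v; simp)+

lemma vec_add_neg [simp]: "vec_add (vec_scale (- 1) v) v = (0, 0)" "vec_add v (vec_scale (- 1) v) = (0, 0)"
  by (cases v; simp)+

lemma vec_scale_simps [simp]:
  "vec_scale 1 u = u" "vec_scale c (vec_scale d u) = vec_scale (c * d) u" "vec_scale c (0, 0) = (0, 0)"
  by (cases u; simp)+

lemma mat_adj_one [simp]: "mat_adj mat_one = mat_one"
  by (simp add: mat_one_def)

lemma conj_eq_mat_one_iff:
  assumes "mat_det A = 1"
  shows "mat_mult (mat_mult A g) (mat_adj A) = mat_one \<longleftrightarrow> g = mat_one"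
proof
  assume *: "mat_mult (mat_mult A g) (mat_adj A) = mat_one"
  have "g = mat_mult (mat_mult (mat_adj A) A) (mat_mult g (mat_mult (mat_adj A) A))"
    using assms by (simp add: mat_mult_adj)
  also have "\<dots> = mat_mult (mat_mult (mat_adj A) (mat_mult (mat_mult A g) (mat_adj A))) A"
    by (simp only: mat_mult_assoc)
  finally show "g = mat_one"
    using assms by (simp add: * mat_mult_adj)
qed (use assms in \<open>simp add: mat_mult_adj\<close>)

lemma mat_vec_adj_cancel:
  assumes "mat_det g = 1"
  shows "mat_vec g (mat_vec (mat_adj g) v) = v" "mat_vec (mat_adj g) (mat_vec g v) = v"
  using assms by (simp_all add: mat_mult_adj flip: mat_vec_mult)

text \<open>The pair \<open>(v, g)\<close> stands for the affine map sending \<open>x\<close> to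
  \<open>g x + v\<close>, and multiplication is composition.\<close>

definition aff_group :: "('k::field vec2 \<times> 'k mat2) monoid" where
  "aff_group = \<lparr>carrier = {(v, g). mat_det g = 1},
    mult = (\<lambda>(v, g) (w, h). (vec_add v (mat_vec g w), mat_mult g h)), one = ((0, 0), mat_one)\<rparr>"

lemma aff_group_simps [simp]:
  "(v, g) \<in> carrier aff_group \<longleftrightarrow> mat_det g = 1"
  "(v, g) \<otimes>\<^bsub>aff_group\<^esub> (w, h) = (vec_add v (mat_vec g w), mat_mult g h)"
  "\<one>\<^bsub>aff_group\<^esub> = ((0, 0), mat_one)"
  by (simp_all add: aff_group_def)

lemma group_aff_group: "group (aff_group :: ('k::field vec2 \<times> 'k mat2) monoid)"
proof (rule groupI)
  fix x y z :: "'k vec2 \<times> 'k mat2"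
  assume "x \<in> carrier aff_group"
  then obtain v g where x: "x = (v, g)" "mat_det g = 1"
    by (cases x) auto
  show "\<exists>y\<in>carrier aff_group. y \<otimes>\<^bsub>aff_group\<^esub> x = \<one>\<^bsub>aff_group\<^esub>"
    using x by (intro bexI[of _ "(vec_scale (- 1) (mat_vec (mat_adj g) v), mat_adj g)"])
      (simp_all add: mat_mult_adj)
  show "\<one>\<^bsub>aff_group\<^esub> \<otimes>\<^bsub>aff_group\<^esub> x = x"
    using x by simp
  assume "y \<in> carrier aff_group"
  then obtain w h where y: "y = (w, h)" "mat_det h = 1"
    by (cases y) auto
  show "x \<otimes>\<^bsub>aff_group\<^esub> y \<in> carrier aff_group"
    using x y by (simp add: mat_det_mult)
  assume "z \<in> carrier aff_group"
  obtain u k where z: "z = (u, k)"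
    by (cases z)
  show "x \<otimes>\<^bsub>aff_group\<^esub> y \<otimes>\<^bsub>aff_group\<^esub> z = x \<otimes>\<^bsub>aff_group\<^esub> (y \<otimes>\<^bsub>aff_group\<^esub> z)"
    using x y z by (simp add: mat_mult_assoc mat_vec_mult mat_vec_add vec_add_assoc)
qed simp

lemma inv_aff_group:
  assumes "mat_det g = 1"
  shows "inv\<^bsub>aff_group\<^esub> (v, g) = (vec_scale (- 1) (mat_vec (mat_adj g) v), mat_adj g)"
proof -
  interpret group aff_group
    by (rule group_aff_group)
  show ?thesis
    by (rule inv_equality) (use assms in \<open>auto simp: mat_mult_adj\<close>)
qed

lemma conj_aff_group:
  assumes "mat_det g = 1"
  shows "(v, g) \<otimes>\<^bsub>aff_group\<^esub> (w, h) \<otimes>\<^bsub>aff_group\<^esub> inv\<^bsub>aff_group\<^esub> (v, g) =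
    (vec_add (vec_add v (mat_vec g w))
      (vec_scale (- 1) (mat_vec (mat_mult (mat_mult g h) (mat_adj g)) v)), mat_mult (mat_mult g h) (mat_adj g))"
  using assms by (simp add: inv_aff_group mat_vec_mult mat_vec_scale)

text \<open>Conjugation by translations moves any element with nontrivial linear part, conjugation
  by unipotent matrices any nontrivial translation. An infinite set of parameters suffices, so that
  a countable subgroup can qualify over a larger field.\<close>

lemma icc_aff_subgroup:
  fixes C :: "('k::field vec2 \<times> 'k mat2) set"
  assumes C: "subgroup C aff_group" and \<Lambda>: "infinite \<Lambda>"
    and gen: "\<And>l. l \<in> \<Lambda> \<Longrightarrow> ((l, 0), mat_one) \<in> C" "\<And>l. l \<in> \<Lambda> \<Longrightarrow> ((0, l), mat_one) \<in> C"
      "\<And>l. l \<in> \<Lambda> \<Longrightarrow> ((0, 0), (1, l, 0, 1)) \<in> C" "\<And>l. l \<in> \<Lambda> \<Longrightarrow> ((0, 0), (1, 0, l, 1)) \<in> C"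
  shows "icc (aff_group\<lparr>carrier := C\<rparr>)"
  unfolding icc_def
proof (intro ballI impI)
  interpret group "aff_group :: ('k vec2 \<times> 'k mat2) monoid"
    by (rule group_aff_group)
  fix z assume z: "z \<in> carrier (aff_group\<lparr>carrier := C\<rparr>)" "z \<noteq> \<one>\<^bsub>aff_group\<lparr>carrier := C\<rparr>\<^esub>"
  let ?K = "conjugacy_class (aff_group\<lparr>carrier := C\<rparr>) z"
  have K: "h \<otimes>\<^bsub>aff_group\<^esub> z \<otimes>\<^bsub>aff_group\<^esub> inv\<^bsub>aff_group\<^esub> h \<in> ?K" if "h \<in> C" for h
    using that m_inv_consistent[OF C that] unfolding conjugacy_class_def
    by (intro CollectI exI[of _ h]) simp
  have inf: "infinite ?K" if "\<And>l. l \<in> \<Lambda> \<Longrightarrow> f l \<in> C"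
      and "inj (\<lambda>l. f l \<otimes>\<^bsub>aff_group\<^esub> z \<otimes>\<^bsub>aff_group\<^esub> inv\<^bsub>aff_group\<^esub> (f l))" for f
  proof
    assume "finite ?K"
    then have "finite ((\<lambda>l. f l \<otimes>\<^bsub>aff_group\<^esub> z \<otimes>\<^bsub>aff_group\<^esub> inv\<^bsub>aff_group\<^esub> (f l)) ` \<Lambda>)"
      by (rule finite_subset[rotated]) (use that(1) K in blast)
    then show False
      using that(2) \<Lambda> by (meson finite_imageD inj_on_subset subset_UNIV)
  qed
  obtain x y a b c d where z_eq: "z = ((x, y), (a, b, c, d))"
    by (metis prod.collapse)
  have det: "a * d - b * c = 1"
    using z(1) subgroup.subset[OF C] by (auto simp: z_eq)
  \<comment> \<open>If the linear part is nontrivial, one column of its difference from the identity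
    is nonzero, which selects the direction of the translations. Otherwise a coordinate of the
    translation vector is nonzero.\<close>
  consider "a \<noteq> 1 \<or> c \<noteq> 0" | "d \<noteq> 1 \<or> b \<noteq> 0" | "a = 1" "c = 0" "d = 1" "b = 0" "y \<noteq> 0"
    | "a = 1" "c = 0" "d = 1" "b = 0" "x \<noteq> 0"
    using z(2) by (auto simp: z_eq mat_one_def)
  then show "infinite ?K"
  proof cases
    case 1
    show ?thesis
    proof (rule inf[OF gen(1)])
      show "inj (\<lambda>l. ((l, 0), mat_one) \<otimes>\<^bsub>aff_group\<^esub> z \<otimes>\<^bsub>aff_group\<^esub> inv\<^bsub>aff_group\<^esub> ((l, 0), mat_one))"
      proof (rule injI)
        fix l l' assume "((l, 0), mat_one) \<otimes>\<^bsub>aff_group\<^esub> z \<otimes>\<^bsub>aff_group\<^esub> inv\<^bsub>aff_group\<^esub> ((l, 0), mat_one) =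
          ((l', 0), mat_one) \<otimes>\<^bsub>aff_group\<^esub> z \<otimes>\<^bsub>aff_group\<^esub> inv\<^bsub>aff_group\<^esub> ((l', 0), mat_one)"
        then have *: "l + x - a * l = l' + x - a * l'" "y - c * l = y - c * l'"
          by (simp_all add: conj_aff_group z_eq del: aff_group_simps)
        then have "(1 - a) * (l - l') = 0" "c * (l - l') = 0"
          by (simp add: algebra_simps) (use * in \<open>auto simp: right_diff_distrib\<close>)
        with 1 show "l = l'"
          by auto
      qed
    qed
  next
    case 2
    show ?thesis
    proof (rule inf[OF gen(2)])
      show "inj (\<lambda>l. ((0, l), mat_one) \<otimes>\<^bsub>aff_group\<^esub> z \<otimes>\<^bsub>aff_group\<^esub> inv\<^bsub>aff_group\<^esub> ((0, l), mat_one))"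
      proof (rule injI)
        fix l l' assume "((0, l), mat_one) \<otimes>\<^bsub>aff_group\<^esub> z \<otimes>\<^bsub>aff_group\<^esub> inv\<^bsub>aff_group\<^esub> ((0, l), mat_one) =
          ((0, l'), mat_one) \<otimes>\<^bsub>aff_group\<^esub> z \<otimes>\<^bsub>aff_group\<^esub> inv\<^bsub>aff_group\<^esub> ((0, l'), mat_one)"
        then have *: "x - b * l = x - b * l'" "l + y - d * l = l' + y - d * l'"
          by (simp_all add: conj_aff_group z_eq del: aff_group_simps)
        then have "(1 - d) * (l - l') = 0" "b * (l - l') = 0"
          by (simp add: algebra_simps) (use * in \<open>auto simp: right_diff_distrib\<close>)
        with 2 show "l = l'"
          by auto
      qed
    qed
  next
    case 3
    show ?thesis
    proof (rule inf[OF gen(3)])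
      show "inj (\<lambda>l. ((0, 0), (1, l, 0, 1)) \<otimes>\<^bsub>aff_group\<^esub> z \<otimes>\<^bsub>aff_group\<^esub> inv\<^bsub>aff_group\<^esub> ((0, 0), (1, l, 0, 1)))"
        using 3 by (intro injI) (simp add: conj_aff_group z_eq del: aff_group_simps)
    qed
  next
    case 4
    show ?thesis
    proof (rule inf[OF gen(4)])
      show "inj (\<lambda>l. ((0, 0), (1, 0, l, 1)) \<otimes>\<^bsub>aff_group\<^esub> z \<otimes>\<^bsub>aff_group\<^esub> inv\<^bsub>aff_group\<^esub> ((0, 0), (1, 0, l, 1)))"
        using 4 by (intro injI) (simp add: conj_aff_group z_eq del: aff_group_simps)
    qed
  qed
qed

definition aff_ultra :: "(nat \<Rightarrow> 'k::field vec2 \<times> 'k mat2) \<Rightarrow> 'k ultrapower vec2 \<times> 'k ultrapower mat2" where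
  "aff_ultra f = ((abs_ultrapower (\<lambda>n. fst (fst (f n))), abs_ultrapower (\<lambda>n. snd (fst (f n)))),
    (abs_ultrapower (\<lambda>n. fst (snd (f n))), abs_ultrapower (\<lambda>n. fst (snd (snd (f n)))),
     abs_ultrapower (\<lambda>n. fst (snd (snd (snd (f n))))), abs_ultrapower (\<lambda>n. snd (snd (snd (snd (f n)))))))"

lemma mat_det_fst_snd: "mat_det g = fst g * snd (snd (snd g)) - fst (snd g) * fst (snd (snd g))"
  by (cases g) simp

lemma ultraproduct_map_aff:
  "ultraproduct_map free_ultrafilter (aff_group :: ('k::field vec2 \<times> 'k mat2) monoid) aff_group aff_ultra"
proof (intro ultraproduct_map.intro ultraproduct_map_axioms.intro)
  show "ultrafilter free_ultrafilter"
    by (rule free_ultrafilter)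
  show "group (aff_group :: ('k vec2 \<times> 'k mat2) monoid)" "group (aff_group :: ('k ultrapower vec2 \<times> 'k ultrapower mat2) monoid)"
    by (rule group_aff_group)+
  have carrier_iff: "x \<in> carrier aff_group \<longleftrightarrow> mat_det (snd x) = 1" for x :: "'l::field vec2 \<times> 'l mat2"
    by (cases x) simp
  show "aff_ultra f \<in> carrier aff_group"
    if "\<And>n. f n \<in> carrier aff_group" for f :: "nat \<Rightarrow> 'k vec2 \<times> 'k mat2"
    using that
    by (simp add: carrier_iff aff_ultra_def mat_det_fst_snd times_ultrapower.abs_eq minus_ultrapower.abs_eq
        one_ultrapower_def)
  show "\<exists>f. (\<forall>n. f n \<in> carrier aff_group) \<and> aff_ultra f = y"
    if y: "y \<in> carrier aff_group" for y :: "'k ultrapower vec2 \<times> 'k ultrapower mat2"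
  proof -
    obtain v1 v2 g1 g2 g3 g4 where y_eq: "y = ((v1, v2), (g1, g2, g3, g4))"
      by (metis prod.collapse)
    obtain f1 f2 h1 h2 h3 h4 where reps: "v1 = abs_ultrapower f1" "v2 = abs_ultrapower f2"
      "g1 = abs_ultrapower h1" "g2 = abs_ultrapower h2" "g3 = abs_ultrapower h3" "g4 = abs_ultrapower h4"
      using ex_abs_ultrapower by meson
    have det: "eventually (\<lambda>n. mat_det (h1 n, h2 n, h3 n, h4 n) = 1) free_ultrafilter"
      using y by (simp add: y_eq reps times_ultrapower.abs_eq minus_ultrapower.abs_eq one_ultrapower_def
          abs_ultrapower_eq_iff)
    \<comment> \<open>The determinant of the representatives is 1 only for almost all indices;
      elsewhere they are replaced by the identity to stay in the group.\<close>
    define f where "f n = (if mat_det (h1 n, h2 n, h3 n, h4 n) = 1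
      then ((f1 n, f2 n), (h1 n, h2 n, h3 n, h4 n)) else ((0, 0), mat_one))" for n
    have "\<forall>n. f n \<in> carrier aff_group"
      by (simp add: f_def)
    moreover have "aff_ultra f = y"
      unfolding aff_ultra_def y_eq reps prod.inject abs_ultrapower_eq_iff
      by (intro conjI; rule eventually_mono[OF det]; simp add: f_def)
    ultimately show ?thesis
      by blast
  qed
  show "aff_ultra f = aff_ultra g \<longleftrightarrow> eventually (\<lambda>n. f n = g n) free_ultrafilter"
    for f g :: "nat \<Rightarrow> 'k vec2 \<times> 'k mat2"
    by (simp add: aff_ultra_def abs_ultrapower_eq_iff prod_eq_iff eventually_conj_iff)
  show "aff_ultra (\<lambda>n. f n \<otimes>\<^bsub>aff_group\<^esub> g n) = aff_ultra f \<otimes>\<^bsub>aff_group\<^esub> aff_ultra g"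
    for f g :: "nat \<Rightarrow> 'k vec2 \<times> 'k mat2"
  proof -
    have mult_eq: "x \<otimes>\<^bsub>aff_group\<^esub> y = ((fst (fst x) + (fst (snd x) * fst (fst y) + fst (snd (snd x)) * snd (fst y)),
       snd (fst x) + (fst (snd (snd (snd x))) * fst (fst y) + snd (snd (snd (snd x))) * snd (fst y))),
       (fst (snd x) * fst (snd y) + fst (snd (snd x)) * fst (snd (snd (snd y))),
        fst (snd x) * fst (snd (snd y)) + fst (snd (snd x)) * snd (snd (snd (snd y))),
        fst (snd (snd (snd x))) * fst (snd y) + snd (snd (snd (snd x))) * fst (snd (snd (snd y))),
        fst (snd (snd (snd x))) * fst (snd (snd y)) + snd (snd (snd (snd x))) * snd (snd (snd (snd y)))))"
      for x y :: "'l::field vec2 \<times> 'l mat2"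
      by (cases x rule: prod.exhaust; cases y rule: prod.exhaust) (auto simp: aff_group_def split: prod.splits)
    show ?thesis
      by (simp add: mult_eq aff_ultra_def times_ultrapower.abs_eq plus_ultrapower.abs_eq)
  qed
qed

section \<open>Central projections in affine groups over locally finite fields\<close>

text \<open>The projections are supported on the translations by vectors in \<open>E \<times> E\<close>, for a finite subfield
  \<open>E\<close> with \<open>q\<close> elements. For a one-dimensional subspace \<open>l\<close> let \<open>P\<^sub>l\<close> be the average of the
  translations by elements of \<open>l\<close>, and \<open>P\<close> the average of all translations. Then the
  \<open>P\<^sub>l - P\<close> are mutually orthogonal projections, with coefficients as follows.\<close>

definition line_coeff :: "real \<Rightarrow> 'k vec2 set \<Rightarrow> 'k vec2 \<Rightarrow> real" where
  "line_coeff q l v = (if v \<in> l then 1 else 0) / q - 1 / q\<^sup>2"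

locale finite_subfield =
  fixes E :: "'k::field set"
  assumes subfield: "is_subfield E" and finite_E: "finite E"
begin

lemma subring_E: "is_subring E"
  using subfield by (simp add: is_subfield_def)

lemmas E_closed = is_subringD[OF subring_E]

lemma E_inverse: "x \<in> E \<Longrightarrow> inverse x \<in> E"
  using subfield by (simp add: is_subfield_def)

lemma E_divide: "x \<in> E \<Longrightarrow> y \<in> E \<Longrightarrow> x / y \<in> E"
  by (simp add: divide_inverse E_closed E_inverse)

definition q :: nat where "q = card E"

lemma q_pos: "q > 0"
  using E_closed(1) finite_E by (auto simp: q_def card_gt_0_iff)

definition V :: "'k vec2 set" where "V = E \<times> E"

definition eline :: "'k vec2 \<Rightarrow> 'k vec2 set" where "eline u = (\<lambda>c. vec_scale c u) ` E"

definition elines :: "'k vec2 set set" where "elines = eline ` (V - {(0, 0)})"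

lemma V_closed: "(0, 0) \<in> V" "v \<in> V \<Longrightarrow> w \<in> V \<Longrightarrow> vec_add v w \<in> V" "c \<in> E \<Longrightarrow> v \<in> V \<Longrightarrow> vec_scale c v \<in> V"
    "v \<in> V \<Longrightarrow> vec_scale (- 1) v \<in> V"
  by (cases v; cases w; auto simp: V_def E_closed)+

lemma finite_V: "finite V" and card_V: "card V = q\<^sup>2"
  by (auto simp: V_def finite_E q_def card_cartesian_product power2_eq_square)

lemma eline_props:
  assumes "u \<in> V - {(0, 0)}"
  shows "eline u \<subseteq> V" "card (eline u) = q" "(0, 0) \<in> eline u" "u \<in> eline u"
proof -
  show "eline u \<subseteq> V"
    using assms by (auto simp: eline_def V_closed)
  have "inj_on (\<lambda>c. vec_scale c u) E"
    using assms by (cases u) (auto simp: inj_on_def)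
  then show "card (eline u) = q"
    by (simp add: eline_def card_image q_def)
  show "(0, 0) \<in> eline u"
    unfolding eline_def by (rule image_eqI[of _ _ 0]) (cases u; auto simp: E_closed)+
  show "u \<in> eline u"
    unfolding eline_def by (rule image_eqI[of _ _ 1]) (auto simp: E_closed)
qed

lemma eline_scale:
  assumes "k \<in> E" "k \<noteq> 0"
  shows "eline (vec_scale k u) = eline u"
proof
  show "eline (vec_scale k u) \<subseteq> eline u"
  proof
    fix w assume "w \<in> eline (vec_scale k u)"
    then obtain c where "w = vec_scale (c * k) u" "c \<in> E"
      unfolding eline_def by auto
    then show "w \<in> eline u"
      using assms unfolding eline_def by (intro image_eqI[of _ _ "c * k"]) (auto intro: E_closed)
  qed
  have "vec_scale c u = vec_scale (c / k) (vec_scale k u)" for c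
    using assms by simp
  then show "eline u \<subseteq> eline (vec_scale k u)"
  proof (intro subsetI)
    fix w assume "w \<in> eline u"
    then obtain c where "w = vec_scale (c / k) (vec_scale k u)" "c \<in> E"
      unfolding eline_def using \<open>\<And>c. vec_scale c u = vec_scale (c / k) (vec_scale k u)\<close> by blast
    then show "w \<in> eline (vec_scale k u)"
      using assms unfolding eline_def by (intro image_eqI[of _ _ "c / k"]) (auto intro: E_divide)
  qed
qed

lemma eline_eqI:
  assumes u: "u \<in> V - {(0, 0)}" and v: "v \<in> V - {(0, 0)}" and det: "fst u * snd v = snd u * fst v"
  shows "eline u = eline v"
proof -
  obtain x y x' y' where uv: "u = (x, y)" "v = (x', y')"
    by (metis prod.collapse)
  have E: "x \<in> E" "y \<in> E" "x' \<in> E" "y' \<in> E"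
    using u v by (auto simp: uv V_def)
  show ?thesis
  proof (cases "x = 0")
    case True
    then have "y \<noteq> 0"
      using u by (simp add: uv)
    with True have "x' = 0"
      using det by (simp add: uv)
    then have "v = vec_scale (y' / y) u" "y' / y \<noteq> 0"
      using \<open>y \<noteq> 0\<close> True v by (auto simp: uv)
    then show ?thesis
      using eline_scale[of "y' / y" u] E by (simp add: E_divide)
  next
    case False
    have "y' = x' / x * y"
      using det False by (simp add: uv field_simps)
    then have "v = vec_scale (x' / x) u"
      using False by (simp add: uv)
    moreover from this have "x' / x \<noteq> 0"
      using v by (auto simp: uv)
    ultimately show ?thesis
      using eline_scale[of "x' / x" u] E by (simp add: E_divide)
  qed
qed

text \<open>This counts the decompositions of \<open>v\<close> as a sum from \<open>l\<close> and
  \<open>l'\<close>, that is, the convolution of the two indicator functions. Distinct lines are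
  complementary, so the decomposition is unique.\<close>

lemma card_line_inter:
  assumes l: "l \<in> elines" "l' \<in> elines" and v: "v \<in> V"
  shows "card {w \<in> V. w \<in> l \<and> vec_add (vec_scale (- 1) w) v \<in> l'} =
    (if l = l' then if v \<in> l then q else 0 else 1)"
proof -
  obtain u u' where u: "u \<in> V - {(0, 0)}" "l = eline u" and u': "u' \<in> V - {(0, 0)}" "l' = eline u'"
    using l by (auto simp: elines_def)
  show ?thesis
  proof (cases "l = l'")
    case True
    have *: "vec_add a b \<in> l" "vec_add (vec_scale (- 1) a) b \<in> l" if ab: "a \<in> l" "b \<in> l" for a b
    proof -
      obtain c d where "a = vec_scale c u" "b = vec_scale d u" "c \<in> E" "d \<in> E"
        using ab unfolding u(2) eline_def by blast
      then have "vec_add a b = vec_scale (c + d) u" "vec_add (vec_scale (- 1) a) b = vec_scale (d - c) u"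
        "c + d \<in> E" "d - c \<in> E"
        by (cases u; simp add: algebra_simps E_closed)+
      then show "vec_add a b \<in> l" "vec_add (vec_scale (- 1) a) b \<in> l"
        by (auto simp: u(2) eline_def)
    qed
    have v_eq: "vec_add w (vec_add (vec_scale (- 1) w) v) = v" for w
      by (simp flip: vec_add_assoc)
    have "vec_add (vec_scale (- 1) w) v \<in> l \<longleftrightarrow> v \<in> l" if "w \<in> l" for w
      using *(1)[of w "vec_add (vec_scale (- 1) w) v", unfolded v_eq] *(2)[of w v] that by blast
    moreover have "l \<subseteq> V"
      using eline_props(1)[OF u(1)] u(2) by simp
    ultimately have "{w \<in> V. w \<in> l \<and> vec_add (vec_scale (- 1) w) v \<in> l} = {w \<in> l. v \<in> l}"
      by blast
    also have "\<dots> = (if v \<in> l then l else {})"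
      by simp
    finally have "{w \<in> V. w \<in> l \<and> vec_add (vec_scale (- 1) w) v \<in> l} = (if v \<in> l then l else {})" .
    then show ?thesis
      using True eline_props(2)[OF u(1)] by (simp add: u(2))
  next
    case False
    obtain x y x' y' v1 v2 where c: "u = (x, y)" "u' = (x', y')" "v = (v1, v2)"
      by (metis prod.collapse)
    have E: "x \<in> E" "y \<in> E" "x' \<in> E" "y' \<in> E" "v1 \<in> E" "v2 \<in> E"
      using u u' v by (auto simp: c V_def)
    define D where "D = x * y' - y * x'"
    have D: "D \<noteq> 0"
      using False eline_eqI[OF u(1) u'(1)] by (auto simp: D_def c u(2) u'(2))
    \<comment> \<open>Coordinates of \<open>v\<close> in the basis \<open>u\<close>,
      \<open>u'\<close> by Cramer's rule.\<close>
    define \<alpha> where "\<alpha> = (v1 * y' - v2 * x') / D"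
    define \<beta> where "\<beta> = (x * v2 - y * v1) / D"
    have \<alpha>\<beta>: "\<alpha> \<in> E" "\<beta> \<in> E"
      using E by (auto simp: \<alpha>_def \<beta>_def D_def intro!: E_divide E_closed)
    have "{w \<in> V. w \<in> l \<and> vec_add (vec_scale (- 1) w) v \<in> l'} = {vec_scale \<alpha> u}"
    proof (intro equalityI subsetI)
      fix w assume "w \<in> {w \<in> V. w \<in> l \<and> vec_add (vec_scale (- 1) w) v \<in> l'}"
      then obtain a b where ab: "w = vec_scale a u" "vec_add (vec_scale (- 1) w) v = vec_scale b u'"
        by (auto simp: u(2) u'(2) eline_def)
      then have "v1 = a * x + b * x'" "v2 = a * y + b * y'"
        by (auto simp: c algebra_simps)
      then have "v1 * y' - v2 * x' = a * D"
        by (simp add: D_def algebra_simps)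
      then show "w \<in> {vec_scale \<alpha> u}"
        using D by (simp add: ab(1) \<alpha>_def)
    next
      fix w assume "w \<in> {vec_scale \<alpha> u}"
      then have w: "w = vec_scale \<alpha> u"
        by simp
      have "D * (v1 - \<alpha> * x) = D * (\<beta> * x')" "D * (v2 - \<alpha> * y) = D * (\<beta> * y')"
        using D by (simp_all add: \<alpha>_def \<beta>_def right_diff_distrib) (simp_all add: D_def algebra_simps)
      then have "vec_add (vec_scale (- 1) w) v = vec_scale \<beta> u'"
        using D by (simp add: w c)
      then show "w \<in> {w \<in> V. w \<in> l \<and> vec_add (vec_scale (- 1) w) v \<in> l'}"
        using \<alpha>\<beta> u(1) by (auto simp: w u(2) u'(2) eline_def V_closed)
    qed
    with False show ?thesis
      by simp
  qed
qed

lemma sum_translate: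
  assumes v: "v \<in> V"
  shows "(\<Sum>w\<in>V. f (vec_add (vec_scale (- 1) w) v)) = (\<Sum>w\<in>V. f w)"
proof (rule sum.reindex_bij_witness[where i = "\<lambda>w. vec_add (vec_scale (- 1) w) v"
      and j = "\<lambda>w. vec_add (vec_scale (- 1) w) v"])
  show "vec_add (vec_scale (- 1) (vec_add (vec_scale (- 1) w) v)) v = w" for w
    by (cases w; cases v) simp
  then show "vec_add (vec_scale (- 1) (vec_add (vec_scale (- 1) w) v)) v = w" for w .
qed (use v in \<open>simp_all add: V_closed\<close>)

text \<open>Expanding the product, both mixed terms contribute minus one over the square of
  \<open>q\<close> and the constant term plus one, so the result is the number of decompositions of
  \<open>v\<close>, less one, over the square of \<open>q\<close>.\<close>

lemma line_coeff_conv: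
  assumes l: "l \<in> elines" "l' \<in> elines" and v: "v \<in> V"
  shows "(\<Sum>w\<in>V. line_coeff q l w * line_coeff q l' (vec_add (vec_scale (- 1) w) v)) =
    (if l = l' then line_coeff q l v else 0)"
proof -
  have ind: "(\<Sum>w\<in>V. if w \<in> l then 1 else 0 :: real) = q" if l0: "l \<in> elines" for l
  proof -
    obtain u where "u \<in> V - {(0, 0)}" "l = eline u"
      using l0 unfolding elines_def by blast
    then have "l \<subseteq> V" "card l = q"
      using eline_props by simp_all
    then have "V \<inter> l = l"
      by blast
    then show ?thesis
      using \<open>card l = q\<close> finite_V by (simp add: sum.If_cases)
  qed
  have 1: "(\<Sum>w\<in>V. if vec_add (vec_scale (- 1) w) v \<in> l' then 1 else 0 :: real) = q"
    using sum_translate[OF v, of "\<lambda>w. if w \<in> l' then 1 else 0 :: real"] ind[OF l(2)] by simp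
  have 2: "(\<Sum>w\<in>V. (if w \<in> l then 1 else 0) * (if vec_add (vec_scale (- 1) w) v \<in> l' then 1 else 0 :: real)) =
      card {w \<in> V. w \<in> l \<and> vec_add (vec_scale (- 1) w) v \<in> l'}"
  proof -
    have "(\<Sum>w\<in>V. (if w \<in> l then 1 else 0) * (if vec_add (vec_scale (- 1) w) v \<in> l' then 1 else 0 :: real)) =
        (\<Sum>w\<in>V. if w \<in> l \<and> vec_add (vec_scale (- 1) w) v \<in> l' then 1 else 0)"
      by (intro sum.cong) auto
    then show ?thesis
      using finite_V by (simp add: sum.If_cases Int_def)
  qed
  define Q where "Q = real q"
  have Q: "Q > 0"
    using q_pos by (simp add: Q_def)
  have "(a * x - x\<^sup>2) * (b * x - x\<^sup>2) = (a * b) * x\<^sup>2 - a * x ^ 3 - b * x ^ 3 + x ^ 4" for a b x :: real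
    by (simp add: algebra_simps power2_eq_square power3_eq_cube power4_eq_xxxx)
  from this[of _ "1 / Q"]
  have "(a / Q - 1 / Q\<^sup>2) * (b / Q - 1 / Q\<^sup>2) = (a * b) * (1 / Q\<^sup>2) - a * (1 / Q ^ 3) - b * (1 / Q ^ 3) + 1 / Q ^ 4"
    for a b :: real
    by (simp add: power_one_over)
  then have "line_coeff q l w * line_coeff q l' (vec_add (vec_scale (- 1) w) v) =
      ((if w \<in> l then 1 else 0) * (if vec_add (vec_scale (- 1) w) v \<in> l' then 1 else 0)) * (1 / Q\<^sup>2)
      - (if w \<in> l then 1 else 0) * (1 / Q ^ 3)
      - (if vec_add (vec_scale (- 1) w) v \<in> l' then 1 else 0) * (1 / Q ^ 3) + 1 / Q ^ 4" for w
    unfolding line_coeff_def Q_def[symmetric] .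
  then have "(\<Sum>w\<in>V. line_coeff q l w * line_coeff q l' (vec_add (vec_scale (- 1) w) v)) =
      card {w \<in> V. w \<in> l \<and> vec_add (vec_scale (- 1) w) v \<in> l'} * (1 / Q\<^sup>2) - Q * (1 / Q ^ 3) - Q * (1 / Q ^ 3)
      + Q\<^sup>2 * (1 / Q ^ 4)"
    by (simp only: sum.distrib sum_subtractf sum_distrib_right[symmetric] 1 2 ind[OF l(1)])
      (simp add: card_V Q_def)
  also have "\<dots> = (real (card {w \<in> V. w \<in> l \<and> vec_add (vec_scale (- 1) w) v \<in> l'}) - 1) / Q\<^sup>2"
    using Q by (simp add: field_simps power2_eq_square power3_eq_cube power4_eq_xxxx)
  also have "\<dots> = (if l = l' then line_coeff q l v else 0)"
    unfolding card_line_inter[OF assms]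
    using Q by (auto simp: line_coeff_def Q_def[symmetric] field_simps power2_eq_square)
  finally show ?thesis .
qed

lemma finite_elines: "finite elines"
  by (simp add: elines_def finite_V)

lemma card_elines: "q \<le> card elines"
proof -
  have "inj_on (\<lambda>z. eline (z, 1)) E"
  proof (rule inj_onI)
    fix z z' assume z: "z \<in> E" "z' \<in> E" "eline (z, 1) = eline (z', 1)"
    then have "(z, 1) \<in> eline (z', 1)"
      using eline_props(4)[of "(z, 1)"] E_closed(1) by (auto simp: V_def)
    then show "z = z'"
      by (auto simp: eline_def)
  qed
  then have "q = card ((\<lambda>z. eline (z, 1)) ` E)"
    by (simp add: q_def card_image)
  also have "\<dots> \<le> card elines"
  proof (rule card_mono[OF finite_elines], rule image_subsetI)
    fix z assume "z \<in> E"
    then have "(z, 1) \<in> V - {(0, 0)}"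
      using E_closed(1) by (simp add: V_def)
    then show "eline (z, 1) \<in> elines"
      unfolding elines_def by (rule imageI)
  qed
  finally show ?thesis .
qed

text \<open>Unions of orbits of a small group can have any size up to a small error.\<close>

lemma invariant_lines_exist:
  assumes K: "finite K" "mat_one \<in> K" "\<And>g h. g \<in> K \<Longrightarrow> h \<in> K \<Longrightarrow> mat_mult g h \<in> K"
    and act: "\<And>g l. g \<in> K \<Longrightarrow> l \<in> elines \<Longrightarrow> mat_vec g ` l \<in> elines"
    and small: "4 * card K \<le> q"
  obtains S where "S \<subseteq> elines" "\<And>g l. g \<in> K \<Longrightarrow> l \<in> S \<Longrightarrow> mat_vec g ` l \<in> S" "q \<le> 4 * card S" "4 * card S \<le> 3 * q"
proof -
  define \<P> where "\<P> = {S. S \<subseteq> elines \<and> (\<forall>g\<in>K. \<forall>l\<in>S. mat_vec g ` l \<in> S) \<and> 4 * card S \<le> 3 * q}"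
  have "finite \<P>"
    by (rule finite_subset[of _ "Pow elines"]) (auto simp: \<P>_def finite_elines)
  moreover have "{} \<in> \<P>"
    by (simp add: \<P>_def)
  ultimately obtain S where S: "S \<in> \<P>" and max: "\<And>S'. S' \<in> \<P> \<Longrightarrow> S \<subseteq> S' \<Longrightarrow> S = S'"
    using finite_has_maximal[of \<P>] by auto
  have S_props: "S \<subseteq> elines" "\<And>g l. g \<in> K \<Longrightarrow> l \<in> S \<Longrightarrow> mat_vec g ` l \<in> S" "4 * card S \<le> 3 * q"
    using S by (auto simp: \<P>_def)
  have "q \<le> 4 * card S"
  proof (rule ccontr)
    assume small': "\<not> q \<le> 4 * card S"
    have "finite S"
      using S_props(1) finite_elines by (rule finite_subset)
    have "\<not> elines \<subseteq> S"
      using card_mono[OF \<open>finite S\<close>, of elines] card_elines small' by auto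
    then obtain l where l: "l \<in> elines" "l \<notin> S"
      by blast
    \<comment> \<open>An orbit has at most \<open>q / 4\<close> elements, so adding one to a set of
      size below \<open>q / 4\<close> keeps it below \<open>3 q / 4\<close>, against
      maximality.\<close>
    define S' where "S' = S \<union> (\<lambda>g. mat_vec g ` l) ` K"
    have "card S' \<le> card S + card K"
      unfolding S'_def using card_Un_le card_image_le[OF K(1)] by (meson add_left_mono order_trans)
    then have "4 * card S' \<le> 3 * q"
      using small small' by simp
    moreover have "mat_vec g ` mat_vec h ` l = mat_vec (mat_mult g h) ` l" for g h
      by (simp add: image_image mat_vec_mult)
    then have "\<forall>g\<in>K. \<forall>l\<in>S'. mat_vec g ` l \<in> S'"
      using S_props(2) K(3) by (auto simp: S'_def)
    moreover have "S' \<subseteq> elines"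
      using S_props(1) act l by (auto simp: S'_def)
    ultimately have "S' \<in> \<P>"
      by (simp add: \<P>_def)
    then have "S = S'"
      by (rule max) (simp add: S'_def)
    moreover have "mat_vec mat_one ` l = l"
      by simp
    moreover have "mat_vec mat_one ` l \<in> S'"
      unfolding S'_def using K(2) by blast
    ultimately show False
      using l by simp
  qed
  with S_props that show ?thesis
    by blast
qed

end

text \<open>A finite field \<open>E0\<close> containing the matrix entries of \<open>F\<close> fixes
  a finite matrix group \<open>K\<close>. The field \<open>E\<close> is then taken so large that
  orbits of \<open>K\<close> on its lines are short compared with \<open>q\<close>, and an invariant
  set with between one and three quarters of \<open>q\<close> lines gives the projection.\<close>

lemma locally_central_projections_aff:
  assumes inf: "infinite (UNIV :: 'k::field set)"
    and locfin: "\<And>T :: 'k set. finite T \<Longrightarrow> \<exists>E. is_subfield E \<and> finite E \<and> T \<subseteq> E"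
  shows "locally_central_projections (aff_group :: ('k vec2 \<times> 'k mat2) monoid)"
  unfolding locally_central_projections_def
proof (intro allI impI, elim conjE)
  interpret G: group "aff_group :: ('k vec2 \<times> 'k mat2) monoid"
    by (rule group_aff_group)
  fix F :: "('k vec2 \<times> 'k mat2) set" assume F: "finite F" "F \<subseteq> carrier aff_group"
  define entries where "entries g = {fst g, fst (snd g), fst (snd (snd g)), snd (snd (snd g))}" for g :: "'k mat2"
  \<comment> \<open>Only linear parts are collected, since translations commute with one
    another.\<close>
  obtain E0 where E0: "is_subfield E0" "finite E0" "(\<Union>x\<in>F. entries (snd x)) \<subseteq> E0"
    using locfin[of "\<Union>x\<in>F. entries (snd x)"] F(1) by (auto simp: entries_def)
  define K where "K = {g. mat_det g = 1 \<and> entries g \<subseteq> E0}"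
  have "K \<subseteq> E0 \<times> E0 \<times> E0 \<times> E0"
    by (auto simp: K_def entries_def)
  then have K_fin: "finite K"
    using E0(2) by (meson finite_SigmaI finite_subset)
  \<comment> \<open>An auxiliary set whose only purpose is to force \<open>E\<close> to be
    large.\<close>
  obtain T :: "'k set" where T: "finite T" "card T = 4 * card K + 4"
    using infinite_arbitrarily_large[OF inf] by blast
  obtain E where E: "is_subfield E" "finite E" "E0 \<union> T \<subseteq> E"
    using locfin[of "E0 \<union> T"] E0(2) T(1) by auto
  interpret finite_subfield E
    by unfold_locales (use E in auto)
  have E0_sub: "is_subring E0"
    using E0(1) by (simp add: is_subfield_def)
  note E0c = is_subringD[OF E0_sub]
  have q_ge: "4 * card K + 4 \<le> q"
    using T card_mono[OF E(2), of T] E(3) by (simp add: q_def)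
  have K_one: "mat_one \<in> K"
    by (auto simp: K_def entries_def mat_one_def E0c)
  have K_mult: "mat_mult g h \<in> K" if "g \<in> K" "h \<in> K" for g h
  proof -
    have "entries (mat_mult g h) \<subseteq> E0"
      using that by (cases g; cases h) (auto simp: K_def entries_def intro!: E0c)
    then show ?thesis
      using that by (simp add: K_def mat_det_mult)
  qed
  have K_adj: "mat_adj g \<in> K" if "g \<in> K" for g
    using that by (cases g) (auto simp: K_def entries_def algebra_simps intro!: E0c)
  have KV: "mat_vec g v \<in> V" if "g \<in> K" "v \<in> V" for g v
    using that E(3) by (cases g; cases v) (auto simp: K_def entries_def V_def intro!: E_closed)
  have K_eline: "mat_vec g ` eline u = eline (mat_vec g u)" for g u
    by (simp add: eline_def image_image mat_vec_scale)
  have K_elines: "mat_vec g ` l \<in> elines" if g: "g \<in> K" and l: "l \<in> elines" for g l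
  proof -
    obtain u where u: "u \<in> V - {(0, 0)}" "l = eline u"
      using l by (auto simp: elines_def)
    have "mat_vec g u \<noteq> (0, 0)"
      using u(1) mat_vec_adj_cancel(2)[of g u] g by (auto simp: K_def)
    then show ?thesis
      using KV[OF g] u by (auto simp: elines_def K_eline simp del: split_paired_Ex)
  qed
  obtain S where S: "S \<subseteq> elines" "\<And>g l. g \<in> K \<Longrightarrow> l \<in> S \<Longrightarrow> mat_vec g ` l \<in> S"
    "q \<le> 4 * card S" "4 * card S \<le> 3 * q"
    using invariant_lines_exist[OF K_fin K_one K_mult K_elines] q_ge by auto
  have S_fin: "finite S"
    using S(1) finite_elines by (rule finite_subset)
  define f where "f v = (\<Sum>l\<in>S. line_coeff q l v)" for v
  define c where "c x = (if snd x = mat_one \<and> fst x \<in> V then f (fst x) else 0)" for x :: "'k vec2 \<times> 'k mat2"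
  define N where "N = (\<lambda>v. (v, mat_one :: 'k mat2)) ` V"
  have inv_N: "inv\<^bsub>aff_group\<^esub> (v, mat_one) = (vec_scale (- 1) v, mat_one)" for v :: "'k vec2"
    by (simp add: inv_aff_group)
  \<comment> \<open>A sum of mutually orthogonal projections is a projection: only the diagonal
    terms survive.\<close>
  have f_conv: "(\<Sum>w\<in>V. f w * f (vec_add (vec_scale (- 1) w) v)) = f v" if v: "v \<in> V" for v
  proof -
    have "(\<Sum>w\<in>V. f w * f (vec_add (vec_scale (- 1) w) v)) =
        (\<Sum>l\<in>S. \<Sum>l'\<in>S. \<Sum>w\<in>V. line_coeff q l w * line_coeff q l' (vec_add (vec_scale (- 1) w) v))"
      unfolding f_def sum_product by (subst sum.swap, intro sum.cong refl, subst sum.swap, rule refl)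
    also have "\<dots> = (\<Sum>l\<in>S. \<Sum>l'\<in>S. if l = l' then line_coeff q l v else 0)"
      using S(1) v by (intro sum.cong refl line_coeff_conv) auto
    also have "\<dots> = f v"
      using S_fin by (simp add: f_def)
    finally show ?thesis .
  qed
  have f_neg: "f (vec_scale (- 1) v) = f v" for v
  proof -
    have "vec_scale (- 1) v \<in> l \<longleftrightarrow> v \<in> l" if l: "l \<in> S" for l
    proof -
      obtain u where "l = eline u"
        using l S(1) unfolding elines_def by blast
      then have *: "vec_scale (- 1) w \<in> l" if "w \<in> l" for w
        using that E_closed by (auto simp: eline_def)
      show ?thesis
        using *[of v] *[of "vec_scale (- 1) v"] by auto
    qed
    then show ?thesis
      by (simp add: f_def line_coeff_def)
  qed
  have f_inv: "f (mat_vec g v) = f v" if g: "g \<in> K" for g v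
  proof -
    have cancel: "mat_vec (mat_adj g) ` mat_vec g ` l = l" "mat_vec g ` mat_vec (mat_adj g) ` l = l" for l
      using g by (simp_all add: image_image mat_vec_adj_cancel K_def)
    have "f (mat_vec g v) = (\<Sum>l\<in>S. line_coeff q (mat_vec g ` l) (mat_vec g v))"
      unfolding f_def
      by (rule sum.reindex_bij_witness[where i = "image (mat_vec g)" and j = "image (mat_vec (mat_adj g))"])
        (use S(2) g K_adj cancel in simp_all)
    also have "\<dots> = f v"
    proof -
      have "mat_vec g v \<in> mat_vec g ` l \<longleftrightarrow> v \<in> l" for l
      proof
        assume "mat_vec g v \<in> mat_vec g ` l"
        then have "mat_vec (mat_adj g) (mat_vec g v) \<in> mat_vec (mat_adj g) ` mat_vec g ` l"
          by (rule imageI)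
        then show "v \<in> l"
          using g unfolding cancel by (simp add: K_def mat_vec_adj_cancel)
      qed (rule imageI)
      then show ?thesis
        by (simp add: f_def line_coeff_def)
    qed
    finally show ?thesis .
  qed
  have f0: "1 / 8 \<le> f (0, 0) * (1 - f (0, 0))"
  proof -
    have "(0, 0) \<in> l" if l: "l \<in> S" for l
    proof -
      obtain u where "u \<in> V - {(0, 0)}" "l = eline u"
        using l S(1) unfolding elines_def by blast
      then show ?thesis
        using eline_props(3) by simp
    qed
    then have "f (0, 0) = real (card S) * (1 / real q - 1 / (real q)\<^sup>2)"
      by (simp add: f_def line_coeff_def)
    also have "\<dots> = (real (card S) / real q) * (1 - 1 / real q)"
      using q_pos by (simp add: field_simps power2_eq_square)
    finally have t: "f (0, 0) = (real (card S) / real q) * (1 - 1 / real q)" .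
    have 1: "1 / 4 \<le> real (card S) / real q" "real (card S) / real q \<le> 3 / 4"
      using S(3,4) q_pos by (simp_all add: field_simps)
    have 2: "3 / 4 \<le> 1 - 1 / real q" "1 - 1 / real q \<le> 1"
      using q_ge by (simp_all add: field_simps)
    have lo: "1 / 4 * (3 / 4) \<le> f (0, 0)"
      unfolding t using 1 2 by (intro mult_mono) auto
    have hi: "f (0, 0) \<le> 3 / 4 * 1"
      unfolding t using 1 2 by (intro mult_mono) auto
    \<comment> \<open>With the trace \<open>t\<close> in the interval from 3/16 to 3/4, this product
      gives \<open>t (1 - t) \<ge> 9 / 64 + t / 16\<close>, which is more than 1/8.\<close>
    have "0 \<le> (f (0, 0) - 3 / 16) * (3 / 4 - f (0, 0))"
      using lo hi by (intro mult_nonneg_nonneg) auto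
    then show ?thesis
      using lo by (simp add: algebra_simps)
  qed
  show "\<exists>N c. subgroup N aff_group \<and> finite N \<and> (\<forall>x\<in>carrier aff_group - N. c x = 0) \<and>
      (\<forall>x\<in>carrier aff_group. c (inv\<^bsub>aff_group\<^esub> x) = c x) \<and>
      (\<forall>x\<in>N. (\<Sum>h\<in>N. c h * c (inv\<^bsub>aff_group\<^esub> h \<otimes>\<^bsub>aff_group\<^esub> x)) = c x) \<and>
      (\<forall>s\<in>F. \<forall>x\<in>carrier aff_group. c (s \<otimes>\<^bsub>aff_group\<^esub> x \<otimes>\<^bsub>aff_group\<^esub> inv\<^bsub>aff_group\<^esub> s) = c x) \<and>
      1 / 8 \<le> c \<one>\<^bsub>aff_group\<^esub> * (1 - c \<one>\<^bsub>aff_group\<^esub> :: real)"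
  proof (intro exI conjI ballI)
    show "subgroup N aff_group"
    proof (rule G.subgroupI)
      show "N \<subseteq> carrier aff_group" "N \<noteq> {}"
        using V_closed(1) by (auto simp: N_def)
      fix x y assume "x \<in> N" "y \<in> N"
      then obtain v w where "x = (v, mat_one)" "v \<in> V" "y = (w, mat_one)" "w \<in> V"
        by (auto simp: N_def)
      then show "inv\<^bsub>aff_group\<^esub> x \<in> N" "x \<otimes>\<^bsub>aff_group\<^esub> y \<in> N"
        by (auto simp: N_def inv_N V_closed simp del: split_paired_Ex)
    qed
    show "finite N"
      by (simp add: N_def finite_V)
    show "c x = 0" if "x \<in> carrier aff_group - N" for x
      using that by (cases x) (auto simp: c_def N_def)
    show "c (inv\<^bsub>aff_group\<^esub> x) = c x" if "x \<in> carrier aff_group" for x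
    proof -
      obtain v g where x: "x = (v, g)"
        by (cases x)
      show ?thesis
      proof (cases "g = mat_one")
        case True
        have "vec_scale (- 1) v \<in> V \<longleftrightarrow> v \<in> V"
          using V_closed(4)[of v] V_closed(4)[of "vec_scale (- 1) v"] by auto
        then show ?thesis
          using True by (simp add: x inv_N c_def f_neg)
      next
        case False
        have "mat_adj g \<noteq> mat_one"
          using False by (cases g) (auto simp: mat_one_def)
        then show ?thesis
          using False that by (simp add: x inv_aff_group c_def)
      qed
    qed
    show "(\<Sum>h\<in>N. c h * c (inv\<^bsub>aff_group\<^esub> h \<otimes>\<^bsub>aff_group\<^esub> x)) = c x" if x: "x \<in> N" for x
    proof -
      obtain v where v: "x = (v, mat_one)" "v \<in> V"
        using x by (auto simp: N_def)
      have "(\<Sum>h\<in>N. c h * c (inv\<^bsub>aff_group\<^esub> h \<otimes>\<^bsub>aff_group\<^esub> x)) =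
          (\<Sum>w\<in>V. c (w, mat_one) * c (inv\<^bsub>aff_group\<^esub> (w, mat_one) \<otimes>\<^bsub>aff_group\<^esub> x))"
        unfolding N_def by (subst sum.reindex) (auto simp: inj_on_def)
      also have "\<dots> = (\<Sum>w\<in>V. f w * f (vec_add (vec_scale (- 1) w) v))"
        using v by (intro sum.cong refl) (simp add: c_def inv_N V_closed)
      finally show ?thesis
        using v by (simp add: f_conv c_def)
    qed
    show "c (s \<otimes>\<^bsub>aff_group\<^esub> x \<otimes>\<^bsub>aff_group\<^esub> inv\<^bsub>aff_group\<^esub> s) = c x" if s: "s \<in> F" and x: "x \<in> carrier aff_group" for s x
    proof -
      obtain w g where w: "s = (w, g)"
        by (cases s)
      have "entries (snd s) \<subseteq> E0"
        using E0(3) s by blast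
      then have g: "mat_det g = 1" "g \<in> K"
        using s F(2) by (auto simp: w K_def)
      obtain v h where v: "x = (v, h)"
        by (cases x)
      note one = conj_eq_mat_one_iff[OF g(1), of h]
      show ?thesis
      proof (cases "h = mat_one")
        case True
        \<comment> \<open>The translation part of \<open>s\<close> cancels, so conjugation acts on
          translations through the matrix alone.\<close>
        have "vec_add (vec_add w (mat_vec g v)) (vec_scale (- 1) w) = mat_vec g v"
          by (subst vec_add_commute) (simp flip: vec_add_assoc)
        moreover have "mat_vec g v \<in> V \<longleftrightarrow> v \<in> V"
          using KV[OF g(2), of v] KV[OF K_adj[OF g(2)], of "mat_vec g v"] g(1) by (auto simp: mat_vec_adj_cancel)
        ultimately show ?thesis
          using g True by (simp add: w v conj_aff_group c_def mat_mult_adj f_inv del: aff_group_simps)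
      next
        case False
        then show ?thesis
          using g by (simp add: w v conj_aff_group c_def one del: aff_group_simps)
      qed
    qed
    show "1 / 8 \<le> c \<one>\<^bsub>aff_group\<^esub> * (1 - c \<one>\<^bsub>aff_group\<^esub>)"
      using f0 V_closed(1) by (simp add: c_def)
  qed
qed

section \<open>Ping-pong on the projective line\<close>

text \<open>The four functions are the measures of the ping-pong sets under the uniform probability
  measure on \<open>fixp x\<close>. Disjointness bounds their sum by 1; whatever of
  \<open>fixp x\<close> lies outside \<open>A2\<close> is carried into \<open>A1\<close>
  injectively.\<close>

lemma ping_pong_from_action:
  fixes G :: "('a, 'b) monoid_scheme" and fixp :: "'a \<Rightarrow> 'l set"
  assumes ab: "a \<in> carrier G" "b \<in> carrier G"
    and fixp: "\<And>x. x \<in> carrier G - {\<one>\<^bsub>G\<^esub>} \<Longrightarrow> finite (fixp x) \<and> fixp x \<noteq> {} \<and> fixp x \<subseteq> L"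
    and \<alpha>: "inj_on \<alpha> L" "\<And>x. x \<in> carrier G - {\<one>\<^bsub>G\<^esub>} \<Longrightarrow> fixp (a \<otimes>\<^bsub>G\<^esub> x \<otimes>\<^bsub>G\<^esub> inv\<^bsub>G\<^esub> a) = \<alpha> ` fixp x"
    and \<beta>: "inj_on \<beta> L" "\<And>x. x \<in> carrier G - {\<one>\<^bsub>G\<^esub>} \<Longrightarrow> fixp (b \<otimes>\<^bsub>G\<^esub> x \<otimes>\<^bsub>G\<^esub> inv\<^bsub>G\<^esub> b) = \<beta> ` fixp x"
    and disj: "A1 \<inter> A2 = {}" "A1 \<inter> B1 = {}" "A1 \<inter> B2 = {}" "A2 \<inter> B1 = {}" "A2 \<inter> B2 = {}" "B1 \<inter> B2 = {}"
    and A: "\<And>l. l \<in> L \<Longrightarrow> l \<notin> A2 \<Longrightarrow> \<alpha> l \<in> A1" and B: "\<And>l. l \<in> L \<Longrightarrow> l \<notin> B2 \<Longrightarrow> \<beta> l \<in> B1"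
  shows "ping_pong G"
proof -
  define m where "m W x = real (card (fixp x \<inter> W)) / real (card (fixp x))" for W x
  have step: "1 \<le> m W1 (g \<otimes>\<^bsub>G\<^esub> x \<otimes>\<^bsub>G\<^esub> inv\<^bsub>G\<^esub> g) + m W2 x"
    if x: "x \<in> carrier G - {\<one>\<^bsub>G\<^esub>}" and \<gamma>: "inj_on \<gamma> L" "fixp (g \<otimes>\<^bsub>G\<^esub> x \<otimes>\<^bsub>G\<^esub> inv\<^bsub>G\<^esub> g) = \<gamma> ` fixp x"
      and W: "\<And>l. l \<in> L \<Longrightarrow> l \<notin> W2 \<Longrightarrow> \<gamma> l \<in> W1" for W1 W2 g \<gamma> x
  proof -
    have fin: "finite (fixp x)" "fixp x \<noteq> {}" "fixp x \<subseteq> L"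
      using fixp[OF x] by auto
    then have inj: "inj_on \<gamma> (fixp x)"
      using \<gamma>(1) inj_on_subset by blast
    have "card (fixp x) - card (fixp x \<inter> W2) = card (fixp x - W2)"
      using fin by (simp add: card_Diff_subset_Int)
    also have "\<dots> = card (\<gamma> ` (fixp x - W2))"
      by (rule card_image[symmetric]) (rule inj_on_subset[OF inj], blast)
    also have "\<dots> \<le> card (\<gamma> ` fixp x \<inter> W1)"
      using W fin by (intro card_mono) auto
    finally have "card (fixp x) \<le> card (\<gamma> ` fixp x \<inter> W1) + card (fixp x \<inter> W2)"
      by simp
    moreover have "card (\<gamma> ` fixp x) = card (fixp x)"
      by (rule card_image[OF inj])
    moreover have "card (fixp x) > 0"
      using fin by (simp add: card_gt_0_iff)
    ultimately show ?thesis
      by (simp add: m_def \<gamma>(2) add_divide_distrib[symmetric])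
  qed
  have sum: "m A1 x + m A2 x + m B1 x + m B2 x \<le> 1" if x: "x \<in> carrier G - {\<one>\<^bsub>G\<^esub>}" for x
  proof -
    have fin: "finite (fixp x)" "fixp x \<noteq> {}"
      using fixp[OF x] by auto
    have "card (fixp x \<inter> A1) + card (fixp x \<inter> A2) = card (fixp x \<inter> A1 \<union> fixp x \<inter> A2)"
      by (rule card_Un_disjoint[symmetric]) (use fin disj in auto)
    also have "\<dots> + card (fixp x \<inter> B1) = card (fixp x \<inter> A1 \<union> fixp x \<inter> A2 \<union> fixp x \<inter> B1)"
      by (rule card_Un_disjoint[symmetric]) (use fin disj in auto)
    also have "\<dots> + card (fixp x \<inter> B2) = card (fixp x \<inter> A1 \<union> fixp x \<inter> A2 \<union> fixp x \<inter> B1 \<union> fixp x \<inter> B2)"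
      by (rule card_Un_disjoint[symmetric]) (use fin disj in auto)
    also have "\<dots> \<le> card (fixp x)"
      using fin by (intro card_mono) auto
    finally have "card (fixp x \<inter> A1) + card (fixp x \<inter> A2) + card (fixp x \<inter> B1) + card (fixp x \<inter> B2) \<le> card (fixp x)" .
    moreover have "card (fixp x) > 0"
      using fin by (simp add: card_gt_0_iff)
    ultimately show ?thesis
      by (simp add: m_def add_divide_distrib[symmetric])
  qed
  show ?thesis
    unfolding ping_pong_def
  proof (intro bexI exI ballI conjI)
    fix x assume x: "x \<in> carrier G - {\<one>\<^bsub>G\<^esub>}"
    show "1 \<le> m A1 (a \<otimes>\<^bsub>G\<^esub> x \<otimes>\<^bsub>G\<^esub> inv\<^bsub>G\<^esub> a) + m A2 x"
      using x \<alpha> A by (intro step) auto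
    show "1 \<le> m B1 (b \<otimes>\<^bsub>G\<^esub> x \<otimes>\<^bsub>G\<^esub> inv\<^bsub>G\<^esub> b) + m B2 x"
      using x \<beta> B by (intro step) auto
    show "m A1 x + m A2 x + m B1 x + m B2 x \<le> 1"
      by (rule sum[OF x])
  qed (use ab in \<open>auto simp: m_def\<close>)
qed

section \<open>Lines and eigenlines\<close>

definition line :: "'k::field vec2 \<Rightarrow> 'k vec2 set" where
  "line u = range (\<lambda>c. vec_scale c u)"

lemma line_refl: "u \<in> line u"
  unfolding line_def by (rule range_eqI[of _ _ 1]) simp

lemma mat_vec_line: "mat_vec g ` line u = line (mat_vec g u)"
  by (auto simp: line_def mat_vec_scale image_image)

lemma line_scale: "c \<noteq> 0 \<Longrightarrow> line (vec_scale c u) = line u"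
proof -
  assume "c \<noteq> 0"
  then have "vec_scale d u = vec_scale (d / c) (vec_scale c u)" for d
    by simp
  then have "line u \<subseteq> line (vec_scale c u)"
    unfolding line_def by blast
  moreover have "line (vec_scale c u) \<subseteq> line u"
    by (auto simp: line_def)
  ultimately show ?thesis
    by blast
qed

lemma line_eq_imp: "line u = line v \<Longrightarrow> fst u * snd v = snd u * fst v"
proof -
  assume "line u = line v"
  then have "v \<in> line u"
    using line_refl by blast
  then show ?thesis
    by (cases u; cases v) (auto simp: line_def)
qed

lemma line_cases:
  assumes "u \<noteq> (0, 0)"
  obtains z where "line u = line (1, z)" | "line u = line (0, 1)"
proof -
  obtain x y where u: "u = (x, y)"
    by (cases u)
  show ?thesis
  proof (cases "x = 0")
    case True
    then have "line u = line (0, 1)"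
      using line_scale[of y "(0, 1)"] assms by (simp add: u)
    then show ?thesis
      by (rule that)
  next
    case False
    then have "line u = line (1, y / x)"
      using line_scale[of x "(1, y / x)"] by (simp add: u)
    then show ?thesis
      by (rule that)
  qed
qed

definition eigenlines :: "'k::field mat2 \<Rightarrow> 'k vec2 set set" where
  "eigenlines g = {line u | u. u \<noteq> (0, 0) \<and> mat_vec g u \<in> line u}"

text \<open>Slopes of eigenlines are roots of a polynomial of degree at most two, which is zero only
  for scalar matrices. In characteristic two, \<open>a * a = 1\<close> forces \<open>a = 1\<close>,
  so the only such matrix of determinant one is the identity.\<close>

lemma finite_eigenlines:
  fixes g :: "'k::field mat2"
  assumes char2: "(1 :: 'k) + 1 = 0" and g: "mat_det g = 1" "g \<noteq> mat_one"
  shows "finite (eigenlines g)"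
proof -
  obtain a b c d where g_eq: "g = (a, b, c, d)"
    by (cases g)
  define p where "p = [: c, d - a, - b :]"
  have "p \<noteq> 0"
  proof
    assume "p = 0"
    then have bc: "b = 0" "c = 0" "d = a"
      by (auto simp: p_def)
    then have "a * a = 1"
      using g by (simp add: g_eq)
    moreover have "(a - 1) * (a - 1) = a * a + 1 - a * (1 + 1)"
      by (simp add: algebra_simps)
    ultimately have "(a - 1) * (a - 1) = 0"
      using char2 by simp
    then have "a = 1"
      by simp
    then show False
      using g bc by (simp add: g_eq mat_one_def)
  qed
  have "eigenlines g \<subseteq> insert (line (0, 1)) ((\<lambda>z. line (1, z)) ` {z. poly p z = 0})"
  proof
    fix l assume "l \<in> eigenlines g"
    then obtain u where u: "u \<noteq> (0, 0)" "mat_vec g u \<in> line u" "l = line u"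
      by (auto simp: eigenlines_def)
    have img: "mat_vec g ` line u \<subseteq> line u"
      using u(2) unfolding mat_vec_line by (auto simp: line_def)
    from u(1) show "l \<in> insert (line (0, 1)) ((\<lambda>z. line (1, z)) ` {z. poly p z = 0})"
    proof (cases rule: line_cases)
      case (1 z)
      then have "mat_vec g (1, z) \<in> line (1, z)"
        using img line_refl[of "(1, z)"] by auto
      then have "c + d * z = (a + b * z) * z"
        by (auto simp: g_eq line_def)
      then have "poly p z = 0"
        by (simp add: p_def algebra_simps)
      with 1 u show ?thesis
        by blast
    qed (use u in simp)
  qed
  then show ?thesis
    using poly_roots_finite[OF \<open>p \<noteq> 0\<close>] by (meson finite_imageI finite_insert finite_subset)
qed

text \<open>The slope of an eigenline solves a quadratic equation with leading coefficient
  \<open>b\<close>; for \<open>b = 0\<close> the vertical line is invariant instead.\<close>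

lemma eigenlines_nonempty:
  fixes g :: "'k::field mat2"
  assumes root: "\<And>b c :: 'k. \<exists>z. z * z + b * z + c = 0"
  shows "eigenlines g \<noteq> {}"
proof -
  obtain a b c d where g: "g = (a, b, c, d)"
    by (cases g)
  show ?thesis
  proof (cases "b = 0")
    case True
    have "mat_vec g (0, 1) \<in> line (0, 1)"
      by (auto simp: g True line_def intro!: image_eqI[of _ _ d])
    then have "line (0, 1) \<in> eigenlines g"
      unfolding eigenlines_def by (intro CollectI exI[of _ "(0, 1)"]) simp
    then show ?thesis
      by blast
  next
    case False
    obtain z where "z * z + ((a - d) / b) * z + (- c / b) = 0"
      using root by blast
    then have "b * (z * z + ((a - d) / b) * z + (- c / b)) = 0"
      by simp
    also have "b * (z * z + ((a - d) / b) * z + (- c / b)) = (a + b * z) * z - (c + d * z)"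
      using False by (simp add: field_simps)
    finally have "mat_vec g (1, z) = vec_scale (a + b * z) (1, z)"
      by (simp add: g)
    then have "mat_vec g (1, z) \<in> line (1, z)"
      unfolding line_def by (rule range_eqI)
    then have "line (1, z) \<in> eigenlines g"
      unfolding eigenlines_def by (intro CollectI exI[of _ "(1, z)"]) simp
    then show ?thesis
      by blast
  qed
qed

lemma mat_vec_eq_0: "mat_det g = 1 \<Longrightarrow> mat_vec g u = (0, 0) \<longleftrightarrow> u = (0, 0)"
  using mat_vec_adj_cancel(2)[of g u] by auto

text \<open>One inclusion is direct; applied to the inverse of \<open>A\<close> it yields the
  other.\<close>

lemma eigenlines_conj:
  assumes "mat_det A = 1"
  shows "eigenlines (mat_mult (mat_mult A g) (mat_adj A)) = image (mat_vec A) ` eigenlines g"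
proof -
  have sub: "image (mat_vec A) ` eigenlines g \<subseteq> eigenlines (mat_mult (mat_mult A g) (mat_adj A))"
    if A: "mat_det A = 1" for A g :: "'a mat2"
  proof clarify
    fix l assume "l \<in> eigenlines g"
    then obtain u where u: "u \<noteq> (0, 0)" "mat_vec g u \<in> line u" "l = line u"
      by (auto simp: eigenlines_def)
    have "mat_vec A (mat_vec g u) \<in> mat_vec A ` line u"
      using u by blast
    then have "mat_vec (mat_mult (mat_mult A g) (mat_adj A)) (mat_vec A u) \<in> line (mat_vec A u)"
      using A by (simp add: mat_vec_mult mat_vec_adj_cancel mat_vec_line)
    then show "mat_vec A ` l \<in> eigenlines (mat_mult (mat_mult A g) (mat_adj A))"
      unfolding eigenlines_def u(3) mat_vec_line using u A
      by (intro CollectI exI[of _ "mat_vec A u"]) (simp add: mat_vec_eq_0)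
  qed
  let ?h = "mat_mult (mat_mult A g) (mat_adj A)"
  have adj: "mat_adj (mat_adj A) = A"
    by (cases A) simp
  have "mat_mult (mat_mult (mat_adj A) ?h) A = mat_mult (mat_mult (mat_adj A) A) (mat_mult g (mat_mult (mat_adj A) A))"
    by (simp only: mat_mult_assoc)
  then have g_eq: "mat_mult (mat_mult (mat_adj A) ?h) A = g"
    using assms by (simp add: mat_mult_adj)
  have "image (mat_vec (mat_adj A)) ` eigenlines ?h \<subseteq> eigenlines g"
    using sub[of "mat_adj A" ?h] assms g_eq adj by simp
  then have "image (mat_vec A) ` image (mat_vec (mat_adj A)) ` eigenlines ?h \<subseteq> image (mat_vec A) ` eigenlines g"
    by (rule image_mono)
  then have "eigenlines ?h \<subseteq> image (mat_vec A) ` eigenlines g"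
    using assms by (simp add: image_image mat_vec_adj_cancel)
  with sub[OF assms, of g] show ?thesis
    by blast
qed

text \<open>A translation preserves every direction, so its own direction takes the place of the
  eigenlines. At the identity the value is the degenerate line consisting of the origin.\<close>

definition fixed_lines :: "'k::field vec2 \<times> 'k mat2 \<Rightarrow> 'k vec2 set set" where
  "fixed_lines x = (if snd x = mat_one then {line (fst x)} else eigenlines (snd x))"

lemma fixed_lines_conj:
  assumes "mat_det A = 1"
  shows "fixed_lines (((0, 0), A) \<otimes>\<^bsub>aff_group\<^esub> x \<otimes>\<^bsub>aff_group\<^esub> inv\<^bsub>aff_group\<^esub> ((0, 0), A)) =
    image (mat_vec A) ` fixed_lines x"
  using assms
  by (cases x)
    (simp add: conj_aff_group fixed_lines_def conj_eq_mat_one_iff eigenlines_conj mat_vec_line del: aff_group_simps)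

text \<open>The affine group plays ping-pong on the projective line over a valued field, with a diagonal
  matrix and its conjugate by \<open>h\<close>. The fixed points \<open>0\<close>, \<open>\<infinity>\<close> of the former and their images under
  \<open>h\<close> have distinct reductions to the residue field, thanks to the root of unity \<open>w\<close>.\<close>

lemma ping_pong_matrices:
  fixes s w :: "'k::field"
  assumes R: "is_subring R" and s: "s \<in> R" "s \<noteq> 0" "inverse s \<notin> R" and val: "\<And>x. x \<in> R \<or> inverse x \<in> R"
    and w: "w * w + w + 1 = 0"
  obtains A B :: "'k mat2" and A1 A2 B1 B2 :: "'k vec2 set set" where "mat_det A = 1" "mat_det B = 1"
    "A1 \<inter> A2 = {}" "A1 \<inter> B1 = {}" "A1 \<inter> B2 = {}" "A2 \<inter> B1 = {}" "A2 \<inter> B2 = {}" "B1 \<inter> B2 = {}"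
    "\<And>u. u \<noteq> (0, 0) \<Longrightarrow> line u \<notin> A2 \<Longrightarrow> mat_vec A ` line u \<in> A1"
    "\<And>u. u \<noteq> (0, 0) \<Longrightarrow> line u \<notin> B2 \<Longrightarrow> mat_vec B ` line u \<in> B1"
proof -
  note Rc = is_subringD[OF R]
  \<comment> \<open>The maximal ideal of the valuation ring, that is, zero and the nonzero elements
    of positive valuation.\<close>
  define M where "M = {c. c = 0 \<or> inverse c \<notin> R}"
  have MR: "c \<in> R" if "c \<in> M" for c
    using that val Rc(2) by (auto simp: M_def)
  have M_mult: "c * r \<in> M" if "c \<in> M" "r \<in> R" for c r
  proof (rule ccontr)
    assume "c * r \<notin> M"
    then have nz: "c \<noteq> 0" "r \<noteq> 0" "inverse (c * r) \<in> R"
      by (auto simp: M_def)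
    then have "r * inverse (c * r) \<in> R"
      using that Rc by blast
    moreover have "r * inverse (c * r) = inverse c"
      using nz by (simp add: field_simps)
    ultimately have "inverse c \<in> R"
      by (simp only:)
    then show False
      using nz that by (simp add: M_def)
  qed
  have M_add_aux: "c + d \<in> M" if "c \<in> M" "d / c \<in> R" "c \<noteq> 0" for c d
  proof -
    have "c * (1 + d / c) \<in> M"
      using that Rc by (intro M_mult) auto
    then show ?thesis
      using that by (simp add: distrib_left)
  qed
  \<comment> \<open>Of two nonzero elements one divides the other in \<open>R\<close>; factoring it
    out reduces sums to multiples.\<close>
  have M_add: "c + d \<in> M" if cd: "c \<in> M" "d \<in> M" for c d
  proof (cases "c = 0 \<or> d = 0")
    case True
    then show ?thesis
      using that by auto
  next
    case False
    then show ?thesis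
      using val[of "d / c"] M_add_aux[of c d] M_add_aux[of d c] cd by (auto simp: add.commute)
  qed
  have M_uminus: "- c \<in> M" if "c \<in> M" for c
    using M_mult[OF that Rc(5)[OF Rc(1)]] by simp
  have M_diff: "c - d \<in> M" if "c \<in> M" "d \<in> M" for c d
    using M_add[OF that(1) M_uminus[OF that(2)]] by simp
  have not_M: "1 \<notin> M" "w \<notin> M" "w + 1 \<notin> M" and wR: "w \<in> R" "w + 1 \<in> R"
  proof -
    \<comment> \<open>The equation of \<open>w\<close> gives \<open>w (w + 1) = -1\<close>, so both
      factors are units once they lie in \<open>R\<close>. They do, since
      \<open>w = - inverse w - 1\<close> puts \<open>w\<close> into \<open>R\<close> as soon as
      \<open>inverse w\<close> is there.\<close>
    have "w * (- (w + 1)) = 1 - (w * w + w + 1)"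
      by (simp add: algebra_simps)
    then have w1: "w * (- (w + 1)) = 1"
      using w by simp
    have "(w + 1) * (- w) = w * (- (w + 1))"
      by (simp add: algebra_simps)
    with w1 have w2: "(w + 1) * (- w) = 1"
      by simp
    have inv: "inverse w = - (w + 1)" "inverse (w + 1) = - w"
      using inverse_unique[OF w1] inverse_unique[OF w2] by simp_all
    have nz: "w \<noteq> 0" "w + 1 \<noteq> 0"
      using w1 w2 by fastforce+
    have w_eq: "w = - inverse w - 1"
      by (simp add: inv(1))
    show wR: "w \<in> R"
      using val[of w]
    proof
      assume "inverse w \<in> R"
      then have "- inverse w - 1 \<in> R"
        by (intro Rc(1,3,5))
      then show ?thesis
        by (simp add: w_eq[symmetric])
    qed
    show w1R: "w + 1 \<in> R"
      by (intro Rc(1,6) wR)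
    show "1 \<notin> M" "w \<notin> M" "w + 1 \<notin> M"
      using nz Rc(1) Rc(5)[OF wR] Rc(5)[OF w1R] by (simp_all add: M_def inv del: minus_add_distrib)
  qed
  \<comment> \<open>The columns are the images of the two fixed lines of \<open>A\<close>, with
    slopes 1 and \<open>(w + 1) / w\<close>; modulo \<open>M\<close> these differ from each other
    and from the slopes 0 and \<infinity>.\<close>
  define h :: "'k mat2" where "h = (1, w, 1, w + 1)"
  \<comment> \<open>The action on slopes is multiplication by the square of \<open>s\<close>, which
    carries all of \<open>R\<close> into \<open>M\<close>.\<close>
  define A :: "'k mat2" where "A = (inverse s, 0, 0, s)"
  define B where "B = mat_mult (mat_mult h A) (mat_adj h)"
  \<comment> \<open>\<open>A1\<close> and \<open>A2\<close> consist of the lines whose reductions to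
    the residue field are the two fixed points of \<open>A\<close>; \<open>A1\<close> attracts and
    \<open>A2\<close> repels.\<close>
  define A1 :: "'k vec2 set set" where "A1 = (\<lambda>c. line (1, c)) ` M"
  define A2 :: "'k vec2 set set" where "A2 = (\<lambda>c. line (c, 1)) ` M"
  define B1 where "B1 = image (mat_vec h) ` A1"
  define B2 where "B2 = image (mat_vec h) ` A2"
  have hd: "mat_det h = 1"
    by (simp add: h_def)
  have Ad: "mat_det A = 1"
    using s by (simp add: A_def)
  have Bd: "mat_det B = 1"
    using hd Ad by (simp add: B_def mat_det_mult)
  have B1_eq: "B1 = (\<lambda>c. line (1 + w * c, 1 + (w + 1) * c)) ` M"
    by (simp add: B1_def A1_def image_image mat_vec_line h_def)
  have B2_eq: "B2 = (\<lambda>c. line (c + w, c + (w + 1))) ` M"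
    by (simp add: B2_def A2_def image_image mat_vec_line h_def)
  have A: "mat_vec A ` line u \<in> A1" if u: "u \<noteq> (0, 0)" "line u \<notin> A2" for u
  proof -
    from u(1) show ?thesis
    proof (cases rule: line_cases)
      case (1 z)
      have sM: "s \<in> M"
        using s by (simp add: M_def)
      have "z \<in> R"
      proof (cases "z = 0")
        case False
        have "line u = line (inverse z, 1)"
          using 1 line_scale[of z "(inverse z, 1)"] False by simp
        then have "inverse z \<notin> M"
          using u(2) by (auto simp: A2_def)
        then show ?thesis
          by (auto simp: M_def)
      qed (simp add: Rc)
      then have "s * (s * z) \<in> M"
        using sM s Rc by (intro M_mult) auto
      moreover have "mat_vec A ` line u = line (1, s * (s * z))"
        using 1 s line_scale[of "inverse s" "(1, s * (s * z))"]
        by (simp add: mat_vec_line A_def mult.assoc[symmetric])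
      ultimately show ?thesis
        by (auto simp: A1_def)
    next
      case 2
      then show ?thesis
        using u(2) by (auto simp: A2_def M_def)
    qed
  qed
  have B: "mat_vec B ` line u \<in> B1" if u: "u \<noteq> (0, 0)" "line u \<notin> B2" for u
  proof -
    define v where "v = mat_vec (mat_adj h) u"
    have v: "v \<noteq> (0, 0)"
      using u hd mat_vec_eq_0[of "mat_adj h" u] by (simp add: v_def)
    have "mat_vec h ` line v = line u"
      using hd by (simp add: mat_vec_line v_def mat_vec_adj_cancel)
    moreover have "mat_vec h ` line v \<in> B2" if "line v \<in> A2"
      unfolding B2_def using that by (rule imageI)
    ultimately have "line v \<notin> A2"
      using u(2) by auto
    then have "mat_vec A ` line v \<in> A1"
      by (rule A[OF v])
    moreover have "mat_vec B ` line u = mat_vec h ` mat_vec A ` line v"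
      by (simp only: B_def mat_vec_line v_def mat_vec_mult)
    ultimately show ?thesis
      by (auto simp: B1_def)
  qed
  \<comment> \<open>In each of the six cases a common line makes a cross product vanish, which would
    place one of the units 1, \<open>w\<close>, \<open>w + 1\<close> in \<open>M\<close>.\<close>
  have "A1 \<inter> A2 = {}"
  proof -
    have False if cd: "c \<in> M" "d \<in> M" "line (1, c) = line (d, 1)" for c d
    proof -
      have "c * d = 1"
        using line_eq_imp[OF cd(3)] by simp
      then show False
        using M_mult[OF cd(1) MR[OF cd(2)]] not_M by simp
    qed
    then show ?thesis
      by (auto simp: A1_def A2_def)
  qed
  moreover have "B1 \<inter> B2 = {}"
  proof -
    have False if cd: "c \<in> M" "d \<in> M" "line (1 + w * c, 1 + (w + 1) * c) = line (d + w, d + (w + 1))" for c d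
    proof -
      have "(1 + w * c) * (d + (w + 1)) - (1 + (w + 1) * c) * (d + w) = 0"
        using line_eq_imp[OF cd(3)] by simp
      then have "c * d = 1"
        by (simp add: algebra_simps)
      then show False
        using M_mult[OF cd(1) MR[OF cd(2)]] not_M by simp
    qed
    then show ?thesis
      by (auto simp: B1_eq B2_eq)
  qed
  moreover have "A1 \<inter> B1 = {}"
  proof -
    have False if cd: "c \<in> M" "d \<in> M" "line (1, c) = line (1 + w * d, 1 + (w + 1) * d)" for c d
    proof -
      have "1 = c * (1 + w * d) - d * (w + 1)"
        using line_eq_imp[OF cd(3)] by (simp add: algebra_simps)
      moreover have "1 + w * d \<in> R"
        by (intro Rc(1,4,6) wR MR[OF cd(2)])
      then have "c * (1 + w * d) - d * (w + 1) \<in> M"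
        by (intro M_diff M_mult wR cd)
      ultimately show False
        using not_M by simp
    qed
    then show ?thesis
      by (auto simp: A1_def B1_eq)
  qed
  moreover have "A1 \<inter> B2 = {}"
  proof -
    have False if cd: "c \<in> M" "d \<in> M" "line (1, c) = line (d + w, d + (w + 1))" for c d
    proof -
      have "w + 1 = c * (d + w) - d"
        using line_eq_imp[OF cd(3)] by (simp add: algebra_simps)
      moreover have "d + w \<in> R"
        by (intro Rc(1,4,6) wR MR[OF cd(2)])
      then have "c * (d + w) - d \<in> M"
        by (intro M_diff M_mult wR cd)
      ultimately show False
        using not_M by simp
    qed
    then show ?thesis
      by (auto simp: A1_def B2_eq)
  qed
  moreover have "A2 \<inter> B1 = {}"
  proof -
    have False if cd: "c \<in> M" "d \<in> M" "line (c, 1) = line (1 + w * d, 1 + (w + 1) * d)" for c d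
    proof -
      have "1 = c * (1 + (w + 1) * d) - d * w"
        using line_eq_imp[OF cd(3)] by (simp add: algebra_simps)
      moreover have "1 + (w + 1) * d \<in> R"
        by (intro Rc(1,4,6) wR MR[OF cd(2)])
      then have "c * (1 + (w + 1) * d) - d * w \<in> M"
        by (intro M_diff M_mult wR cd)
      ultimately show False
        using not_M by simp
    qed
    then show ?thesis
      by (auto simp: A2_def B1_eq)
  qed
  moreover have "A2 \<inter> B2 = {}"
  proof -
    have False if cd: "c \<in> M" "d \<in> M" "line (c, 1) = line (d + w, d + (w + 1))" for c d
    proof -
      have "w = c * (d + (w + 1)) - d"
        using line_eq_imp[OF cd(3)] by (simp add: algebra_simps)
      moreover have "d + (w + 1) \<in> R"
        by (intro Rc(1,4,6) wR MR[OF cd(2)])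
      then have "c * (d + (w + 1)) - d \<in> M"
        by (intro M_diff M_mult wR cd)
      ultimately show False
        using not_M by simp
    qed
    then show ?thesis
      by (auto simp: A2_def B2_eq)
  qed
  ultimately show ?thesis
    using that[of A B A1 A2 B1 B2] Ad Bd A B by blast
qed

text \<open>The pair is produced before the subgroup, because the countable elementary subgroup is
  afterwards chosen to contain it. The fixed lines do not depend on the subgroup, so every subgroup
  containing the pair inherits the property.\<close>

lemma ping_pong_aff_subgroup:
  fixes C :: "('k::field vec2 \<times> 'k mat2) set"
  assumes char2: "(1 :: 'k) + 1 = 0" and root: "\<And>b c :: 'k. \<exists>z. z * z + b * z + c = 0"
    and R: "is_subring R" and s: "s \<in> R" "s \<noteq> (0 :: 'k)" "inverse s \<notin> R" and val: "\<And>x. x \<in> R \<or> inverse x \<in> R"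
  obtains a b :: "'k vec2 \<times> 'k mat2" where "a \<in> carrier aff_group" "b \<in> carrier aff_group"
    "\<And>C. subgroup C aff_group \<Longrightarrow> a \<in> C \<Longrightarrow> b \<in> C \<Longrightarrow> ping_pong (aff_group\<lparr>carrier := C\<rparr>)"
proof -
  obtain w :: 'k where "w * w + 1 * w + 1 = 0"
    using root by blast
  then have w: "w * w + w + 1 = 0"
    by simp
  obtain A B :: "'k mat2" and A1 A2 B1 B2 where det: "mat_det A = 1" "mat_det B = 1"
    and disj: "A1 \<inter> A2 = {}" "A1 \<inter> B1 = {}" "A1 \<inter> B2 = {}" "A2 \<inter> B1 = {}" "A2 \<inter> B2 = {}" "B1 \<inter> B2 = {}"
    and A: "\<And>u. u \<noteq> (0, 0) \<Longrightarrow> line u \<notin> A2 \<Longrightarrow> mat_vec A ` line u \<in> A1"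
    and B: "\<And>u. u \<noteq> (0, 0) \<Longrightarrow> line u \<notin> B2 \<Longrightarrow> mat_vec B ` line u \<in> B1"
    using ping_pong_matrices[OF R s val w] by metis
  define L :: "'k vec2 set set" where "L = {line u | u. u \<noteq> (0, 0)}"
  have inj: "inj_on (image (mat_vec g)) L" if "mat_det g = 1" for g :: "'k mat2"
  proof (rule inj_on_inverseI[where g = "image (mat_vec (mat_adj g))"])
    show "mat_vec (mat_adj g) ` mat_vec g ` l = l" for l
      using that by (simp add: image_image mat_vec_adj_cancel)
  qed
  have fixp: "finite (fixed_lines x) \<and> fixed_lines x \<noteq> {} \<and> fixed_lines x \<subseteq> L"
    if "x \<in> carrier aff_group - {\<one>\<^bsub>aff_group\<^esub>}" for x
  proof -
    obtain v g where "x = (v, g)"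
      by (cases x)
    with that have x: "x = (v, g)" "mat_det g = 1"
      by simp_all
    show ?thesis
    proof (cases "g = mat_one")
      case True
      then have "v \<noteq> (0, 0)" "fixed_lines x = {line v}"
        using that x by (simp_all add: fixed_lines_def)
      moreover from this(1) have "line v \<in> L"
        unfolding L_def by (intro CollectI exI[of _ v]) simp
      ultimately show ?thesis
        by simp
    next
      case False
      then have "fixed_lines x = eigenlines g"
        using x by (simp add: fixed_lines_def)
      moreover have "eigenlines g \<subseteq> L"
        unfolding eigenlines_def L_def by blast
      ultimately show ?thesis
        using finite_eigenlines[OF char2 x(2) False] eigenlines_nonempty[OF root, of g] by simp
    qed
  qed
  interpret group "aff_group :: ('k vec2 \<times> 'k mat2) monoid"
    by (rule group_aff_group)
  have "ping_pong (aff_group\<lparr>carrier := C\<rparr>)"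
    if C: "subgroup C aff_group" and ab: "((0, 0), A) \<in> C" "((0, 0), B) \<in> C" for C
  proof (rule ping_pong_from_action[where a = "((0, 0), A)" and b = "((0, 0), B)" and fixp = fixed_lines
        and L = L and \<alpha> = "image (mat_vec A)" and \<beta> = "image (mat_vec B)" and ?A1.0 = A1 and ?A2.0 = A2
        and ?B1.0 = B1 and ?B2.0 = B2])
    show "finite (fixed_lines x) \<and> fixed_lines x \<noteq> {} \<and> fixed_lines x \<subseteq> L"
      if "x \<in> carrier (aff_group\<lparr>carrier := C\<rparr>) - {\<one>\<^bsub>aff_group\<lparr>carrier := C\<rparr>\<^esub>}" for x
      using that subgroup.subset[OF C] by (intro fixp) (auto simp del: aff_group_simps)
    show "fixed_lines (((0, 0), A) \<otimes>\<^bsub>aff_group\<lparr>carrier := C\<rparr>\<^esub> x \<otimes>\<^bsub>aff_group\<lparr>carrier := C\<rparr>\<^esub>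
        inv\<^bsub>aff_group\<lparr>carrier := C\<rparr>\<^esub> ((0, 0), A)) = image (mat_vec A) ` fixed_lines x" for x
      using fixed_lines_conj[OF det(1), of x] m_inv_consistent[OF C ab(1)] by simp
    show "fixed_lines (((0, 0), B) \<otimes>\<^bsub>aff_group\<lparr>carrier := C\<rparr>\<^esub> x \<otimes>\<^bsub>aff_group\<lparr>carrier := C\<rparr>\<^esub>
        inv\<^bsub>aff_group\<lparr>carrier := C\<rparr>\<^esub> ((0, 0), B)) = image (mat_vec B) ` fixed_lines x" for x
      using fixed_lines_conj[OF det(2), of x] m_inv_consistent[OF C ab(2)] by simp
    show "mat_vec A ` l \<in> A1" if "l \<in> L" "l \<notin> A2" for l
      using that A by (auto simp: L_def)
    show "mat_vec B ` l \<in> B1" if "l \<in> L" "l \<notin> B2" for l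
      using that B by (auto simp: L_def)
  qed (use ab disj inj det in simp_all)
  with det show ?thesis
    by (intro that[of "((0, 0), A)" "((0, 0), B)"]) auto
qed

section \<open>Transport along isomorphisms\<close>

locale group_iso_pair = A: group A + B: group B for A :: "('a, 'c) monoid_scheme" and B :: "('b, 'd) monoid_scheme" +
  fixes f :: "'a \<Rightarrow> 'b" and g :: "'b \<Rightarrow> 'a"
  assumes f: "\<And>x. x \<in> carrier A \<Longrightarrow> f x \<in> carrier B" and g: "\<And>y. y \<in> carrier B \<Longrightarrow> g y \<in> carrier A"
    and gf: "\<And>x. x \<in> carrier A \<Longrightarrow> g (f x) = x" and fg: "\<And>y. y \<in> carrier B \<Longrightarrow> f (g y) = y"
    and g_mult: "\<And>x y. x \<in> carrier B \<Longrightarrow> y \<in> carrier B \<Longrightarrow> g (x \<otimes>\<^bsub>B\<^esub> y) = g x \<otimes>\<^bsub>A\<^esub> g y"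
begin

lemma g_one: "g \<one>\<^bsub>B\<^esub> = \<one>\<^bsub>A\<^esub>"
  using g_mult[of "\<one>\<^bsub>B\<^esub>" "\<one>\<^bsub>B\<^esub>"] g[of "\<one>\<^bsub>B\<^esub>"] by simp

lemma g_inv: "y \<in> carrier B \<Longrightarrow> g (inv\<^bsub>B\<^esub> y) = inv\<^bsub>A\<^esub> (g y)"
  using g_mult[of "inv\<^bsub>B\<^esub> y" y] g_one by (intro A.inv_equality[symmetric]) (simp_all add: g)

lemma g_conj: "x \<in> carrier B \<Longrightarrow> y \<in> carrier B \<Longrightarrow>
    g (x \<otimes>\<^bsub>B\<^esub> y \<otimes>\<^bsub>B\<^esub> inv\<^bsub>B\<^esub> x) = g x \<otimes>\<^bsub>A\<^esub> g y \<otimes>\<^bsub>A\<^esub> inv\<^bsub>A\<^esub> (g x)"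
  by (simp add: g_mult g_inv)

lemma g_nontrivial: "y \<in> carrier B \<Longrightarrow> y \<noteq> \<one>\<^bsub>B\<^esub> \<Longrightarrow> g y \<noteq> \<one>\<^bsub>A\<^esub>"
  using fg g_one by (metis B.one_closed)

lemma icc_transport:
  assumes "icc A"
  shows "icc B"
  unfolding icc_def
proof (intro ballI impI)
  fix y assume y: "y \<in> carrier B" "y \<noteq> \<one>\<^bsub>B\<^esub>"
  have "conjugacy_class A (g y) \<subseteq> g ` conjugacy_class B y"
  proof
    fix z assume "z \<in> conjugacy_class A (g y)"
    then obtain h where h: "h \<in> carrier A" "z = h \<otimes>\<^bsub>A\<^esub> g y \<otimes>\<^bsub>A\<^esub> inv\<^bsub>A\<^esub> h"
      by (auto simp: conjugacy_class_def)
    then have "z = g (f h \<otimes>\<^bsub>B\<^esub> y \<otimes>\<^bsub>B\<^esub> inv\<^bsub>B\<^esub> (f h))"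
      using y by (simp add: g_conj f gf)
    then show "z \<in> g ` conjugacy_class B y"
      using h f by (auto simp: conjugacy_class_def)
  qed
  moreover have "infinite (conjugacy_class A (g y))"
    using assms y g g_nontrivial by (auto simp: icc_def)
  ultimately show "infinite (conjugacy_class B y)"
    by (meson finite_imageI finite_subset)
qed

lemma ping_pong_transport:
  assumes "ping_pong A"
  shows "ping_pong B"
proof -
  obtain a b and p q r t :: "'a \<Rightarrow> real" where ab: "a \<in> carrier A" "b \<in> carrier A" and
    *: "\<forall>x\<in>carrier A - {\<one>\<^bsub>A\<^esub>}. 0 \<le> p x \<and> 0 \<le> q x \<and> 0 \<le> r x \<and> 0 \<le> t x \<and> p x + q x + r x + t x \<le> 1 \<and>
      1 \<le> p (a \<otimes>\<^bsub>A\<^esub> x \<otimes>\<^bsub>A\<^esub> inv\<^bsub>A\<^esub> a) + q x \<and> 1 \<le> r (b \<otimes>\<^bsub>A\<^esub> x \<otimes>\<^bsub>A\<^esub> inv\<^bsub>A\<^esub> b) + t x"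
    using assms unfolding ping_pong_def by (elim bexE exE) (rule that)
  show ?thesis
    unfolding ping_pong_def
  proof (rule bexI[of _ "f a"], rule bexI[of _ "f b"], intro exI ballI)
    fix y assume y: "y \<in> carrier B - {\<one>\<^bsub>B\<^esub>}"
    then have "g y \<in> carrier A - {\<one>\<^bsub>A\<^esub>}"
      using g g_nontrivial by auto
    from *[rule_format, OF this]
    show "0 \<le> (p \<circ> g) y \<and> 0 \<le> (q \<circ> g) y \<and> 0 \<le> (r \<circ> g) y \<and> 0 \<le> (t \<circ> g) y \<and>
        (p \<circ> g) y + (q \<circ> g) y + (r \<circ> g) y + (t \<circ> g) y \<le> 1 \<and>
        1 \<le> (p \<circ> g) (f a \<otimes>\<^bsub>B\<^esub> y \<otimes>\<^bsub>B\<^esub> inv\<^bsub>B\<^esub> (f a)) + (q \<circ> g) y \<and>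
        1 \<le> (r \<circ> g) (f b \<otimes>\<^bsub>B\<^esub> y \<otimes>\<^bsub>B\<^esub> inv\<^bsub>B\<^esub> (f b)) + (t \<circ> g) y"
      using ab y by (simp add: g_conj f gf)
  qed (use ab f in auto)
qed

lemma locally_central_projections_transport:
  assumes "locally_central_projections A"
  shows "locally_central_projections B"
  unfolding locally_central_projections_def
proof (intro allI impI)
  fix F assume F: "finite F \<and> F \<subseteq> carrier B"
  then have gF: "finite (g ` F) \<and> g ` F \<subseteq> carrier A"
    using g by auto
  obtain N and c :: "'a \<Rightarrow> real" where Nc: "subgroup N A \<and> finite N \<and>
      (\<forall>x\<in>carrier A - N. c x = 0) \<and> (\<forall>x\<in>carrier A. c (inv\<^bsub>A\<^esub> x) = c x) \<and>
      (\<forall>x\<in>N. (\<Sum>h\<in>N. c h * c (inv\<^bsub>A\<^esub> h \<otimes>\<^bsub>A\<^esub> x)) = c x) \<and>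
      (\<forall>s\<in>g ` F. \<forall>x\<in>carrier A. c (s \<otimes>\<^bsub>A\<^esub> x \<otimes>\<^bsub>A\<^esub> inv\<^bsub>A\<^esub> s) = c x) \<and>
      1 / 8 \<le> c \<one>\<^bsub>A\<^esub> * (1 - c \<one>\<^bsub>A\<^esub>)"
    using assms[unfolded locally_central_projections_def, THEN spec, THEN mp, OF gF]
    by (elim exE) (rule that)
  interpret N: subgroup N A
    using Nc by blast
  define N' where "N' = {y \<in> carrier B. g y \<in> N}"
  have "subgroup N' B"
    by (rule B.subgroupI)
      (auto simp: N'_def g_one g_inv g_mult N.mem_carrier intro!: exI[of _ "\<one>\<^bsub>B\<^esub>"])
  moreover have "N' \<subseteq> f ` N"
    using fg by (force simp: N'_def)
  then have "finite N'"
    using Nc finite_subset by blast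
  moreover have "(\<Sum>h\<in>N'. c (g h) * c (g (inv\<^bsub>B\<^esub> h \<otimes>\<^bsub>B\<^esub> y))) = c (g y)" if y: "y \<in> N'" for y
  proof -
    have "(\<Sum>h\<in>N'. c (g h) * c (g (inv\<^bsub>B\<^esub> h \<otimes>\<^bsub>B\<^esub> y))) = (\<Sum>k\<in>N. c k * c (inv\<^bsub>A\<^esub> k \<otimes>\<^bsub>A\<^esub> g y))"
      by (rule sum.reindex_bij_witness[where i = f and j = g])
        (use y in \<open>auto simp: N'_def fg gf f g_mult g_inv N.mem_carrier\<close>)
    then show ?thesis
      using Nc y by (simp add: N'_def)
  qed
  moreover have "c (g (s \<otimes>\<^bsub>B\<^esub> y \<otimes>\<^bsub>B\<^esub> inv\<^bsub>B\<^esub> s)) = c (g y)" if "s \<in> F" "y \<in> carrier B" for s y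
    using that F Nc g by (auto simp: g_conj subset_iff)
  moreover have "c (g y) = 0" if "y \<in> carrier B - N'" for y
    using that Nc g by (auto simp: N'_def)
  moreover have "c (g (inv\<^bsub>B\<^esub> y)) = c (g y)" if "y \<in> carrier B" for y
    using that Nc g by (simp add: g_inv)
  moreover have "1 / 8 \<le> c (g \<one>\<^bsub>B\<^esub>) * (1 - c (g \<one>\<^bsub>B\<^esub>))"
    using Nc by (simp add: g_one)
  ultimately show "\<exists>N c. subgroup N B \<and> finite N \<and>
      (\<forall>x\<in>carrier B - N. c x = 0) \<and> (\<forall>x\<in>carrier B. c (inv\<^bsub>B\<^esub> x) = c x) \<and>
      (\<forall>x\<in>N. (\<Sum>h\<in>N. c h * c (inv\<^bsub>B\<^esub> h \<otimes>\<^bsub>B\<^esub> x)) = c x) \<and>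
      (\<forall>s\<in>F. \<forall>x\<in>carrier B. c (s \<otimes>\<^bsub>B\<^esub> x \<otimes>\<^bsub>B\<^esub> inv\<^bsub>B\<^esub> s) = c x) \<and>
      1 / 8 \<le> c \<one>\<^bsub>B\<^esub> * (1 - c \<one>\<^bsub>B\<^esub> :: real)"
    by (intro exI[of _ N'] exI[of _ "\<lambda>y. c (g y)"]) blast
qed

end

lemma group_iso_pairI:
  assumes "group A" "group B" "f \<in> iso A B"
  shows "group_iso_pair A B f (inv_into (carrier A) f)"
proof -
  interpret A: group A by fact
  interpret B: group B by fact
  have bij: "bij_betw f (carrier A) (carrier B)" and hom: "f \<in> hom A B"
    using assms by (auto simp: iso_def)
  let ?g = "inv_into (carrier A) f"
  have g: "?g y \<in> carrier A" "f (?g y) = y" if "y \<in> carrier B" for y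
    using that bij by (auto simp: bij_betw_def inv_into_into f_inv_into_f)
  have gf: "?g (f x) = x" if "x \<in> carrier A" for x
    using that bij by (auto simp: bij_betw_def)
  show ?thesis
  proof
    show "f x \<in> carrier B" if "x \<in> carrier A" for x
      using that hom by (auto simp: hom_def)
    show "?g (x \<otimes>\<^bsub>B\<^esub> y) = ?g x \<otimes>\<^bsub>A\<^esub> ?g y" if "x \<in> carrier B" "y \<in> carrier B" for x y
      using gf[of "?g x \<otimes>\<^bsub>A\<^esub> ?g y"] hom_mult[OF hom, of "?g x" "?g y"] g that by simp
  qed (use g gf in auto)
qed

section \<open>The two groups\<close>

lemma aff_group_over_alg_closure:
  defines "H \<equiv> (aff_group :: (bit alg_closure vec2 \<times> bit alg_closure mat2) monoid)"
  shows "group H" "countable (carrier H)" "icc H" "locally_central_projections H"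
proof -
  interpret group H
    unfolding H_def by (rule group_aff_group)
  show "group H" ..
  let ?F = "UNIV :: bit alg_closure set"
  have "countable ((?F \<times> ?F) \<times> ?F \<times> ?F \<times> ?F \<times> ?F)"
    by (intro countable_SIGMA countable_alg_closure)
  then show "countable (carrier H)"
    by (rule countable_subset[rotated]) auto
  show "locally_central_projections H"
    unfolding H_def
    by (rule locally_central_projections_aff[OF infinite_alg_closed_field locally_finite_alg_closure])
  have "icc (aff_group\<lparr>carrier := carrier (aff_group :: (bit alg_closure vec2 \<times> bit alg_closure mat2) monoid)\<rparr>)"
    by (rule icc_aff_subgroup[where \<Lambda> = UNIV, OF _ infinite_alg_closed_field])
      (simp_all add: subgroup_self[unfolded H_def])
  then show "icc H"
    by (simp add: H_def)
qed

text \<open>Los's theorem passes to the ultrapower, and the Loewenheim-Skolem theorem back to a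
  countable group around a prescribed countable seed.\<close>

lemma countable_elementary_extension:
  obtains C :: "(bit alg_closure ultrapower vec2 \<times> bit alg_closure ultrapower mat2) set"
  where "subgroup C aff_group" "countable C"
    "icc (aff_group\<lparr>carrier := C\<rparr>)" "ping_pong (aff_group\<lparr>carrier := C\<rparr>)"
    "group_elem_equiv (aff_group :: (bit alg_closure vec2 \<times> bit alg_closure mat2) monoid) (aff_group\<lparr>carrier := C\<rparr>)"
proof -
  let ?H = "aff_group :: (bit alg_closure vec2 \<times> bit alg_closure mat2) monoid"
  let ?G = "aff_group :: (bit alg_closure ultrapower vec2 \<times> bit alg_closure ultrapower mat2) monoid"
  interpret ultraproduct_map free_ultrafilter ?H ?G aff_ultra
    by (rule ultraproduct_map_aff)
  define const :: "bit alg_closure \<Rightarrow> bit alg_closure ultrapower" where "const x = abs_ultrapower (\<lambda>_. x)" for x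
  have "inj const"
    by (auto simp: inj_def const_def abs_ultrapower_eq_iff free_ultrafilter.proper)
  then have inf: "infinite (range const)"
    using infinite_alg_closed_field finite_imageD by blast
  obtain R and s :: "bit alg_closure ultrapower" where R: "is_subring R" "s \<in> R" "s \<noteq> 0" "inverse s \<notin> R"
    "\<And>x. x \<in> R \<or> inverse x \<in> R"
    using ultrapower_valuation_ring[OF infinite_alg_closed_field] by metis
  have "const 1 + const 1 = const (1 + 1)"
    by (simp add: const_def plus_ultrapower.abs_eq)
  also have "1 + 1 = (0 :: bit alg_closure)"
    by (rule char2_add_self)
  finally have char2: "(1 :: bit alg_closure ultrapower) + 1 = 0"
    by (simp only: const_def one_ultrapower_def[symmetric] zero_ultrapower_def[symmetric])
  obtain a b where ab: "a \<in> carrier ?G" "b \<in> carrier ?G"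
    "\<And>C. subgroup C ?G \<Longrightarrow> a \<in> C \<Longrightarrow> b \<in> C \<Longrightarrow> ping_pong (aff_group\<lparr>carrier := C\<rparr>)"
    using ping_pong_aff_subgroup[OF char2 ultrapower_quadratic_root R] by metis
  \<comment> \<open>The seed consists of the ping-pong pair and of the elements that make conjugacy
    classes infinite, with the constants as a countable infinite set of parameters.\<close>
  define A where "A = {a, b} \<union> (\<Union>l\<in>range const. {((l, 0), mat_one), ((0, l), mat_one),
    ((0, 0), (1, l, 0, 1)), ((0, 0), (1, 0, l, 1))})"
  have "countable A"
    unfolding A_def by (intro countable_Un countable_UN countable_image countable_alg_closure) auto
  moreover have "A \<subseteq> carrier ?G"
    using ab by (auto simp: A_def)
  ultimately obtain C where C: "subgroup C ?G" "A \<subseteq> C" "countable C" "group_elem_equiv ?G (aff_group\<lparr>carrier := C\<rparr>)"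
    using lowenheim_skolem[OF B.group_axioms] by metis
  show ?thesis
  proof (rule that[OF C(1) C(3)])
    show "icc (aff_group\<lparr>carrier := C\<rparr>)"
      by (rule icc_aff_subgroup[OF C(1) inf]) (use C(2) in \<open>auto simp: A_def\<close>)
    show "ping_pong (aff_group\<lparr>carrier := C\<rparr>)"
      using ab(3)[OF C(1)] C(2) by (auto simp: A_def)
    show "group_elem_equiv ?H (aff_group\<lparr>carrier := C\<rparr>)"
      using group_elem_equiv C(4) by (rule group_elem_equiv_trans)
  qed
qed

theorem proposition3p1:
  shows "\<exists>(G :: nat monoid) (H :: nat monoid).
    group G \<and> countable (carrier G) \<and> icc G \<and>
    group H \<and> countable (carrier H) \<and> icc H \<and>
    group_elem_equiv G H \<and>
    \<not> tracial_elem_equiv (group_vN G) (group_vN H)"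
proof -
  let ?H = "aff_group :: (bit alg_closure vec2 \<times> bit alg_closure mat2) monoid"
  note H0 = aff_group_over_alg_closure
  obtain C :: "(bit alg_closure ultrapower vec2 \<times> bit alg_closure ultrapower mat2) set"
    where C: "subgroup C aff_group" "countable C" "icc (aff_group\<lparr>carrier := C\<rparr>)"
      "ping_pong (aff_group\<lparr>carrier := C\<rparr>)" "group_elem_equiv ?H (aff_group\<lparr>carrier := C\<rparr>)"
    by (rule countable_elementary_extension)
  let ?G = "aff_group\<lparr>carrier := C\<rparr>"
  have G0: "group ?G"
    using C(1) group_aff_group by (rule subgroup.subgroup_is_group)
  obtain G :: "nat monoid" and f where G: "group G" "f \<in> iso ?G G"
    using countable_group_nat_copy[OF G0] C(2) by auto
  obtain H :: "nat monoid" and h where H: "group H" "h \<in> iso ?H H"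
    using countable_group_nat_copy[OF H0(1,2)] by blast
  interpret G: group_iso_pair ?G G f "inv_into (carrier ?G) f"
    by (rule group_iso_pairI[OF G0 G])
  interpret H: group_iso_pair ?H H h "inv_into (carrier ?H) h"
    by (rule group_iso_pairI[OF H0(1) H])
  have "group_elem_equiv G ?H"
    by (rule group_elem_equiv_sym[OF group_elem_equiv_trans[OF C(5) group_elem_equiv_iso[OF G0 G]]])
  then have "group_elem_equiv G H"
    using group_elem_equiv_iso[OF H0(1) H] by (rule group_elem_equiv_trans)
  \<comment> \<open>The value is at least 1/64 on the left and at most 0 on the right.\<close>
  moreover have "sentence_value (group_vN G) gap_sentence \<noteq> sentence_value (group_vN H) gap_sentence"
    using G.B.gap_sentence_ping_pong[OF G.ping_pong_transport[OF C(4)]]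
      H.B.gap_sentence_locally_central_projections[OF H.locally_central_projections_transport[OF H0(4)]] by simp
  then have "\<not> tracial_elem_equiv (group_vN G) (group_vN H)"
    using tracial_sentence_gap unfolding tracial_elem_equiv_def by blast
  moreover have "icc G" "icc H"
    using G.icc_transport[OF C(3)] H.icc_transport[OF H0(3)] by simp_all
  ultimately show ?thesis
    using G(1) H(1) by blast
qed

end
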